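(* Let $\Gamma\subset\mathbb R^2$ be a $C^2$-regular boundary with signed distance function $\phi$, closest point projection $\pi$ and curvature $\kappa$, immersed in a triangulation $\mathcal T_h$. Let $\Gamma_h$ be the union of the positive edges in $\mathcal T_h$ and $\mathcal P_h$ the collection of triangles in $\mathcal T_h$ positively cut by $\Gamma$. For each $K\in\mathcal P_h$ let $\vartheta_K$ be the conditioning angle of $K$, let $\vartheta_K^{\rm adj}$ be the angle adjacent to the positive edge of $K$ (when defined), and let $$M_K:=\max_{\overline{B(K,h_K)}\cap\Gamma}\kappa,\qquad C_K^h:=\frac{M_K}{1-M_Kh_K}.$$ Assume that for each connected component $\gamma$ of $\Gamma$, the set $\gamma_h:=\{x\in\Gamma_h:\pi(x)\in\gamma\}$ is nonempty. Suppose that for each $K\in\mathcal P_h$: (a) $h_K<r_n$; (b) $\vartheta_K<90^\circ$; (c) $0<\sigma_KC_K^hh_K<\min\{\cos\vartheta_K,\ \sin(\vartheta_K/2)\}$; (d) $C_K^hh_K<\tfrac12\sin\vartheta_K^{\rm adj}$ whenever $\vartheta_K^{\rm adj}$ is defined. Then: (i) each positive edge in $\Gamma_h$ is an edge of precisely one triangle in $\mathcal P_h$; (ii) for each positive edge $e\subset\Gamma_h$, $\pi$ is a $C^1$-diffeomorphism over the relative interior $\mathbf{ri}(e)$; (iii) if $K=(p,q,r)\in\mathcal P_h$ has positive edge $e_{pq}$, then $$-C_K^hh_K^2<\phi(x)\le h_K\qquad\forall x\in e_{pq},$$ and the Jacobian $J$ of the map $\pi:\mathbf{ri}(e_{pq})\to\Gamma$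 satisfies $$0<\frac{\sin(\beta_K-\vartheta_K)}{1+M_Kh_K}\le J(x)=\left|\nabla\pi(x)\cdot\frac{p-q}{d(p,q)}\right|\le\frac1{1-M_Kh_K}\qquad\forall x\in\mathbf{ri}(e_{pq}),$$ where $\cos\beta_K:=C_K^h\sigma_Kh_K-\eta_K$ with $\beta_K\in[0^\circ,180^\circ]$, and $\eta_K:=\dfrac{\min\{\phi(p),\phi(q)\}-\phi(r)}{h_K}$; (iv) the map $\pi:\Gamma_h\to\Gamma$ is a homeomorphism. In particular, for each connected component $\gamma$ of $\Gamma$, the set $\gamma_h$ is a simple, closed curve.
   Context: $d$ is the Euclidean distance on $\mathbb R^2$, $B(x,\varepsilon)=\{y:d(x,y)<\varepsilon\}$, and $B(A,\varepsilon)=\bigcup_{x\in A}B(x,\varepsilon)$ for $A\subset\mathbb R^2$. Curve. A $C^2$-regular boundary is $\Gamma=\partial\Omega$ where $\Omega\subset\mathbb R^2$ is bounded and open and there is $\Psi\in C^2(\mathbb R^2,\mathbb R)$ with $\Omega=\{\Psi<0\}$ and $|\nabla\Psi|\ge1$ wherever $\Psi=0$. The signed distance $\phi$ is $-\min_{y\in\Gamma}d(\cdot,y)$ on $\Omega$ and $+\min_{y\in\Gamma}d(\cdot,y)$ elsewhere; the closest point projection is $\pi(\cdot)=\arg\min_{y\in\Gamma}d(\cdot,y)$. The number $r_n>0$ is fixed such that (by a known theorem) on $B(\Gamma,r_n)$ both $\phi$ and $\pi$ are well defined (single valued), $\phi$ is $C^2$, $\pi$ is a $C^1$ retraction onto $\Gamma$,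 and $x\mapsto(\phi(x),\pi(x))$ is a $C^1$-diffeomorphism of $B(\Gamma,r_n)$ onto $(-r_n,r_n)\times\Gamma$ with inverse $(s,\xi)\mapsto\xi+s\hat N(\xi)$, $\hat N$ being the unit outward normal to $\Omega$. The curvature is $\kappa=|\kappa_s|$, with $\kappa_s$ the signed curvature of $\Gamma$. Triangulation. $\mathcal T_h$ is a (finite) triangulation of a polygonal domain: a finite vertex set and a finite set of nondegenerate triangles, the closures of any two distinct triangles meeting in the empty set, a common vertex or a common edge. A triangle $K=(p,q,r)$ is the open triangle with vertices $p,q,r$. $e_{pq}$ is the closed segment with endpoints $p,q$, and $\mathbf{ri}(e_{pq})=e_{pq}\setminus\{p,q\}$. $h_K$ is the diameter of $K$, $\rho_K$ the diameter of the largest ball contained in $\overline K$, and $\sigma_K=h_K/\rho_K$. $\Gamma$ is immersed in $\mathcal T_h$ if $\Gamma\subset\mathrm{int}\big(\bigcup_{K\in\mathcal T_h}\overline K\big)$. A triangle of $\mathcal T_h$ is positively cut by $\Gamma$ if $\phi\ge0$ at precisely two of its vertices. A positive edge is an edge with $\phi\ge0$ at both of its vertices that is an edge of a positively cut triangle. The proximal vertex of a positively cut triangle is the vertex of its positive edge closest to $\Gamma$; if both are equidistant from $\Gamma$, it is the one with the smaller interior angle, and if the angles are equal as well, either one may be chosen. The conditioning angle of a positively cut triangle is its interior angle at the proximal vertex. If $K,K^{\rm adj}\in\mathcal T_h$, $K$ is positively cut with positive edge $e$, $e\cap\Gamma\ne\emptyset$ and $\overline K\cap\overline{K^{\rm adj}}=e$,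 then the angle adjacent to the positive edge of $K$, $\vartheta_K^{\rm adj}$, is the minimum of the interior angles of $K^{\rm adj}$ at the two vertices of $e$ (otherwise it is undefined). "$C^1$-diffeomorphism over $\mathbf{ri}(e)$" means a $C^1$-diffeomorphism from $\mathbf{ri}(e)$ onto its image in $\Gamma$. *)

theory Defs
  imports "HOL-Analysis.Analysis"
begin

section \<open>Differentiability classes\<close>

text \<open>Intended for open \<open>S\<close>.\<close>

definition C1_on_open ::
    "'a::real_normed_vector set \<Rightarrow> ('a \<Rightarrow> 'b::real_normed_vector) \<Rightarrow> bool" where
  "C1_on_open S f \<longleftrightarrow>
     (\<exists>f' :: 'a \<Rightarrow> 'a \<Rightarrow>\<^sub>L 'b.
        (\<forall>x\<in>S. (f has_derivative blinfun_apply (f' x)) (at x)) \<and> continuous_on S f')"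

definition C2_on_open ::
    "'a::real_normed_vector set \<Rightarrow> ('a \<Rightarrow> 'b::real_normed_vector) \<Rightarrow> bool" where
  "C2_on_open S f \<longleftrightarrow>
     (\<exists>f' :: 'a \<Rightarrow> 'a \<Rightarrow>\<^sub>L 'b.
        (\<forall>x\<in>S. (f has_derivative blinfun_apply (f' x)) (at x)) \<and> C1_on_open S f')"

text \<open>On an arbitrary subset of a Euclidean space (e.g. an arc of \<open>\<Gamma>\<close>, or \<open>(-r, r) \<times> \<Gamma>\<close>),
  a map is \<open>C\<^sup>1\<close> if near each point it is the restriction of a \<open>C\<^sup>1\<close> map of an open set.
  For submanifolds this is the same as being \<open>C\<^sup>1\<close> in charts.\<close>

definition C1_on_set ::
    "'a::real_normed_vector set \<Rightarrow> ('a \<Rightarrow> 'b::real_normed_vector) \<Rightarrow> bool" where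
  "C1_on_set X f \<longleftrightarrow>
     (\<forall>x\<in>X. \<exists>U F. open U \<and> x \<in> U \<and> C1_on_open U F \<and> (\<forall>y\<in>X \<inter> U. F y = f y))"

definition C1_diffeomorphism ::
    "'a::real_normed_vector set \<Rightarrow> 'b::real_normed_vector set \<Rightarrow> ('a \<Rightarrow> 'b) \<Rightarrow> ('b \<Rightarrow> 'a) \<Rightarrow> bool"
  where
  "C1_diffeomorphism X Y f g \<longleftrightarrow> homeomorphism X Y f g \<and> C1_on_set X f \<and> C1_on_set Y g"

section \<open>Curves bounding planar open sets\<close>

text \<open>The curve is \<open>\<Gamma> = frontier \<Omega>\<close>; all notions attached to it take \<open>\<Omega>\<close> as argument.
  The closest point projection onto \<open>\<Gamma>\<close> is \<^const>\<open>closest_point\<close> of the library.\<close>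

definition C2_regular_boundary :: "(real^2) set \<Rightarrow> bool" where
  "C2_regular_boundary \<Omega> \<longleftrightarrow>
     bounded \<Omega> \<and> open \<Omega> \<and>
     (\<exists>\<Psi> :: real^2 \<Rightarrow> real. C2_on_open UNIV \<Psi> \<and> \<Omega> = {x. \<Psi> x < 0} \<and>
        (\<forall>x. \<Psi> x = 0 \<longrightarrow> (\<exists>D. GDERIV \<Psi> x :> D \<and> 1 \<le> norm D)))"

definition signed_distance :: "(real^2) set \<Rightarrow> real^2 \<Rightarrow> real" where
  "signed_distance \<Omega> x =
     (if x \<in> \<Omega> then - infdist x (frontier \<Omega>) else infdist x (frontier \<Omega>))"

definition nbhd :: "(real^2) set \<Rightarrow> real \<Rightarrow> (real^2) set" where
  "nbhd A \<epsilon> = (\<Union>x\<in>A. ball x \<epsilon>)"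

definition tangent_vector :: "(real^2) set \<Rightarrow> real^2 \<Rightarrow> real^2 \<Rightarrow> bool" where
  "tangent_vector S \<xi> v \<longleftrightarrow>
     (\<exists>c. c 0 = \<xi> \<and> (\<forall>\<^sub>F t in at 0. c t \<in> S) \<and> (c has_vector_derivative v) (at 0))"

definition outward_normal :: "(real^2) set \<Rightarrow> real^2 \<Rightarrow> real^2" where
  "outward_normal \<Omega> \<xi> =
     (THE n. norm n = 1 \<and>
        (\<forall>v. tangent_vector (frontier \<Omega>) \<xi> v \<longrightarrow> n \<bullet> v = 0) \<and>
        (\<forall>\<^sub>F t in at_right 0. \<xi> - t *\<^sub>R n \<in> \<Omega> \<and> \<xi> + t *\<^sub>R n \<notin> closure \<Omega>))"

text \<open>\<open>dT/ds = \<kappa>\<^sub>s N\<close> for the unit tangent \<open>T = c' / |c'|\<close> of a regular \<open>C\<^sup>2\<close> parametrization \<open>c\<close>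
  of \<open>\<Gamma>\<close> near \<open>\<xi> = c 0\<close>, where \<open>ds = |c'| dt\<close>. The value does not depend on the
  parametrization or its orientation. The sign convention is immaterial here, as only
  the absolute value is used.\<close>

definition signed_curvature :: "(real^2) set \<Rightarrow> real^2 \<Rightarrow> real" where
  "signed_curvature \<Omega> \<xi> =
     (THE k. \<exists>\<delta>>0. \<exists>c c' c''.
        c 0 = \<xi> \<and>
        (\<forall>t\<in>{-\<delta><..<\<delta>}. c t \<in> frontier \<Omega> \<and> c' t \<noteq> 0 \<and>
           (c has_vector_derivative c' t) (at t) \<and> (c' has_vector_derivative c'' t) (at t)) \<and>
        continuous_on {-\<delta><..<\<delta>} c'' \<and>
        ((\<lambda>t. sgn (c' t)) has_vector_derivative (norm (c' 0) * k) *\<^sub>R outward_normal \<Omega> \<xi>) (at 0))"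

definition curvature :: "(real^2) set \<Rightarrow> real^2 \<Rightarrow> real" where
  "curvature \<Omega> \<xi> = \<bar>signed_curvature \<Omega> \<xi>\<bar>"

definition tubular_radius :: "(real^2) set \<Rightarrow> real \<Rightarrow> bool" where
  "tubular_radius \<Omega> r \<longleftrightarrow>
     0 < r \<and>
     (\<forall>x\<in>nbhd (frontier \<Omega>) r. \<exists>!y. y \<in> frontier \<Omega> \<and> (\<forall>z\<in>frontier \<Omega>. dist x y \<le> dist x z)) \<and>
     C2_on_open (nbhd (frontier \<Omega>) r) (signed_distance \<Omega>) \<and>
     C1_on_open (nbhd (frontier \<Omega>) r) (closest_point (frontier \<Omega>)) \<and>
     retraction (nbhd (frontier \<Omega>) r) (frontier \<Omega>) (closest_point (frontier \<Omega>)) \<and>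
     C1_diffeomorphism (nbhd (frontier \<Omega>) r) ({-r<..<r} \<times> frontier \<Omega>)
       (\<lambda>x. (signed_distance \<Omega> x, closest_point (frontier \<Omega>) x))
       (\<lambda>(s, \<xi>). \<xi> + s *\<^sub>R outward_normal \<Omega> \<xi>)"

section \<open>Triangles and triangulations\<close>

text \<open>A triangle is represented by its closure \<open>K\<close>, a 2-simplex of the library; the open triangle
  is \<open>interior K\<close>. The vertices of a triangle or of an edge are its extreme points.\<close>

definition planar_triangulation :: "(real^2) set set \<Rightarrow> bool" where
  "planar_triangulation \<T> \<longleftrightarrow> triangulation \<T> \<and> (\<forall>K\<in>\<T>. 2 simplex K)"

definition is_triangle :: "(real^2) set \<Rightarrow> real^2 \<Rightarrow> real^2 \<Rightarrow> real^2 \<Rightarrow> bool" where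
  "is_triangle K p q r \<longleftrightarrow> \<not> collinear {p, q, r} \<and> K = convex hull {p, q, r}"

definition interior_angle :: "(real^2) set \<Rightarrow> real^2 \<Rightarrow> real" where
  "interior_angle K v =
     (THE \<theta>. \<exists>a b. is_triangle K v a b \<and>
        \<theta> = arccos (((a - v) \<bullet> (b - v)) / (norm (a - v) * norm (b - v))))"

definition inball_diameter :: "(real^2) set \<Rightarrow> real" where
  "inball_diameter K = Sup {diameter (ball x s) | x s. ball x s \<subseteq> K}"

definition shape_parameter :: "(real^2) set \<Rightarrow> real" where
  "shape_parameter K = diameter K / inball_diameter K"

section \<open>Curves immersed in a triangulation\<close>

definition immersed :: "(real^2) set \<Rightarrow> (real^2) set set \<Rightarrow> bool" where
  "immersed \<Gamma> \<T> \<longleftrightarrow> \<Gamma> \<subseteq> interior (\<Union>\<T>)"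

definition positively_cut :: "(real^2) set \<Rightarrow> (real^2) set \<Rightarrow> bool" where
  "positively_cut \<Omega> K \<longleftrightarrow> card {v. v extreme_point_of K \<and> 0 \<le> signed_distance \<Omega> v} = 2"

definition positive_edge_of :: "(real^2) set \<Rightarrow> (real^2) set \<Rightarrow> (real^2) set \<Rightarrow> bool" where
  "positive_edge_of \<Omega> K e \<longleftrightarrow>
     positively_cut \<Omega> K \<and> e edge_of K \<and> (\<forall>v. v extreme_point_of e \<longrightarrow> 0 \<le> signed_distance \<Omega> v)"

definition positive_edges :: "(real^2) set \<Rightarrow> (real^2) set set \<Rightarrow> (real^2) set set" where
  "positive_edges \<Omega> \<T> = {e. \<exists>K\<in>\<T>. positive_edge_of \<Omega> K e}"

definition positively_cut_triangles :: "(real^2) set \<Rightarrow> (real^2) set set \<Rightarrow> (real^2) set set" where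
  "positively_cut_triangles \<Omega> \<T> = {K\<in>\<T>. positively_cut \<Omega> K}"

definition proximal_vertex :: "(real^2) set \<Rightarrow> (real^2) set \<Rightarrow> real^2 \<Rightarrow> bool" where
  "proximal_vertex \<Omega> K p \<longleftrightarrow>
     (\<exists>q. positive_edge_of \<Omega> K (closed_segment p q) \<and>
        (infdist p (frontier \<Omega>) < infdist q (frontier \<Omega>) \<or>
         infdist p (frontier \<Omega>) = infdist q (frontier \<Omega>) \<and>
           interior_angle K p \<le> interior_angle K q))"

definition conditioning_angle :: "(real^2) set \<Rightarrow> (real^2) set \<Rightarrow> real" where
  "conditioning_angle \<Omega> K = interior_angle K (SOME p. proximal_vertex \<Omega> K p)"

text \<open>The angle adjacent to the positive edge is a partial notion, hence a relation; where it is
  undefined, no \<open>\<theta>\<close> satisfies it. There is at most one \<open>\<theta>\<close>, since at most two triangles of a planar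
  triangulation share an edge.\<close>

definition is_adjacent_angle ::
    "(real^2) set \<Rightarrow> (real^2) set set \<Rightarrow> (real^2) set \<Rightarrow> real \<Rightarrow> bool" where
  "is_adjacent_angle \<Omega> \<T> K \<theta> \<longleftrightarrow>
     (\<exists>p q. \<exists>K'\<in>\<T>. positive_edge_of \<Omega> K (closed_segment p q) \<and>
        closed_segment p q \<inter> frontier \<Omega> \<noteq> {} \<and> K \<inter> K' = closed_segment p q \<and>
        \<theta> = min (interior_angle K' p) (interior_angle K' q))"

text \<open>The supremum is a maximum, since the curvature is continuous on the compact set \<open>\<Gamma>\<close>.\<close>

definition max_curvature :: "(real^2) set \<Rightarrow> (real^2) set \<Rightarrow> real" where
  "max_curvature \<Omega> K =
     (SUP \<xi>\<in>closure (nbhd (interior K) (diameter K)) \<inter> frontier \<Omega>. curvature \<Omega> \<xi>)"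

definition curvature_const :: "(real^2) set \<Rightarrow> (real^2) set \<Rightarrow> real" where
  "curvature_const \<Omega> K = max_curvature \<Omega> K / (1 - max_curvature \<Omega> K * diameter K)"

text \<open>Jacobian at \<open>x\<close> of the restriction of \<open>f\<close> to the open segment between \<open>p\<close> and \<open>q\<close>: the speed of
  \<open>f\<close> along the arc-length parametrization of the segment through \<open>x\<close>.\<close>

definition segment_jacobian :: "(real^2 \<Rightarrow> real^2) \<Rightarrow> real^2 \<Rightarrow> real^2 \<Rightarrow> real^2 \<Rightarrow> real" where
  "segment_jacobian f p q x =
     norm (vector_derivative (\<lambda>t. f (x + t *\<^sub>R sgn (q - p))) (at 0))"

end

theory Submission
  imports Defs
begin

text \<open>The proof has an analytic part, which concerns one positively cut triangle, and a topological
part, which puts the triangles together.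

Write \<open>\<nu> x\<close> for the outward normal at the foot point of \<open>x\<close>. In the tubular neighbourhood
\<open>x = \<pi> x + \<phi> x \<nu> x\<close>, and \<open>\<nu>\<close> is the gradient of \<open>\<phi>\<close>, since \<open>\<phi>\<close> is 1-Lipschitz and grows at rate 1
along normal lines. As \<open>\<nu>\<close> has unit length and is constant along normal lines, its derivative
vanishes on \<open>\<nu>\<close> and has values orthogonal to \<open>\<nu>\<close>; in the plane it is thus determined by one number, the
curvature of the level line. Differentiating \<open>\<nu> = \<nu> \<circ> \<pi>\<close> expresses this number by the curvature
\<open>\<kappa>\<close> at the foot point (\<open>level_curvature_foot\<close>), and differentiating \<open>\<pi> = id - \<phi> \<nu>\<close> gives the
derivative of \<open>\<pi>\<close>: the tangential component is multiplied by \<open>1 / (1 + \<phi> \<kappa>)\<close>, up to the sign of \<open>\<kappa>\<close>. On a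
positively cut triangle, all of whose points have distance at most \<open>h\<close> from the curve, this bounds
the stretching of \<open>\<pi>\<close> and makes \<open>\<nu>\<close> Lipschitz with constant \<open>C\<close>.

Consequently \<open>\<nu>\<close> varies by at most \<open>C h\<close> on the triangle. Since \<open>\<phi>\<close> decreases from the proximal to
the negative vertex and does not decrease along the positive edge, \<open>\<nu>\<close> lies in a
sector on the far side of the positive edge, bounded away from the direction of the edge
(\<open>normal_sector\<close>). This gives the bounds for the Jacobian. It also shows that a positive edge
belongs to just one positively cut triangle, as \<open>\<nu>\<close> cannot point away from triangles on both sides. Two points
with the same projection differ by a multiple of \<open>\<nu>\<close>, so \<open>\<pi>\<close> is injective on each edge; its
inverse intersects normal lines with the line of the edge, which is a \<open>C\<^sup>1\<close> operation.

For the global statements, consider the union of all triangles with a vertex in \<open>\<Omega>\<close>. Its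
frontier consists of the positive edges and of boundary edges of the triangulation contained in \<open>\<Omega>\<close>. At
a point of a positive edge, the normal line leaves the union in the direction of \<open>\<nu>\<close>
(\<open>Gamma_h_crossing\<close>): this is clear inside an edge, and at a vertex it follows by moving on the two half
circles from \<open>-\<nu>\<close> to \<open>\<nu>\<close>, on which all positive edges are crossed outwards. The same argument shows
that exactly two positive edges meet at each vertex, one on each side of the normal line. If two
points of \<open>\<Gamma>\<^sub>h\<close> had the same projection, the normal line between them would have to enter the
union without crossing a positive edge outwards. It could do so only through boundary edges inside \<open>\<Omega>\<close>, and
the condition on the adjacent angle excludes this: the part of the normal line above a point of \<open>\<Gamma>\<^sub>h\<close> that
lies in \<open>\<Omega>\<close> stays in the adjacent triangle, whose vertices lie outside \<open>\<Omega>\<close>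
(\<open>above_submerged_point\<close>). So \<open>\<pi>\<close> is injective on \<open>\<Gamma>\<^sub>h\<close>. Since the normal lines near a given one
also leave the union, they meet \<open>\<Gamma>\<^sub>h\<close>, and the image of \<open>\<pi>\<close> is open in \<open>\<Gamma>\<close>; being compact, it contains each
component of \<open>\<Gamma>\<close> that it meets. Finally, a finite straight-line graph whose vertices all have
degree two is a disjoint union of simple closed polygons (\<open>simple_closed_component\<close>).\<close>

section \<open>Planar cross product and triangles\<close>

definition cross :: "real^2 \<Rightarrow> real^2 \<Rightarrow> real" where
  "cross u v = u$1 * v$2 - u$2 * v$1"

definition rot :: "real^2 \<Rightarrow> real^2" where
  "rot u = vector [- u$2, u$1]"

lemma inner_real2: "u \<bullet> v = u$1 * v$1 + u$2 * v$2" for u v :: "real^2"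
  by (simp add: inner_vec_def sum_2)

lemma vec_eq_real2: "u = v \<longleftrightarrow> u$1 = v$1 \<and> u$2 = v$2" for u v :: "real^2"
  by (simp add: vec_eq_iff forall_2)

lemma rot_nth [simp]: "rot u $ 1 = - u$2" "rot u $ 2 = u$1"
  by (simp_all add: rot_def)

lemma cross_rot: "cross u v = rot u \<bullet> v"
  by (simp add: cross_def inner_real2)

lemma rot_inner_self [simp]: "rot u \<bullet> u = 0" "u \<bullet> rot u = 0"
  by (simp_all add: inner_real2)

lemma inner_rot_rot [simp]: "rot u \<bullet> rot v = u \<bullet> v"
  by (simp add: inner_real2)

lemma norm_rot [simp]: "norm (rot u) = norm u"
  by (simp add: norm_eq_sqrt_inner)

lemma cross_simps:
  "cross (u + v) w = cross u w + cross v w" "cross w (u + v) = cross w u + cross w v"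
  "cross (u - v) w = cross u w - cross v w" "cross w (u - v) = cross w u - cross w v"
  "cross (a *\<^sub>R u) w = a * cross u w" "cross w (a *\<^sub>R u) = a * cross w u"
  "cross u u = 0"
  by (simp_all add: cross_def algebra_simps)

lemma cross_commute: "cross u v = - cross v u"
  by (simp add: cross_def)

lemma cross_eq_0_iff: "cross u v = 0 \<longleftrightarrow> u = 0 \<or> (\<exists>c. v = c *\<^sub>R u)"
proof
  assume *: "cross u v = 0"
  show "u = 0 \<or> (\<exists>c. v = c *\<^sub>R u)"
  proof (cases "u = 0")
    case False
    then have "u \<bullet> u \<noteq> 0" by simp
    moreover have "(u \<bullet> u) *\<^sub>R v = (u \<bullet> v) *\<^sub>R u"
      using * unfolding vec_eq_real2 cross_def inner_real2
      by (simp add: algebra_simps)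
    ultimately have "v = ((u \<bullet> v) / (u \<bullet> u)) *\<^sub>R u"
      by (metis (no_types, lifting) divide_inverse_commute scaleR_one scaleR_scaleR left_inverse)
    then show ?thesis by blast
  qed simp
next
  assume "u = 0 \<or> (\<exists>c. v = c *\<^sub>R u)"
  then show "cross u v = 0" by (auto simp: cross_def)
qed

lemma cross_sq_plus_inner_sq: "(cross u v)\<^sup>2 + (u \<bullet> v)\<^sup>2 = (norm u)\<^sup>2 * (norm v)\<^sup>2"
  unfolding power2_norm_eq_inner
  by (simp add: cross_def inner_real2 power2_eq_square algebra_simps)

lemma abs_cross_le: "\<bar>cross u v\<bar> \<le> norm u * norm v"
  using Cauchy_Schwarz_ineq2[of "rot u" v] by (simp add: cross_rot)

lemma orthonormal_expansion:
  assumes "norm n = 1"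
  shows "v = (n \<bullet> v) *\<^sub>R n + (rot n \<bullet> v) *\<^sub>R rot n"
proof -
  have *: "n$1 * n$1 + n$2 * n$2 = 1"
    using assms by (simp add: norm_eq_1 inner_real2)
  have "v$1 = (n$1 * n$1 + n$2 * n$2) * v$1" "v$2 = (n$1 * n$1 + n$2 * n$2) * v$2"
    unfolding * by auto
  then show ?thesis
    unfolding vec_eq_real2 by (simp add: inner_real2 algebra_simps)
qed

lemma collinear_iff_cross: "collinear {p, q, r} \<longleftrightarrow> cross (q - p) (r - p) = 0"
proof -
  have "collinear {p, q, r} \<longleftrightarrow> collinear {q, p, r}" by (simp add: insert_commute)
  also have "\<dots> \<longleftrightarrow> collinear {0, q - p, r - p}" using collinear_3[of q p r] by (simp add: NO_MATCH_def)
  also have "\<dots> \<longleftrightarrow> cross (q - p) (r - p) = 0"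
    unfolding collinear_lemma cross_eq_0_iff by (metis scaleR_zero_left)
  finally show ?thesis .
qed

lemma cross_triangle_cyclic: "cross (q - p) (r - p) = cross (r - q) (p - q)"
  "cross (q - p) (r - p) = cross (p - r) (q - r)"
  by (simp_all add: cross_def algebra_simps)

lemma is_triangleD:
  assumes "is_triangle K p q r"
  shows "cross (q - p) (r - p) \<noteq> 0" "p \<noteq> q" "q \<noteq> r" "p \<noteq> r" "K = convex hull {p, q, r}"
    "\<not> affine_dependent {p, q, r}"
  using assms unfolding is_triangle_def
  by (auto simp: collinear_iff_cross[symmetric] collinear_3_eq_affine_dependent)

lemma is_triangle_perm:
  assumes "is_triangle K p q r"
  shows "is_triangle K q r p" "is_triangle K r p q" "is_triangle K q p r" "is_triangle K p r q"
    "is_triangle K r q p"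
  using assms by (simp_all add: is_triangle_def insert_commute)

text \<open>The barycentric coordinates are quotients of signed areas, so that membership in a triangle and in its
  interior is a matter of signs.\<close>

lemma barycentric_expansion:
  assumes "cross (q - p) (r - p) \<noteq> 0"
  shows "z = (1 - cross (z - p) (r - p) / cross (q - p) (r - p)
                - cross (q - p) (z - p) / cross (q - p) (r - p)) *\<^sub>R p
           + (cross (z - p) (r - p) / cross (q - p) (r - p)) *\<^sub>R q
           + (cross (q - p) (z - p) / cross (q - p) (r - p)) *\<^sub>R r"
proof -
  define A where "A = cross (q - p) (r - p)"
  have A: "A \<noteq> 0" using assms A_def by simp
  have "A *\<^sub>R z = (A - cross (z - p) (r - p) - cross (q - p) (z - p)) *\<^sub>R p
           + cross (z - p) (r - p) *\<^sub>R q + cross (q - p) (z - p) *\<^sub>R r"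
    unfolding vec_eq_real2 by (simp add: A_def cross_def algebra_simps)
  then have "(1/A) *\<^sub>R (A *\<^sub>R z) = (1/A) *\<^sub>R ((A - cross (z - p) (r - p) - cross (q - p) (z - p)) *\<^sub>R p
           + cross (z - p) (r - p) *\<^sub>R q + cross (q - p) (z - p) *\<^sub>R r)" by simp
  then show ?thesis using A
    by (simp add: A_def[symmetric] scaleR_add_right diff_divide_distrib)
qed

lemma barycentric_cross:
  assumes "z = a *\<^sub>R p + b *\<^sub>R q + c *\<^sub>R r" "a + b + c = 1"
  shows "cross (z - p) (r - p) = b * cross (q - p) (r - p)"
    "cross (q - p) (z - p) = c * cross (q - p) (r - p)"
proof -
  have a: "a = 1 - b - c" using assms(2) by simp
  show "cross (z - p) (r - p) = b * cross (q - p) (r - p)"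
    "cross (q - p) (z - p) = c * cross (q - p) (r - p)"
    unfolding assms(1) a by (simp_all add: cross_def algebra_simps)
qed

lemma triangle_mem_iff:
  assumes "is_triangle K p q r"
  shows "z \<in> K \<longleftrightarrow> 0 \<le> cross (z - p) (r - p) / cross (q - p) (r - p) \<and>
     0 \<le> cross (q - p) (z - p) / cross (q - p) (r - p) \<and>
     cross (z - p) (r - p) / cross (q - p) (r - p) + cross (q - p) (z - p) / cross (q - p) (r - p) \<le> 1"
    (is "_ \<longleftrightarrow> ?R")
proof
  note D = is_triangleD[OF assms]
  assume "z \<in> K"
  then obtain a b c where *: "0 \<le> a" "0 \<le> b" "0 \<le> c" "a + b + c = 1"
    "z = a *\<^sub>R p + b *\<^sub>R q + c *\<^sub>R r"
    unfolding D(5) convex_hull_3 by auto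
  show ?R using barycentric_cross[OF *(5,4)] * D(1) by simp
next
  note D = is_triangleD[OF assms]
  assume ?R
  then show "z \<in> K"
    unfolding D(5) convex_hull_3 mem_Collect_eq
    by (intro exI[of _ "1 - cross (z - p) (r - p) / cross (q - p) (r - p)
                - cross (q - p) (z - p) / cross (q - p) (r - p)"]
        exI[of _ "cross (z - p) (r - p) / cross (q - p) (r - p)"]
        exI[of _ "cross (q - p) (z - p) / cross (q - p) (r - p)"] conjI
        barycentric_expansion[OF D(1)]) auto
qed

lemma triangle_interior_iff:
  assumes "is_triangle K p q r"
  shows "z \<in> interior K \<longleftrightarrow> 0 < cross (z - p) (r - p) / cross (q - p) (r - p) \<and>
     0 < cross (q - p) (z - p) / cross (q - p) (r - p) \<and>
     cross (z - p) (r - p) / cross (q - p) (r - p) + cross (q - p) (z - p) / cross (q - p) (r - p) < 1"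
    (is "_ \<longleftrightarrow> ?R")
proof -
  note D = is_triangleD[OF assms]
  have nc: "\<not> collinear {p, q, r}" using assms is_triangle_def by blast
  note int = interior_convex_hull_3_minimal[OF nc, simplified]
  show ?thesis
  proof
    assume "z \<in> interior K"
    then obtain a b c where *: "0 < a" "0 < b" "0 < c" "a + b + c = 1"
      "z = a *\<^sub>R p + b *\<^sub>R q + c *\<^sub>R r"
      unfolding D(5) int by auto
    show ?R using barycentric_cross[OF *(5,4)] * D(1) by simp
  next
    assume ?R
    then show "z \<in> interior K"
      unfolding D(5) int mem_Collect_eq
      by (intro exI[of _ "1 - cross (z - p) (r - p) / cross (q - p) (r - p)
                - cross (q - p) (z - p) / cross (q - p) (r - p)"]
        exI[of _ "cross (z - p) (r - p) / cross (q - p) (r - p)"]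
        exI[of _ "cross (q - p) (z - p) / cross (q - p) (r - p)"] conjI
        barycentric_expansion[OF D(1), symmetric]) auto
  qed
qed

lemma triangle_interior_nonempty:
  assumes "is_triangle K p q r"
  shows "interior K \<noteq> {}"
proof -
  have "p + (1/3) *\<^sub>R (q - p) + (1/3) *\<^sub>R (r - p) \<in> interior K"
    using is_triangleD(1)[OF assms]
    by (simp add: triangle_interior_iff[OF assms] cross_simps(1,2,5,6,7) add_diff_eq[symmetric])
  then show ?thesis by blast
qed

lemma simplex_2_is_triangle:
  assumes "2 simplex K"
  shows "\<exists>p q r. is_triangle K p q r"
proof -
  obtain C where C: "\<not> affine_dependent C" "card C = 3" "K = convex hull C"
    using assms unfolding simplex_def by auto
  obtain p q r where "C = {p, q, r}" "p \<noteq> q" "q \<noteq> r" "p \<noteq> r"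
    using C(2) card_3_iff by metis
  then show ?thesis
    using C collinear_3_eq_affine_dependent[of p q r] unfolding is_triangle_def by blast
qed

lemma triangle_extreme_iff:
  assumes "is_triangle K p q r"
  shows "v extreme_point_of K \<longleftrightarrow> v \<in> {p, q, r}"
  using extreme_point_of_convex_hull_affine_independent[OF is_triangleD(6)[OF assms]]
    is_triangleD(5)[OF assms] by simp

lemma triangle_extreme_set:
  assumes "is_triangle K p q r"
  shows "{v. v extreme_point_of K \<and> P v} = {v\<in>{p, q, r}. P v}"
  using triangle_extreme_iff[OF assms] by auto

lemma triangle_compact:
  assumes "is_triangle K p q r"
  shows "compact K" "convex K" "closed K" "bounded K" "K \<noteq> {}"
  using is_triangleD(5)[OF assms]
  by (auto intro!: finite_imp_compact_convex_hull compact_imp_closed compact_imp_bounded)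

lemma triangle_vertices:
  assumes "is_triangle K p q r"
  shows "p \<in> K" "q \<in> K" "r \<in> K"
  using is_triangleD(5)[OF assms] by (auto intro: hull_inc)

lemma triangle_closed_segment:
  assumes "is_triangle K p q r"
  shows "closed_segment p q \<subseteq> K"
  using triangle_vertices[OF assms] triangle_compact(2)[OF assms] by (simp add: closed_segment_subset)

lemma triangle_dist_le:
  assumes "is_triangle K p q r" "x \<in> K" "y \<in> K"
  shows "dist x y \<le> diameter K"
  by (rule diameter_bounded_bound[OF triangle_compact(4)[OF assms(1)] assms(2,3)])

lemma triangle_diameter_pos:
  assumes "is_triangle K p q r"
  shows "0 < diameter K"
  using triangle_dist_le[OF assms triangle_vertices(1,2)[OF assms]] is_triangleD(2)[OF assms]
  by (smt (verit) zero_less_dist_iff)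

lemma triangle_face_iff:
  assumes "is_triangle K p q r"
  shows "F face_of K \<longleftrightarrow> (\<exists>c. c \<subseteq> {p, q, r} \<and> F = convex hull c)"
  using face_of_convex_hull_affine_independent[OF is_triangleD(6)[OF assms]]
    is_triangleD(5)[OF assms] by simp

lemma triangle_edge:
  assumes "is_triangle K p q r"
  shows "closed_segment p q edge_of K"
proof -
  have "closed_segment p q face_of K"
    unfolding triangle_face_iff[OF assms] segment_convex_hull by (intro exI[of _ "{p, q}"]) auto
  moreover have "aff_dim (closed_segment p q) = 1"
    using is_triangleD(2)[OF assms] by (simp add: segment_convex_hull aff_dim_convex_hull aff_dim_2)
  ultimately show ?thesis by (simp add: edge_of_def)
qed

lemma triangle_edge_cases:
  assumes "is_triangle K p q r" "e edge_of K"
  obtains a b c where "is_triangle K a b c" "e = closed_segment a b" "{a, b, c} = {p, q, r}"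
proof -
  obtain c where c: "c \<subseteq> {p, q, r}" "e = convex hull c"
    using assms(2) triangle_face_iff[OF assms(1), of e] by (auto simp: edge_of_def)
  have ad: "aff_dim c = 1" using assms(2) c unfolding edge_of_def by (simp add: aff_dim_convex_hull)
  have fin: "finite c" using c(1) finite_subset by blast
  have "\<not> affine_dependent c" using affine_independent_subset is_triangleD(6)[OF assms(1)] c(1) by blast
  then have "card c = 2" using aff_dim_affine_independent[of c] ad by simp
  then obtain a b where ab: "c = {a, b}" "a \<noteq> b" by (meson card_2_iff)
  have e: "e = closed_segment a b" by (simp add: c ab segment_convex_hull)
  note P = assms(1) is_triangle_perm[OF assms(1)]
  have "a = p \<and> b = q \<or> a = q \<and> b = p \<or> a = q \<and> b = r \<or> a = r \<and> b = q \<or>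
        a = p \<and> b = r \<or> a = r \<and> b = p"
    using c(1) ab by auto
  then show thesis
  proof (elim disjE conjE)
    assume "a = p" "b = q" then show ?thesis using that[OF P(1)] e by simp
  next
    assume "a = q" "b = p" then show ?thesis using that[OF P(4)] e by (simp add: insert_commute)
  next
    assume "a = q" "b = r" then show ?thesis using that[OF P(2)] e by (simp add: insert_commute)
  next
    assume "a = r" "b = q" then show ?thesis using that[OF P(6)] e by (simp add: insert_commute)
  next
    assume "a = p" "b = r" then show ?thesis using that[OF P(5)] e by (simp add: insert_commute)
  next
    assume "a = r" "b = p" then show ?thesis using that[OF P(3)] e by (simp add: insert_commute)
  qed
qed

lemma triangle_of_edge:
  assumes "is_triangle K p q r" "closed_segment a b edge_of K"
  shows "\<exists>c. is_triangle K a b c"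
proof -
  obtain a' b' c where *: "is_triangle K a' b' c" "closed_segment a b = closed_segment a' b'"
    using triangle_edge_cases[OF assms] by metis
  then have "{a, b} = {a', b'}" using closed_segment_eq by blast
  then show ?thesis using *(1) is_triangle_perm[OF *(1)] by (auto simp: doubleton_eq_iff)
qed

lemma triangle_point_cases:
  assumes "is_triangle K p q r" "z \<in> K"
  obtains "z \<in> interior K" | "z extreme_point_of K"
  | a b c where "is_triangle K a b c" "{a, b, c} = {p, q, r}" "z \<in> open_segment a b"
proof -
  note D = is_triangleD[OF assms(1)]
  have nc: "\<not> collinear {p, q, r}" using assms is_triangle_def by blast
  obtain a b c where *: "0 \<le> a" "0 \<le> b" "0 \<le> c" "a + b + c = 1"
    "z = a *\<^sub>R p + b *\<^sub>R q + c *\<^sub>R r"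
    using assms(2) unfolding D(5) convex_hull_3 by auto
  have seg: "x *\<^sub>R v + y *\<^sub>R w \<in> open_segment v w" if "x > 0" "y > 0" "x + y = 1" "v \<noteq> w"
    for x y and v w :: "real^2"
    unfolding in_segment using that by (intro conjI exI[of _ y]) (auto simp: eq_diff_eq[symmetric])
  note P = is_triangle_perm[OF assms(1)]
  have "a = 0 \<or> a > 0" "b = 0 \<or> b > 0" "c = 0 \<or> c > 0" using *(1-3) by auto
  then consider "a > 0" "b > 0" "c > 0" | "a = 0" "b > 0" "c > 0" | "a > 0" "b = 0" "c > 0"
    | "a > 0" "b > 0" "c = 0" | "a = 0" "b = 0" | "a = 0" "c = 0" | "b = 0" "c = 0"
    by blast
  then show thesis
  proof cases
    case 1
    have "z \<in> interior K"
      unfolding D(5) interior_convex_hull_3_minimal[OF nc, simplified] using 1 * by blast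
    then show ?thesis by (rule that(1))
  next
    case 2
    have "z \<in> open_segment q r" using seg[of b c q r] 2 * D by simp
    then show ?thesis using that(3)[OF P(1)] by (auto simp: insert_commute)
  next
    case 3
    have "z \<in> open_segment p r" using seg[of a c p r] 3 * D by simp
    then show ?thesis using that(3)[OF P(4)] by (auto simp: insert_commute)
  next
    case 4
    have "z \<in> open_segment p q" using seg[of a b p q] 4 * D by simp
    then show ?thesis using that(3)[OF assms(1)] by (auto simp: insert_commute)
  qed (use * that(2) triangle_extreme_iff[OF assms(1)] in auto)
qed

lemma is_triangle_third:
  assumes "is_triangle K v a b" "is_triangle K v c d"
  shows "{a, b} = {c, d}"
proof -
  have "{v, a, b} = {v, c, d}"
    using triangle_extreme_iff[OF assms(1)] triangle_extreme_iff[OF assms(2)] by blast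
  then show ?thesis using is_triangleD(2-4)[OF assms(1)] is_triangleD(2-4)[OF assms(2)]
    by (metis insert_ident insert_iff empty_iff)
qed

lemma interior_angle_eq:
  assumes "is_triangle K v a b"
  shows "interior_angle K v = arccos (((a - v) \<bullet> (b - v)) / (norm (a - v) * norm (b - v)))"
  unfolding interior_angle_def
proof (rule the_equality)
  show "\<exists>c d. is_triangle K v c d \<and> arccos ((a - v) \<bullet> (b - v) / (norm (a - v) * norm (b - v))) =
      arccos ((c - v) \<bullet> (d - v) / (norm (c - v) * norm (d - v)))"
    using assms by blast
next
  fix \<theta> assume "\<exists>c d. is_triangle K v c d \<and> \<theta> = arccos ((c - v) \<bullet> (d - v) / (norm (c - v) * norm (d - v)))"
  then obtain c d where *: "is_triangle K v c d"
    "\<theta> = arccos ((c - v) \<bullet> (d - v) / (norm (c - v) * norm (d - v)))" by blast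
  have "{a, b} = {c, d}" using is_triangle_third assms *(1) by blast
  then show "\<theta> = arccos ((a - v) \<bullet> (b - v) / (norm (a - v) * norm (b - v)))"
    using *(2) by (auto simp: doubleton_eq_iff inner_commute mult.commute)
qed

lemma interior_angle_trig:
  assumes "is_triangle K v a b"
  defines "\<theta> \<equiv> interior_angle K v"
  shows "0 < \<theta>" "\<theta> < pi" "(a - v) \<bullet> (b - v) = norm (a - v) * norm (b - v) * cos \<theta>"
    "\<bar>cross (a - v) (b - v)\<bar> = norm (a - v) * norm (b - v) * sin \<theta>"
proof -
  note D = is_triangleD[OF assms(1)]
  define L where "L = norm (a - v) * norm (b - v)"
  have L: "L > 0" using D by (simp add: L_def)
  define c where "c = ((a - v) \<bullet> (b - v)) / L"
  have sq: "(cross (a - v) (b - v))\<^sup>2 + ((a - v) \<bullet> (b - v))\<^sup>2 = L\<^sup>2"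
    unfolding L_def power_mult_distrib by (rule cross_sq_plus_inner_sq)
  have c1: "\<bar>(a - v) \<bullet> (b - v)\<bar> < L"
  proof -
    have "(cross (a - v) (b - v))\<^sup>2 > 0" using D(1) by simp
    then have "((a - v) \<bullet> (b - v))\<^sup>2 < L\<^sup>2" using sq by linarith
    then show ?thesis using L by (metis power2_abs power2_less_imp_less less_imp_le)
  qed
  then have c: "-1 < c" "c < 1" using L by (auto simp: c_def field_simps)
  have th: "\<theta> = arccos c" unfolding \<theta>_def c_def L_def by (rule interior_angle_eq[OF assms(1)])
  show "0 < \<theta>" "\<theta> < pi" using arccos_lt_bounded[of c] c th by auto
  have cos: "cos \<theta> = c" using c th by (simp add: cos_arccos)
  then show in_eq: "(a - v) \<bullet> (b - v) = norm (a - v) * norm (b - v) * cos \<theta>"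
    using L by (simp add: c_def L_def[symmetric])
  have "sin \<theta> > 0" using \<open>0 < \<theta>\<close> \<open>\<theta> < pi\<close> by (rule sin_gt_zero)
  have "(cross (a - v) (b - v))\<^sup>2 = (L * sin \<theta>)\<^sup>2"
    using sq in_eq unfolding L_def[symmetric]
    by (simp add: power_mult_distrib sin_squared_eq algebra_simps)
  then show "\<bar>cross (a - v) (b - v)\<bar> = norm (a - v) * norm (b - v) * sin \<theta>"
    unfolding L_def[symmetric] using L \<open>sin \<theta> > 0\<close>
    by (metis abs_of_pos mult_pos_pos power2_eq_iff abs_minus_cancel)
qed

text \<open>Of the three barycentric coordinates of the centre of a ball inside the triangle, one is at
  most 1/3; the corresponding height, hence the diameter, is at least three times the radius.\<close>

lemma triangle_ball_radius:
  assumes "is_triangle K p q r" "ball o' s \<subseteq> K" "0 < s"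
  shows "3 * s \<le> diameter K"
proof -
  have main: "3 * s \<le> diameter K" if t: "is_triangle K p q r"
    and c: "cross (q - p) (o' - p) / cross (q - p) (r - p) \<le> 1/3" for p q r
  proof (rule ccontr)
    note D = is_triangleD[OF t]
    assume "\<not> 3 * s \<le> diameter K"
    then have lt: "diameter K / 3 < s" by simp
    define A where "A = cross (q - p) (r - p)"
    define d where "d = diameter K / 3"
    have d0: "0 < d" using triangle_diameter_pos[OF t] by (simp add: d_def)
    define n where "n = (sgn A / norm (q - p)) *\<^sub>R rot (q - p)"
    have pq: "norm (q - p) > 0" using D by simp
    have A0: "A \<noteq> 0" using D A_def by simp
    have nn: "norm n = 1" using pq A0 by (simp add: n_def sgn_if)
    have cn: "cross (q - p) n = sgn A * norm (q - p)"
      using pq unfolding n_def cross_simps cross_rot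
      by (simp add: power2_norm_eq_inner[symmetric] power2_eq_square)
    obtain d' where d': "d < d'" "d' < s" using lt dense d_def by blast
    have "o' - d' *\<^sub>R n \<in> ball o' s" using d' d0 nn by (simp add: dist_norm)
    then have "o' - d' *\<^sub>R n \<in> K" using assms by blast
    then have "0 \<le> cross (q - p) ((o' - d' *\<^sub>R n) - p) / A"
      using triangle_mem_iff[OF t] by (simp add: A_def)
    also have "cross (q - p) ((o' - d' *\<^sub>R n) - p) = cross (q - p) (o' - p) - d' * (sgn A * norm (q - p))"
      by (simp add: cn[symmetric] cross_simps)
    also have "\<dots> / A = cross (q - p) (o' - p) / A - d' * norm (q - p) / \<bar>A\<bar>"
      using A0 by (simp add: diff_divide_distrib sgn_if)
    finally have "d' * norm (q - p) / \<bar>A\<bar> \<le> 1/3" using c[folded A_def] by linarith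
    then have "d' * norm (q - p) \<le> \<bar>A\<bar> / 3" using A0 by (simp add: field_simps)
    also have "\<bar>A\<bar> \<le> norm (q - p) * norm (r - p)" unfolding A_def by (rule abs_cross_le)
    finally have "3 * d' \<le> norm (r - p)" using pq by simp
    also have "\<dots> \<le> diameter K"
      using triangle_dist_le[OF t triangle_vertices(3,1)[OF t]] by (simp add: dist_norm)
    finally show False using d' by (simp add: d_def)
  qed
  note D = is_triangleD[OF assms(1)]
  define b where "b = cross (o' - p) (r - p) / cross (q - p) (r - p)"
  define c where "c = cross (q - p) (o' - p) / cross (q - p) (r - p)"
  have b': "b = cross (p - r) (o' - r) / cross (p - r) (q - r)"
    unfolding b_def cross_triangle_cyclic(2)[of q p r, symmetric] by (simp add: cross_def algebra_simps)
  have c': "1 - b - c = cross (r - q) (o' - q) / cross (r - q) (p - q)"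
    unfolding b_def c_def cross_triangle_cyclic(1)[of q p r, symmetric]
  proof -
    have "cross (q - p) (r - p) - cross (o' - p) (r - p) - cross (q - p) (o' - p) = cross (r - q) (o' - q)"
      by (simp add: cross_def algebra_simps)
    moreover have "1 - x / A - y / A = (A - x - y) / A" if "A \<noteq> 0" for A x y :: real
      using that by (simp add: diff_divide_distrib)
    ultimately show "1 - cross (o' - p) (r - p) / cross (q - p) (r - p) - cross (q - p) (o' - p) / cross (q - p) (r - p) =
       cross (r - q) (o' - q) / cross (q - p) (r - p)" using D(1) by simp
  qed
  have "c \<le> 1/3 \<or> b \<le> 1/3 \<or> 1 - b - c \<le> 1/3" by linarith
  then consider "c \<le> 1/3" | "b \<le> 1/3" | "1 - b - c \<le> 1/3" by blast
  then show ?thesis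
  proof cases
    case 1 then show ?thesis unfolding c_def by (rule main[OF assms(1)])
  next
    case 2 then show ?thesis unfolding b' by (rule main[OF is_triangle_perm(2)[OF assms(1)]])
  next
    case 3 then show ?thesis unfolding c' by (rule main[OF is_triangle_perm(1)[OF assms(1)]])
  qed
qed

text \<open>The constant enters the last inequality in \<open>normal_sector\<close>. (Equilateral triangles attain
  the optimal constant \<open>sqrt 3\<close>.)\<close>

lemma shape_parameter_ge:
  assumes "is_triangle K p q r"
  shows "3/2 \<le> shape_parameter K"
proof -
  define S where "S = {diameter (ball x s) | x s. ball x s \<subseteq> K}"
  have ub: "d \<le> 2/3 * diameter K" if "d \<in> S" for d
  proof -
    obtain x s where xs: "d = diameter (ball x s)" "ball x s \<subseteq> K" using \<open>d \<in> S\<close> S_def by blast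
    show ?thesis
    proof (cases "s > 0")
      case True then show ?thesis using triangle_ball_radius[OF assms xs(2)] xs by simp
    next
      case False
      then show ?thesis using xs triangle_diameter_pos[OF assms] by simp
    qed
  qed
  obtain x s where s: "s > 0" "ball x s \<subseteq> K"
    using triangle_interior_nonempty[OF assms] by (meson ex_in_conv mem_interior)
  then have "2 * s \<in> S" unfolding S_def mem_Collect_eq
    by (intro exI[of _ x] exI[of _ s]) simp
  moreover have "bdd_above S" using ub by (rule bdd_aboveI)
  ultimately have "2 * s \<le> Sup S" by (rule cSup_upper)
  then have pos: "0 < Sup S" using s by simp
  have "Sup S \<le> 2/3 * diameter K" using ub \<open>2 * s \<in> S\<close> by (intro cSup_least) auto
  then show ?thesis using pos unfolding shape_parameter_def inball_diameter_def S_def[symmetric]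
    by (simp add: field_simps)
qed

text \<open>Two of the three barycentric coordinates are positive near such a point, so only the sign of the third
  one matters.\<close>

lemma triangle_near_edge:
  assumes "is_triangle K p q r" "z \<in> open_segment p q"
  shows "\<exists>\<epsilon>>0. \<forall>u\<in>ball z \<epsilon>. u \<in> K \<longleftrightarrow> 0 \<le> cross (q - p) (u - p) * cross (q - p) (r - p)"
proof -
  note D = is_triangleD[OF assms(1)]
  define A where "A = cross (q - p) (r - p)"
  obtain t where t: "0 < t" "t < 1" "z = (1 - t) *\<^sub>R p + t *\<^sub>R q"
    using assms(2) by (auto simp: in_segment)
  define V where "V = {u. 0 < cross (u - p) (r - p) / A \<and>
     cross (u - p) (r - p) / A + cross (q - p) (u - p) / A < 1}"
  have zp: "z - p = t *\<^sub>R (q - p)" using t by (simp add: algebra_simps)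
  have "open V" unfolding V_def cross_def
    by (intro open_Collect_conj open_Collect_less continuous_intros) (use D(1) A_def in auto)
  moreover have "z \<in> V" using t D(1) A_def unfolding V_def mem_Collect_eq zp cross_simps(5,6,7)
    by simp
  ultimately obtain \<epsilon> where e: "\<epsilon> > 0" "ball z \<epsilon> \<subseteq> V" by (meson open_contains_ball)
  have "u \<in> K \<longleftrightarrow> 0 \<le> cross (q - p) (u - p) * A" if "u \<in> ball z \<epsilon>" for u
  proof -
    have "u \<in> V" using that e by blast
    then have "u \<in> K \<longleftrightarrow> 0 \<le> cross (q - p) (u - p) / A"
      unfolding triangle_mem_iff[OF assms(1)] A_def[symmetric] V_def by auto
    then show ?thesis using D(1) A_def by (auto simp: zero_le_divide_iff zero_le_mult_iff)
  qed
  then show ?thesis using e(1) A_def by blast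
qed

lemma interior_Un_opposite_triangles:
  assumes "is_triangle K p q w" "is_triangle K' p q w'" "z \<in> open_segment p q"
    and opp: "cross (q - p) (w - p) * cross (q - p) (w' - p) < 0"
  shows "z \<in> interior (K \<union> K')"
proof -
  obtain \<epsilon>1 \<epsilon>2 where e: "\<epsilon>1 > 0" "\<forall>u\<in>ball z \<epsilon>1. u \<in> K \<longleftrightarrow> 0 \<le> cross (q - p) (u - p) * cross (q - p) (w - p)"
    "\<epsilon>2 > 0" "\<forall>u\<in>ball z \<epsilon>2. u \<in> K' \<longleftrightarrow> 0 \<le> cross (q - p) (u - p) * cross (q - p) (w' - p)"
    using triangle_near_edge[OF assms(1,3)] triangle_near_edge[OF assms(2,3)] by blast
  have "ball z (min \<epsilon>1 \<epsilon>2) \<subseteq> K \<union> K'"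
  proof
    fix u assume u: "u \<in> ball z (min \<epsilon>1 \<epsilon>2)"
    have "0 \<le> cross (q - p) (u - p) * cross (q - p) (w - p) \<or> 0 \<le> cross (q - p) (u - p) * cross (q - p) (w' - p)"
      using opp by (auto simp: mult_less_0_iff zero_le_mult_iff)
    then show "u \<in> K \<union> K'" using u e by auto
  qed
  then show ?thesis unfolding mem_interior using e by (intro exI[of _ "min \<epsilon>1 \<epsilon>2"]) auto
qed

text \<open>The sign of \<open>A\<close> selects the side.\<close>

lemma point_beside_segment:
  assumes "z \<in> open_segment p q" "0 < \<epsilon>" "A \<noteq> 0"
  shows "\<exists>u\<in>ball z \<epsilon>. 0 < cross (q - p) (u - p) * A"
proof -
  have n0: "norm (q - p) > 0" using assms(1) by auto
  define m where "m = \<epsilon> / (2 * norm (q - p))"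
  have m0: "m > 0" using n0 assms(2) by (simp add: m_def)
  define u where "u = z + (m * sgn A) *\<^sub>R rot (q - p)"
  have "dist z u = m * norm (q - p)" using m0 assms(3) by (simp add: u_def dist_norm abs_mult sgn_if)
  also have "\<dots> < \<epsilon>" using n0 assms(2) by (simp add: m_def)
  finally have "u \<in> ball z \<epsilon>" by simp
  moreover obtain s where "z = (1 - s) *\<^sub>R p + s *\<^sub>R q" using assms(1) by (auto simp: in_segment)
  then have up: "u - p = s *\<^sub>R (q - p) + (m * sgn A) *\<^sub>R rot (q - p)"
    by (simp add: u_def algebra_simps)
  have "cross (q - p) (rot (q - p)) = (norm (q - p))\<^sup>2"
    by (simp add: cross_rot power2_norm_eq_inner)
  then have "cross (q - p) (u - p) * A = m * \<bar>A\<bar> * (norm (q - p))\<^sup>2"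
    unfolding up cross_simps(2,6,7) using assms(3) by (simp add: sgn_if)
  moreover have "0 < m * \<bar>A\<bar> * (norm (q - p))\<^sup>2" using m0 assms(3) n0 by simp
  ultimately show ?thesis by (intro bexI[of _ u]) simp_all
qed

section \<open>The signed distance in a tubular neighbourhood\<close>

text \<open>On a space of finite dimension, the operator norm is controlled by the values on a basis.\<close>

lemma C1_on_open_finite_dim:
  fixes f :: "'a::euclidean_space \<Rightarrow> 'b::real_normed_vector"
  assumes "\<And>x. x \<in> S \<Longrightarrow> (f has_derivative D x) (at x)"
    and "\<And>v. continuous_on S (\<lambda>x. D x v)"
  shows "C1_on_open S f"
  unfolding C1_on_open_def
proof (intro exI conjI ballI)
  have app: "blinfun_apply (Blinfun (D x)) = D x" if "x \<in> S" for x
    using assms(1)[OF that] has_derivative_bounded_linear bounded_linear_Blinfun_apply by blast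
  show "(f has_derivative blinfun_apply (Blinfun (D x))) (at x)" if "x \<in> S" for x
    using assms(1)[OF that] app[OF that] by simp
  show "continuous_on S (\<lambda>x. Blinfun (D x))"
    by (intro continuous_on_blinfun_componentwise)
       (use assms(2) app in \<open>simp cong: continuous_on_cong\<close>)
qed

locale tubular_curve =
  fixes \<Omega> :: "(real^2) set" and r :: real
  assumes bounded_Omega: "bounded \<Omega>" and open_Omega: "open \<Omega>"
    and tubular: "tubular_radius \<Omega> r"
begin

abbreviation "\<Gamma> \<equiv> frontier \<Omega>"
abbreviation "\<phi> \<equiv> signed_distance \<Omega>"
abbreviation "\<pi> \<equiv> closest_point (frontier \<Omega>)"
abbreviation "U \<equiv> nbhd (frontier \<Omega>) r"

text \<open>The normal field, extended to be constant along normal lines; it is the gradient of the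
  signed distance.\<close>

definition \<nu> :: "real^2 \<Rightarrow> real^2" where "\<nu> x = outward_normal \<Omega> (\<pi> x)"

lemma r_pos: "0 < r"
  using tubular by (simp add: tubular_radius_def)

lemma compact_Gamma: "compact \<Gamma>"
  using bounded_Omega by (rule compact_frontier_bounded)

lemma closed_Gamma: "closed \<Gamma>"
  by (rule frontier_closed)

lemma open_U: "open U"
  unfolding nbhd_def by blast

lemma mem_U: "y \<in> \<Gamma> \<Longrightarrow> dist x y < r \<Longrightarrow> x \<in> U"
  unfolding nbhd_def by (auto simp: dist_commute)

lemma Gamma_subset_U: "\<Gamma> \<subseteq> U"
  using mem_U r_pos by force

lemma U_nonempty: "x \<in> U \<Longrightarrow> \<Gamma> \<noteq> {}"
  unfolding nbhd_def by auto

text \<open>This lemma and \<open>normal_line\<close> say that \<open>x \<mapsto> (\<phi> x, \<pi> x)\<close> and \<open>(s, \<xi>) \<mapsto> \<xi> + s \<nu> \<xi>\<close> are inverse to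
  each other. All properties of the normal are derived from them.\<close>

lemma tubular_coordinates:
  assumes "x \<in> U"
  shows "\<bar>\<phi> x\<bar> < r" "\<pi> x \<in> \<Gamma>" "\<pi> x + \<phi> x *\<^sub>R \<nu> x = x"
proof -
  have h: "homeomorphism U ({-r<..<r} \<times> \<Gamma>)
       (\<lambda>x. (\<phi> x, \<pi> x)) (\<lambda>(s, \<xi>). \<xi> + s *\<^sub>R outward_normal \<Omega> \<xi>)"
    using tubular by (auto simp: tubular_radius_def C1_diffeomorphism_def)
  have "(\<phi> x, \<pi> x) \<in> {-r<..<r} \<times> \<Gamma>"
    using homeomorphism_image1[OF h] assms by blast
  then show "\<bar>\<phi> x\<bar> < r" "\<pi> x \<in> \<Gamma>" by auto
  show "\<pi> x + \<phi> x *\<^sub>R \<nu> x = x"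
    using homeomorphism_apply1[OF h assms] by (simp add: \<nu>_def)
qed

lemma proj_Gamma: "\<xi> \<in> \<Gamma> \<Longrightarrow> \<pi> \<xi> = \<xi>"
  by (simp add: closest_point_self)

lemma nu_proj: "x \<in> U \<Longrightarrow> \<nu> (\<pi> x) = \<nu> x"
  using proj_Gamma tubular_coordinates(2) by (simp add: \<nu>_def)

lemma normal_line:
  assumes "\<xi> \<in> \<Gamma>" "\<bar>s\<bar> < r"
  shows "\<xi> + s *\<^sub>R \<nu> \<xi> \<in> U" "\<phi> (\<xi> + s *\<^sub>R \<nu> \<xi>) = s" "\<pi> (\<xi> + s *\<^sub>R \<nu> \<xi>) = \<xi>"
    "\<nu> (\<xi> + s *\<^sub>R \<nu> \<xi>) = \<nu> \<xi>"
proof -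
  let ?g = "\<lambda>(s, \<xi>). \<xi> + s *\<^sub>R outward_normal \<Omega> \<xi>"
  have h: "homeomorphism U ({-r<..<r} \<times> \<Gamma>) (\<lambda>x. (\<phi> x, \<pi> x)) ?g"
    using tubular by (auto simp: tubular_radius_def C1_diffeomorphism_def)
  have m: "(s, \<xi>) \<in> {-r<..<r} \<times> \<Gamma>" using assms by auto
  have g: "?g (s, \<xi>) = \<xi> + s *\<^sub>R \<nu> \<xi>" using proj_Gamma assms by (simp add: \<nu>_def)
  show "\<xi> + s *\<^sub>R \<nu> \<xi> \<in> U"
    unfolding g[symmetric] homeomorphism_image2[OF h, symmetric] by (rule imageI[OF m])
  have "(\<phi> (\<xi> + s *\<^sub>R \<nu> \<xi>), \<pi> (\<xi> + s *\<^sub>R \<nu> \<xi>)) = (s, \<xi>)"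
    using homeomorphism_apply2[OF h m] unfolding g .
  then show "\<phi> (\<xi> + s *\<^sub>R \<nu> \<xi>) = s" and *: "\<pi> (\<xi> + s *\<^sub>R \<nu> \<xi>) = \<xi>" by auto
  show "\<nu> (\<xi> + s *\<^sub>R \<nu> \<xi>) = \<nu> \<xi>" using * proj_Gamma assms by (simp add: \<nu>_def)
qed

lemma abs_signed_distance: "\<bar>\<phi> x\<bar> = infdist x \<Gamma>"
  by (simp add: signed_distance_def infdist_nonneg)

lemma infdist_proj:
  assumes "\<Gamma> \<noteq> {}"
  shows "infdist x \<Gamma> = dist x (\<pi> x)"
  using setdist_closest_point[OF closed_Gamma assms] by (simp add: infdist_eq_setdist)

text \<open>The point with coordinate \<open>r/2\<close> on a normal line has distance \<open>r/2\<close> from its foot point.\<close>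

lemma norm_nu:
  assumes "x \<in> U"
  shows "norm (\<nu> x) = 1"
proof -
  have \<xi>: "\<pi> x \<in> \<Gamma>" by (rule tubular_coordinates(2)[OF assms])
  let ?y = "\<pi> x + (r/2) *\<^sub>R \<nu> (\<pi> x)"
  have s: "\<bar>r/2\<bar> < r" using r_pos by simp
  have "\<bar>\<phi> ?y\<bar> = dist ?y (\<pi> ?y)"
    unfolding abs_signed_distance by (rule infdist_proj[OF U_nonempty[OF assms]])
  then have "r/2 = r/2 * norm (\<nu> (\<pi> x))"
    unfolding normal_line(2,3)[OF \<xi> s] using r_pos by (simp add: dist_norm)
  then show ?thesis using r_pos nu_proj[OF assms] by simp
qed

lemma signed_distance_neg_iff: "\<phi> x < 0 \<longleftrightarrow> x \<in> \<Omega>"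
proof
  assume "\<phi> x < 0"
  then show "x \<in> \<Omega>" using infdist_nonneg[of x \<Gamma>] by (auto simp: signed_distance_def split: if_splits)
next
  assume x: "x \<in> \<Omega>"
  have "\<Omega> \<noteq> UNIV" using bounded_Omega not_bounded_UNIV by auto
  then have "\<Gamma> \<noteq> {}" using x frontier_eq_empty by blast
  moreover have "x \<notin> \<Gamma>" using x open_Omega frontier_disjoint_eq by blast
  ultimately have "infdist x \<Gamma> > 0" using closed_Gamma infdist_pos_not_in_closed by blast
  then show "\<phi> x < 0" using x by (simp add: signed_distance_def)
qed

lemma signed_distance_eq_0_iff:
  assumes "\<Gamma> \<noteq> {}"
  shows "\<phi> x = 0 \<longleftrightarrow> x \<in> \<Gamma>"
proof -
  have "\<phi> x = 0 \<longleftrightarrow> infdist x \<Gamma> = 0" using abs_signed_distance[of x] by auto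
  then show ?thesis using closed_Gamma assms in_closed_iff_infdist_zero by blast
qed

lemma segment_meets_Gamma:
  assumes "\<phi> x < 0" "0 \<le> \<phi> y"
  shows "\<exists>z\<in>closed_segment x y. z \<in> \<Gamma>"
proof -
  have "x \<in> \<Omega>" "y \<notin> \<Omega>" using assms signed_distance_neg_iff by force+
  then have "closed_segment x y \<inter> \<Gamma> \<noteq> {}"
    by (intro connected_Int_frontier) auto
  then show ?thesis by blast
qed

text \<open>For points on different sides of the curve, compare with a point of \<open>\<Gamma>\<close> on the segment between them.\<close>

lemma signed_distance_lipschitz: "\<bar>\<phi> x - \<phi> y\<bar> \<le> dist x y"
proof -
  have opp: "\<phi> b - \<phi> a \<le> dist a b" if ab: "\<phi> a < 0" "0 \<le> \<phi> b" for a b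
  proof -
    obtain z where z: "z \<in> closed_segment a b" "z \<in> \<Gamma>" using segment_meets_Gamma[OF ab] by blast
    have "infdist a \<Gamma> \<le> dist a z" "infdist b \<Gamma> \<le> dist b z" using z infdist_le by auto
    moreover have "dist a b = dist a z + dist z b"
      using between_mem_segment[symmetric] z between by metis
    ultimately show ?thesis using ab abs_signed_distance[of a] abs_signed_distance[of b]
      by (simp add: dist_commute)
  qed
  consider "\<phi> x < 0" "0 \<le> \<phi> y" | "\<phi> y < 0" "0 \<le> \<phi> x" | "\<phi> x < 0" "\<phi> y < 0" | "0 \<le> \<phi> x" "0 \<le> \<phi> y"
    by force
  then show ?thesis
  proof cases
    case 1 then show ?thesis using opp[of x y] by simp
  next
    case 2 then show ?thesis using opp[of y x] by (simp add: dist_commute)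
  qed (use infdist_triangle_abs[of x \<Gamma> y] abs_signed_distance[of x] abs_signed_distance[of y] in auto)
qed

lemma continuous_signed_distance: "continuous_on S \<phi>"
proof -
  have "1-lipschitz_on S \<phi>"
    by (rule lipschitz_onI) (use signed_distance_lipschitz in \<open>auto simp: dist_real_def\<close>)
  then show ?thesis by (rule lipschitz_on_continuous_on)
qed

lemma continuous_proj: "continuous_on U \<pi>"
  using tubular by (auto simp: tubular_radius_def retraction_def)

text \<open>On a normal line \<open>\<phi>\<close> is the coordinate.\<close>

lemma directional_derivative_nu:
  assumes x: "x \<in> U" and D: "(\<phi> has_derivative D) (at x)"
  shows "D (\<nu> x) = 1"
proof -
  have \<xi>: "\<pi> x \<in> \<Gamma>" by (rule tubular_coordinates(2)[OF x])
  have nu: "\<nu> (\<pi> x) = \<nu> x" by (rule nu_proj[OF x])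
  have line: "((\<lambda>t. x + t *\<^sub>R \<nu> x) has_derivative (\<lambda>t. t *\<^sub>R \<nu> x)) (at 0)"
    by (auto intro!: derivative_eq_intros)
  have "((\<lambda>t. \<phi> (x + t *\<^sub>R \<nu> x)) has_derivative (\<lambda>t. D (t *\<^sub>R \<nu> x))) (at 0)"
    using has_derivative_compose[OF line, of \<phi> D] D by simp
  moreover have "((\<lambda>t. \<phi> (x + t *\<^sub>R \<nu> x)) has_derivative (\<lambda>t. t)) (at 0)"
  proof (rule has_derivative_transform_within_open)
    show "((\<lambda>t. \<phi> x + t) has_derivative (\<lambda>t. t)) (at 0)" by (auto intro!: derivative_eq_intros)
    show "open {t. \<bar>\<phi> x + t\<bar> < r}" by (intro open_Collect_less continuous_intros)
    show "0 \<in> {t. \<bar>\<phi> x + t\<bar> < r}" using tubular_coordinates(1)[OF x] by simp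
    fix t assume "t \<in> {t. \<bar>\<phi> x + t\<bar> < r}"
    moreover have "x + t *\<^sub>R \<nu> x = \<pi> x + (\<phi> x + t) *\<^sub>R \<nu> (\<pi> x)"
      using tubular_coordinates(3)[OF x] by (simp add: nu algebra_simps)
    ultimately show "\<phi> x + t = \<phi> (x + t *\<^sub>R \<nu> x)"
      using normal_line(2)[OF \<xi>, of "\<phi> x + t"] by simp
  qed
  ultimately have "(\<lambda>t. D (t *\<^sub>R \<nu> x)) = (\<lambda>t. t)" by (rule has_derivative_unique)
  from fun_cong[OF this, of 1] show ?thesis by simp
qed

text \<open>A 1-Lipschitz function whose derivative in some unit direction is 1 has that direction as its
  gradient.\<close>

lemma signed_distance_gradient:
  assumes x: "x \<in> U" and D: "(\<phi> has_derivative D) (at x)"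
  shows "D v = \<nu> x \<bullet> v"
proof -
  have lin: "linear D" using D has_derivative_linear by blast
  define d where "d = (\<Sum>i\<in>Basis. D i *\<^sub>R i)"
  have Dd: "D v = d \<bullet> v" for v
  proof -
    have "D v = D (\<Sum>i\<in>Basis. (v \<bullet> i) *\<^sub>R i)" by (simp add: euclidean_representation)
    also have "\<dots> = (\<Sum>i\<in>Basis. (v \<bullet> i) * D i)"
      by (simp add: linear_sum[OF lin] linear_cmul[OF lin])
    also have "\<dots> = d \<bullet> v"
      unfolding d_def inner_sum_left by (intro sum.cong refl) (simp add: inner_commute mult.commute)
    finally show ?thesis .
  qed
  have bound: "\<bar>D v\<bar> \<le> norm v" for v
  proof -
    have line: "((\<lambda>t. x + t *\<^sub>R v) has_derivative (\<lambda>t. t *\<^sub>R v)) (at 0)"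
      by (auto intro!: derivative_eq_intros)
    have "((\<lambda>t. \<phi> (x + t *\<^sub>R v)) has_derivative (\<lambda>t. D (t *\<^sub>R v))) (at 0)"
      using has_derivative_compose[OF line, of \<phi> D] D by simp
    then have "((\<lambda>t. \<phi> (x + t *\<^sub>R v)) has_real_derivative D v) (at 0)"
      by (simp add: has_field_derivative_def linear_cmul[OF lin] mult_commute_abs)
    then have lim: "(\<lambda>t. (\<phi> (x + t *\<^sub>R v) - \<phi> x) / t) \<midarrow>0\<rightarrow> D v"
      by (simp add: DERIV_def)
    have "norm (D v) \<le> norm v"
    proof (rule Lim_norm_ubound[OF _ lim])
      show "\<forall>\<^sub>F t in at 0. norm ((\<phi> (x + t *\<^sub>R v) - \<phi> x) / t) \<le> norm v"
        unfolding eventually_at_filter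
      proof (intro always_eventually allI impI)
        fix t :: real assume "t \<noteq> 0"
        have "\<bar>\<phi> (x + t *\<^sub>R v) - \<phi> x\<bar> \<le> \<bar>t\<bar> * norm v"
          using signed_distance_lipschitz[of "x + t *\<^sub>R v" x] by (simp add: dist_norm)
        then show "norm ((\<phi> (x + t *\<^sub>R v) - \<phi> x) / t) \<le> norm v"
          using \<open>t \<noteq> 0\<close> by (simp add: abs_divide pos_divide_le_eq mult.commute)
      qed
    qed simp
    then show ?thesis by simp
  qed
  have dn: "d \<bullet> \<nu> x = 1" using directional_derivative_nu[OF x D] Dd by simp
  have "d \<bullet> d \<le> norm d" using bound[of d] Dd by simp
  then have "norm d * norm d \<le> norm d" by (simp only: power2_norm_eq_inner[symmetric] power2_eq_square)
  then have "norm d \<le> 1" by (cases "norm d = 0") auto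
  then have "d \<bullet> d \<le> 1" by (simp add: norm_le_square)
  moreover have "(d - \<nu> x) \<bullet> (d - \<nu> x) = d \<bullet> d - 1"
    using dn norm_nu[OF x] by (simp add: inner_diff inner_commute norm_eq_1)
  ultimately have "(d - \<nu> x) \<bullet> (d - \<nu> x) \<le> 0" by simp
  then have "(d - \<nu> x) \<bullet> (d - \<nu> x) = 0" using inner_ge_zero by (rule antisym)
  then have "d = \<nu> x" unfolding inner_eq_zero_iff by simp
  then show ?thesis using Dd by simp
qed

lemma signed_distance_has_derivative:
  assumes "x \<in> U"
  shows "(\<phi> has_derivative (\<lambda>v. \<nu> x \<bullet> v)) (at x)"
proof -
  obtain D where "(\<phi> has_derivative D) (at x)"
    using tubular assms unfolding tubular_radius_def C2_on_open_def by blast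
  then show ?thesis using signed_distance_gradient[OF assms] by (metis ext)
qed

text \<open>The Hessian of \<open>\<phi>\<close> as a linear map.\<close>

definition Hess :: "real^2 \<Rightarrow> real^2 \<Rightarrow> real^2" where "Hess x = frechet_derivative \<nu> (at x)"

lemma nu_C1:
  shows nu_has_derivative: "x \<in> U \<Longrightarrow> (\<nu> has_derivative Hess x) (at x)"
    and continuous_on_H: "continuous_on U (\<lambda>x. Hess x v)"
proof -
  obtain f' :: "real^2 \<Rightarrow> (real^2) \<Rightarrow>\<^sub>L real" where f': "\<And>x. x \<in> U \<Longrightarrow> (\<phi> has_derivative blinfun_apply (f' x)) (at x)"
    and "C1_on_open U f'"
    using tubular unfolding tubular_radius_def C2_on_open_def by blast
  then obtain f'' where f'': "\<And>x. x \<in> U \<Longrightarrow> (f' has_derivative blinfun_apply (f'' x)) (at x)"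
    and cont: "continuous_on U f''"
    unfolding C1_on_open_def by blast
  define H' where "H' x v = (\<Sum>i\<in>Basis. f'' x v i *\<^sub>R i)" for x v
  have nu: "\<nu> x = (\<Sum>i\<in>Basis. f' x i *\<^sub>R i)" if "x \<in> U" for x
    using signed_distance_gradient[OF that f'[OF that]]
    by (simp add: euclidean_representation)
  have der: "(\<nu> has_derivative H' x) (at x)" if "x \<in> U" for x
  proof (rule has_derivative_transform_within_open[OF _ open_U that])
    show "((\<lambda>x. \<Sum>i\<in>Basis. f' x i *\<^sub>R i) has_derivative H' x) (at x)"
      unfolding H'_def
      by (intro has_derivative_sum)
         (auto intro!: derivative_eq_intros f''[OF that])
  qed (simp add: nu)
  have HH: "Hess x = H' x" if "x \<in> U" for x
    using der[OF that] frechet_derivative_at unfolding Hess_def by metis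
  then show "x \<in> U \<Longrightarrow> (\<nu> has_derivative Hess x) (at x)" using der by simp
  have "continuous_on U (\<lambda>x. H' x v)"
    unfolding H'_def by (intro continuous_intros cont)
  then show "continuous_on U (\<lambda>x. Hess x v)" by (simp add: HH cong: continuous_on_cong)
qed

lemma continuous_nu: "continuous_on U \<nu>"
  using nu_has_derivative has_derivative_continuous
  by (metis continuous_at_imp_continuous_on)

lemma linear_H: "x \<in> U \<Longrightarrow> linear (Hess x)"
  using nu_has_derivative has_derivative_linear by blast

text \<open>\<open>\<nu>\<close> is constant on normal lines.\<close>

lemma H_nu:
  assumes x: "x \<in> U"
  shows "Hess x (\<nu> x) = 0"
proof -
  have \<xi>: "\<pi> x \<in> \<Gamma>" by (rule tubular_coordinates(2)[OF x])
  have nu: "\<nu> (\<pi> x) = \<nu> x" by (rule nu_proj[OF x])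
  have line: "((\<lambda>t. x + t *\<^sub>R \<nu> x) has_derivative (\<lambda>t. t *\<^sub>R \<nu> x)) (at 0)"
    by (auto intro!: derivative_eq_intros)
  have "((\<lambda>t. \<nu> (x + t *\<^sub>R \<nu> x)) has_derivative (\<lambda>t. Hess x (t *\<^sub>R \<nu> x))) (at 0)"
    using has_derivative_compose[OF line, of \<nu> "Hess x"] nu_has_derivative[OF x] by simp
  moreover have "((\<lambda>t. \<nu> (x + t *\<^sub>R \<nu> x)) has_derivative (\<lambda>t. 0)) (at 0)"
  proof (rule has_derivative_transform_within_open)
    show "((\<lambda>t::real. \<nu> x) has_derivative (\<lambda>t. 0)) (at 0)" by simp
    show "open {t. \<bar>\<phi> x + t\<bar> < r}" by (intro open_Collect_less continuous_intros)
    show "0 \<in> {t. \<bar>\<phi> x + t\<bar> < r}" using tubular_coordinates(1)[OF x] by simp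
    fix t assume "t \<in> {t. \<bar>\<phi> x + t\<bar> < r}"
    moreover have "x + t *\<^sub>R \<nu> x = \<pi> x + (\<phi> x + t) *\<^sub>R \<nu> (\<pi> x)"
      using tubular_coordinates(3)[OF x] by (simp add: nu algebra_simps)
    ultimately show "\<nu> x = \<nu> (x + t *\<^sub>R \<nu> x)"
      using normal_line(4)[OF \<xi>, of "\<phi> x + t"] nu by simp
  qed
  ultimately have "(\<lambda>t. Hess x (t *\<^sub>R \<nu> x)) = (\<lambda>t. 0)" by (rule has_derivative_unique)
  from fun_cong[OF this, of 1] show ?thesis by simp
qed

text \<open>\<open>\<nu>\<close> has constant length.\<close>

lemma nu_inner_H:
  assumes x: "x \<in> U"
  shows "\<nu> x \<bullet> Hess x v = 0"
proof -
  have "((\<lambda>y. \<nu> y \<bullet> \<nu> y) has_derivative (\<lambda>v. \<nu> x \<bullet> Hess x v + Hess x v \<bullet> \<nu> x)) (at x)"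
    by (intro has_derivative_inner nu_has_derivative x)
  moreover have "((\<lambda>y. \<nu> y \<bullet> \<nu> y) has_derivative (\<lambda>v. 0)) (at x)"
  proof (rule has_derivative_transform_within_open[OF _ open_U x])
    show "((\<lambda>y. 1::real) has_derivative (\<lambda>v. 0)) (at x)" by simp
  qed (use norm_nu in \<open>simp add: norm_eq_1\<close>)
  ultimately have "(\<lambda>v. \<nu> x \<bullet> Hess x v + Hess x v \<bullet> \<nu> x) = (\<lambda>v. 0)" by (rule has_derivative_unique)
  from fun_cong[OF this, of v] show ?thesis by (simp add: inner_commute)
qed

text \<open>Besides 0, the Hessian has this eigenvalue, belonging to the tangential direction; up to sign it is the
  curvature of the level line of \<open>\<phi>\<close>.\<close>

definition level_curvature :: "real^2 \<Rightarrow> real" where "level_curvature x = rot (\<nu> x) \<bullet> Hess x (rot (\<nu> x))"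

lemma H_eq:
  assumes x: "x \<in> U"
  shows "Hess x v = (level_curvature x * (rot (\<nu> x) \<bullet> v)) *\<^sub>R rot (\<nu> x)"
proof -
  note n1 = norm_nu[OF x] and lin = linear_H[OF x]
  have "Hess x v = Hess x ((\<nu> x \<bullet> v) *\<^sub>R \<nu> x + (rot (\<nu> x) \<bullet> v) *\<^sub>R rot (\<nu> x))"
    using orthonormal_expansion[OF n1] by metis
  also have "\<dots> = (rot (\<nu> x) \<bullet> v) *\<^sub>R Hess x (rot (\<nu> x))"
    by (simp add: linear_add[OF lin] linear_cmul[OF lin] H_nu[OF x])
  also have "Hess x (rot (\<nu> x)) = level_curvature x *\<^sub>R rot (\<nu> x)"
    using orthonormal_expansion[OF n1, of "Hess x (rot (\<nu> x))"] nu_inner_H[OF x]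
    by (simp add: level_curvature_def)
  finally show ?thesis by (simp add: mult.commute)
qed

lemma continuous_on_rot [continuous_intros]:
  "continuous_on S f \<Longrightarrow> continuous_on S (\<lambda>x. rot (f x))"
proof -
  have "bounded_linear rot"
    by (intro linear_conv_bounded_linear[THEN iffD1] linearI) (simp_all add: vec_eq_real2)
  then show "continuous_on S f \<Longrightarrow> continuous_on S (\<lambda>x. rot (f x))"
    by (rule bounded_linear.continuous_on)
qed

lemma continuous_level_curvature: "continuous_on U level_curvature"
proof -
  let ?e = "axis 1 1 :: real^2" and ?f = "axis 2 1 :: real^2"
  have "level_curvature x = rot (\<nu> x) \<bullet> ((rot (\<nu> x) $ 1) *\<^sub>R Hess x ?e + (rot (\<nu> x) $ 2) *\<^sub>R Hess x ?f)" if "x \<in> U" for x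
  proof -
    have *: "rot (\<nu> x) = (rot (\<nu> x) $ 1) *\<^sub>R ?e + (rot (\<nu> x) $ 2) *\<^sub>R ?f"
      unfolding vec_eq_real2 by (simp add: axis_def)
    have "Hess x (rot (\<nu> x)) = (rot (\<nu> x) $ 1) *\<^sub>R Hess x ?e + (rot (\<nu> x) $ 2) *\<^sub>R Hess x ?f"
      by (subst *) (simp only: linear_add[OF linear_H[OF that]] linear_cmul[OF linear_H[OF that]])
    then show ?thesis by (simp only: level_curvature_def)
  qed
  moreover have "continuous_on U (\<lambda>x. rot (\<nu> x) \<bullet> ((rot (\<nu> x) $ 1) *\<^sub>R Hess x ?e + (rot (\<nu> x) $ 2) *\<^sub>R Hess x ?f))"
    by (intro continuous_intros continuous_nu continuous_on_H)
  ultimately show ?thesis by (simp cong: continuous_on_cong)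
qed

text \<open>Differentiate \<open>\<pi> y = y - \<phi> y \<nu> y\<close>.\<close>

lemma proj_has_derivative:
  assumes x: "x \<in> U"
  shows "(\<pi> has_derivative (\<lambda>v. ((1 - \<phi> x * level_curvature x) * (rot (\<nu> x) \<bullet> v)) *\<^sub>R rot (\<nu> x))) (at x)"
proof -
  have "((\<lambda>y. y - \<phi> y *\<^sub>R \<nu> y) has_derivative (\<lambda>v. v - (\<phi> x *\<^sub>R Hess x v + (\<nu> x \<bullet> v) *\<^sub>R \<nu> x))) (at x)"
    by (intro has_derivative_diff has_derivative_ident has_derivative_scaleR
        signed_distance_has_derivative nu_has_derivative x)
  moreover have "v - (\<phi> x *\<^sub>R Hess x v + (\<nu> x \<bullet> v) *\<^sub>R \<nu> x) =
     ((1 - \<phi> x * level_curvature x) * (rot (\<nu> x) \<bullet> v)) *\<^sub>R rot (\<nu> x)" for v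
    using orthonormal_expansion[OF norm_nu[OF x], of v]
    by (simp add: H_eq[OF x] algebra_simps)
  ultimately have *: "((\<lambda>y. y - \<phi> y *\<^sub>R \<nu> y) has_derivative
      (\<lambda>v. ((1 - \<phi> x * level_curvature x) * (rot (\<nu> x) \<bullet> v)) *\<^sub>R rot (\<nu> x))) (at x)"
    by simp
  show ?thesis
    by (rule has_derivative_transform_within_open[OF * open_U x])
       (use tubular_coordinates(3) in \<open>simp add: algebra_simps diff_eq_eq\<close>)
qed

text \<open>Differentiating \<open>\<nu> = \<nu> \<circ> \<pi>\<close> in the tangential direction relates the Hessian at a point to the
  one at its foot point.\<close>

lemma level_curvature_foot:
  assumes x: "x \<in> U"
  shows "level_curvature x = (1 - \<phi> x * level_curvature x) * level_curvature (\<pi> x)"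
    and level_curvature_foot': "(1 - \<phi> x * level_curvature x) * (1 + \<phi> x * level_curvature (\<pi> x)) = 1"
proof -
  have px: "\<pi> x \<in> U" using tubular_coordinates(2)[OF x] Gamma_subset_U by blast
  have n1: "rot (\<nu> x) \<bullet> rot (\<nu> x) = 1" using norm_nu[OF x] by (simp add: norm_eq_1)
  have "((\<lambda>y. \<nu> (\<pi> y)) has_derivative
     (\<lambda>v. Hess (\<pi> x) (((1 - \<phi> x * level_curvature x) * (rot (\<nu> x) \<bullet> v)) *\<^sub>R rot (\<nu> x)))) (at x)"
    by (rule has_derivative_compose[OF proj_has_derivative[OF x] nu_has_derivative[OF px]])
  then have "(\<nu> has_derivative
     (\<lambda>v. Hess (\<pi> x) (((1 - \<phi> x * level_curvature x) * (rot (\<nu> x) \<bullet> v)) *\<^sub>R rot (\<nu> x)))) (at x)"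
    by (rule has_derivative_transform_within_open[OF _ open_U x]) (simp add: nu_proj)
  from fun_cong[OF has_derivative_unique[OF this nu_has_derivative[OF x]], of "rot (\<nu> x)"]
  have "Hess x (rot (\<nu> x)) = Hess (\<pi> x) ((1 - \<phi> x * level_curvature x) *\<^sub>R rot (\<nu> x))"
    unfolding n1 by simp
  then have "rot (\<nu> x) \<bullet> Hess x (rot (\<nu> x)) = (1 - \<phi> x * level_curvature x) * level_curvature (\<pi> x)"
    by (simp only: H_eq[OF px] nu_proj[OF x] inner_scaleR_right n1 mult.commute mult_1_right)
  then show eq: "level_curvature x = (1 - \<phi> x * level_curvature x) * level_curvature (\<pi> x)"
    by (simp only: level_curvature_def[of x, symmetric])
  have "(1 - \<phi> x * level_curvature x) * (1 + \<phi> x * level_curvature (\<pi> x)) = 1 - \<phi> x * level_curvature x + \<phi> x * ((1 - \<phi> x * level_curvature x) * level_curvature (\<pi> x))"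
    by (simp add: algebra_simps)
  then show "(1 - \<phi> x * level_curvature x) * (1 + \<phi> x * level_curvature (\<pi> x)) = 1"
    unfolding eq[symmetric] by simp
qed

end

section \<open>Curvature\<close>

context tubular_curve
begin

text \<open>The condition that characterizes \<^const>\<open>signed_curvature\<close>. As that constant is a definite description,
  both uniqueness and existence of a witness have to be shown.\<close>

definition curvature_witness :: "real^2 \<Rightarrow> real \<Rightarrow> bool" where
  "curvature_witness \<xi> k \<longleftrightarrow> (\<exists>\<delta>>0. \<exists>c c' c''.
        c 0 = \<xi> \<and>
        (\<forall>t\<in>{-\<delta><..<\<delta>}. c t \<in> \<Gamma> \<and> c' t \<noteq> 0 \<and>
           (c has_vector_derivative c' t) (at t) \<and> (c' has_vector_derivative c'' t) (at t)) \<and>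
        continuous_on {-\<delta><..<\<delta>} c'' \<and>
        ((\<lambda>t. sgn (c' t)) has_vector_derivative (norm (c' 0) * k) *\<^sub>R outward_normal \<Omega> \<xi>) (at 0))"

lemma outward_normal_eq: "\<xi> \<in> \<Gamma> \<Longrightarrow> outward_normal \<Omega> \<xi> = \<nu> \<xi>"
  by (simp add: \<nu>_def proj_Gamma)

lemma curve_in_Gamma_orthogonal:
  assumes "open S" "t \<in> S" "\<And>s. s \<in> S \<Longrightarrow> c s \<in> \<Gamma>" "(c has_vector_derivative c') (at t)"
  shows "\<nu> (c t) \<bullet> c' = 0"
proof -
  have ct: "c t \<in> \<Gamma>" using assms by blast
  then have U: "c t \<in> U" using Gamma_subset_U by blast
  have ne: "\<Gamma> \<noteq> {}" using ct by blast
  have "((\<lambda>s. \<phi> (c s)) has_derivative (\<lambda>s. \<nu> (c t) \<bullet> (s *\<^sub>R c'))) (at t)"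
    by (rule has_derivative_compose[OF assms(4)[unfolded has_vector_derivative_def]
          signed_distance_has_derivative[OF U]])
  moreover have "((\<lambda>s. \<phi> (c s)) has_derivative (\<lambda>s. 0)) (at t)"
    by (rule has_derivative_transform_within_open[OF _ assms(1,2), of "\<lambda>_. 0"])
       (use signed_distance_eq_0_iff[OF ne] assms(3) in auto)
  ultimately have "(\<lambda>s. \<nu> (c t) \<bullet> (s *\<^sub>R c')) = (\<lambda>s. 0)" by (rule has_derivative_unique)
  from fun_cong[OF this, of 1] show ?thesis by simp
qed

text \<open>Differentiate \<open>\<nu> (c t) \<bullet> sgn (c' t) = 0\<close>.\<close>

lemma curvature_witness_unique:
  assumes \<xi>: "\<xi> \<in> \<Gamma>" and "curvature_witness \<xi> k"
  shows "k = - level_curvature \<xi>"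
proof -
  obtain \<delta> c c' c'' where \<delta>: "\<delta> > 0" and c0: "c 0 = \<xi>"
    and c: "\<And>t. t \<in> {-\<delta><..<\<delta>} \<Longrightarrow> c t \<in> \<Gamma> \<and> c' t \<noteq> 0 \<and>
           (c has_vector_derivative c' t) (at t) \<and> (c' has_vector_derivative c'' t) (at t)"
    and s: "((\<lambda>t. sgn (c' t)) has_vector_derivative (norm (c' 0) * k) *\<^sub>R \<nu> \<xi>) (at 0)"
    using assms unfolding curvature_witness_def outward_normal_eq[OF \<xi>] by metis
  have U: "\<xi> \<in> U" using \<xi> Gamma_subset_U by blast
  have orth: "\<nu> (c t) \<bullet> c' t = 0" if "t \<in> {-\<delta><..<\<delta>}" for t
    by (rule curve_in_Gamma_orthogonal[OF open_greaterThanLessThan that]) (use c that in auto)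
  have z: "0 \<in> {-\<delta><..<\<delta>}" using \<delta> by simp
  have dc: "(c has_derivative (\<lambda>t. t *\<^sub>R c' 0)) (at 0)"
    using c[OF z] by (simp add: has_vector_derivative_def)
  have "((\<lambda>t. \<nu> (c t)) has_derivative (\<lambda>t. Hess \<xi> (t *\<^sub>R c' 0))) (at 0)"
    using has_derivative_compose[OF dc, of \<nu> "Hess \<xi>"] nu_has_derivative[OF U] c0 by simp
  from has_derivative_inner[OF this s[unfolded has_vector_derivative_def]]
  have "((\<lambda>t. \<nu> (c t) \<bullet> sgn (c' t)) has_derivative
     (\<lambda>t. \<nu> \<xi> \<bullet> (t *\<^sub>R (norm (c' 0) * k) *\<^sub>R \<nu> \<xi>) + Hess \<xi> (t *\<^sub>R c' 0) \<bullet> sgn (c' 0))) (at 0)"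
    by (simp add: c0)
  moreover have "((\<lambda>t. \<nu> (c t) \<bullet> sgn (c' t)) has_derivative (\<lambda>t. 0)) (at 0)"
    by (rule has_derivative_transform_within_open[OF _ open_greaterThanLessThan z, of "\<lambda>_. 0"])
       (use orth in \<open>auto simp: sgn_div_norm\<close>)
  ultimately have "(\<lambda>t. \<nu> \<xi> \<bullet> (t *\<^sub>R (norm (c' 0) * k) *\<^sub>R \<nu> \<xi>) + Hess \<xi> (t *\<^sub>R c' 0) \<bullet> sgn (c' 0)) = (\<lambda>t. 0)"
    by (rule has_derivative_unique)
  from fun_cong[OF this, of 1]
  have eq: "norm (c' 0) * k * (\<nu> \<xi> \<bullet> \<nu> \<xi>) + Hess \<xi> (c' 0) \<bullet> sgn (c' 0) = 0" by simp
  have n1: "\<nu> \<xi> \<bullet> \<nu> \<xi> = 1" using norm_nu[OF U] by (simp add: norm_eq_1)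
  define a where "a = rot (\<nu> \<xi>) \<bullet> c' 0"
  have ca: "c' 0 = a *\<^sub>R rot (\<nu> \<xi>)"
    using orthonormal_expansion[OF norm_nu[OF U], of "c' 0"] orth[OF z] c0 by (simp add: a_def)
  have na: "norm (c' 0) = \<bar>a\<bar>" using norm_nu[OF U] by (simp add: ca)
  have a0: "a \<noteq> 0" using c[OF z] ca by auto
  have "Hess \<xi> (c' 0) \<bullet> sgn (c' 0) = level_curvature \<xi> * (a * a) / \<bar>a\<bar>"
    unfolding H_eq[OF U] a_def[symmetric] sgn_div_norm na
    unfolding ca by (simp add: n1 divide_inverse)
  also have "\<dots> = level_curvature \<xi> * \<bar>a\<bar>" using a0 by (simp add: abs_if)
  finally have "\<bar>a\<bar> * (k + level_curvature \<xi>) = 0" using eq by (simp add: n1 na algebra_simps)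
  then show ?thesis using a0 by simp
qed

text \<open>The projection of the tangent line at \<open>\<xi>\<close> is only a \<open>C\<^sup>1\<close> parametrization, but after
  reparametrization by the tangential coordinate the curve becomes a graph whose slope is a
  quotient of components of \<open>\<nu>\<close>, which makes it \<open>C\<^sup>2\<close>.\<close>

lemma local_graph_parametrization:
  assumes \<xi>: "\<xi> \<in> \<Gamma>"
  shows "\<exists>\<delta>>0. \<exists>c c'. c 0 = \<xi> \<and> (\<forall>t\<in>{-\<delta><..<\<delta>}. c t \<in> \<Gamma> \<and>
     (c has_vector_derivative c' t) (at t) \<and> c' t \<bullet> rot (\<nu> \<xi>) = 1)"
proof -
  define T where "T = rot (\<nu> \<xi>)"
  have \<xi>U: "\<xi> \<in> U" using \<xi> Gamma_subset_U by blast
  have T1: "T \<bullet> T = 1" using norm_nu[OF \<xi>U] by (simp add: T_def norm_eq_1)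
  have inU: "\<xi> + t *\<^sub>R T \<in> U" if "\<bar>t\<bar> < r" for t
    by (rule mem_U[OF \<xi>]) (use that norm_nu[OF \<xi>U] in \<open>simp add: dist_norm T_def\<close>)
  define x where "x t = \<xi> + t *\<^sub>R T" for t
  define c0 where "c0 t = \<pi> (x t)" for t
  define c0' where "c0' t = ((1 - \<phi> (x t) * level_curvature (x t)) * (rot (\<nu> (x t)) \<bullet> T)) *\<^sub>R rot (\<nu> (x t))" for t
  have dc0: "(c0 has_vector_derivative c0' t) (at t)" if "\<bar>t\<bar> < r" for t
  proof -
    have line: "(x has_derivative (\<lambda>s. s *\<^sub>R T)) (at t)"
      unfolding x_def by (auto intro!: derivative_eq_intros)
    have "x t \<in> U" using inU[OF that] by (simp add: x_def)
    from has_derivative_compose[OF line proj_has_derivative[OF this]]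
    show ?thesis unfolding has_vector_derivative_def c0_def c0'_def
      by (simp add: mult.assoc mult.commute mult.left_commute)
  qed
  define u where "u t = (c0 t - \<xi>) \<bullet> T" for t
  define u' where "u' t = c0' t \<bullet> T" for t
  have du: "(u has_real_derivative u' t) (at t)" if "\<bar>t\<bar> < r" for t
  proof -
    have "((\<lambda>t. (c0 t - \<xi>) \<bullet> T) has_derivative (\<lambda>s. (s *\<^sub>R c0' t) \<bullet> T)) (at t)"
      using dc0[OF that] unfolding has_vector_derivative_def
      by (auto intro!: derivative_eq_intros)
    then show ?thesis unfolding u_def u'_def has_field_derivative_def by (simp add: mult_commute_abs)
  qed
  have px: "\<pi> \<xi> = \<xi>" and p0: "\<phi> \<xi> = 0"
    using \<xi> proj_Gamma signed_distance_eq_0_iff by blast+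
  have "u' 0 = 1" by (simp add: u'_def c0'_def x_def p0 T_def[symmetric] T1)
  have "continuous_on {-r<..<r} u'"
  proof -
    have cx: "continuous_on {-r<..<r} x" unfolding x_def by (intro continuous_intros)
    have xU: "x ` {-r<..<r} \<subseteq> U" using inU by (auto simp: x_def)
    show ?thesis unfolding u'_def c0'_def
      by (intro continuous_intros continuous_on_compose2[OF continuous_nu cx xU]
          continuous_on_compose2[OF continuous_level_curvature cx xU]
          continuous_on_compose2[OF continuous_signed_distance cx xU])
  qed
  then have "open ({-r<..<r} \<inter> u' -` {0<..})"
    by (rule continuous_open_preimage) auto
  moreover have "0 \<in> {-r<..<r} \<inter> u' -` {0<..}" using \<open>u' 0 = 1\<close> r_pos by simp
  ultimately obtain d where d: "d > 0" "ball 0 d \<subseteq> {-r<..<r} \<inter> u' -` {0<..}"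
    by (meson open_contains_ball)
  define S where "S = {-d<..<d}"
  have Sr: "\<bar>t\<bar> < r" and Su: "u' t > 0" if "t \<in> S" for t
    using subsetD[OF d(2), of t] that by (auto simp: S_def dist_real_def abs_less_iff)
  have mono: "u s < u t" if "s \<in> S" "t \<in> S" "s < t" for s t
  proof (rule DERIV_pos_imp_increasing[OF \<open>s < t\<close>])
    fix y assume "s \<le> y" "y \<le> t"
    then have "y \<in> S" using that by (auto simp: S_def)
    then show "\<exists>z. (u has_real_derivative z) (at y) \<and> 0 < z" using du Sr Su by blast
  qed
  have inj: "inj_on u S"
    by (rule linorder_inj_onI') (metis mono order_less_irrefl)
  have contu: "continuous_on S u"
    by (rule DERIV_continuous_on) (use du Sr DERIV_subset in blast)
  have oS: "open S" by (simp add: S_def)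
  have oW: "open (u ` S)"
    by (rule injective_into_1d_imp_open_map_UNIV[OF oS contu inj]) simp
  have z: "0 \<in> S" using d by (simp add: S_def)
  have "u 0 = 0" by (simp add: u_def c0_def x_def px)
  then have "0 \<in> u ` S" using z by (metis imageI)
  then obtain \<delta> where \<delta>: "\<delta> > 0" "ball 0 \<delta> \<subseteq> u ` S" using oW by (meson open_contains_ball)
  define \<tau> where "\<tau> = inv_into S u"
  define c where "c s = c0 (\<tau> s)" for s
  define c' where "c' s = (1 / u' (\<tau> s)) *\<^sub>R c0' (\<tau> s)" for s
  have \<tau>u: "\<tau> (u t) = t" if "t \<in> S" for t using that inj by (simp add: \<tau>_def)
  have main: "c s \<in> \<Gamma> \<and> (c has_vector_derivative c' s) (at s) \<and> c' s \<bullet> T = 1"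
    if "s \<in> {-\<delta><..<\<delta>}" for s
  proof -
    have "s \<in> u ` S" using that \<delta>(2) by (auto simp: dist_real_def)
    then obtain t where t: "t \<in> S" "s = u t" by blast
    have ts: "\<tau> s = t" using \<tau>u t by simp
    have ut: "u' t \<noteq> 0" using Su[OF t(1)] by simp
    have "(\<tau> has_derivative (\<lambda>v. v * (1 / u' t))) (at (u t))"
    proof (rule has_derivative_inverse_strong[OF oS t(1) contu \<tau>u])
      show "(u has_derivative (*) (u' t)) (at t)" using du[OF Sr[OF t(1)]] by (simp add: has_field_derivative_def)
      show "(*) (u' t) \<circ> (\<lambda>v. v * (1 / u' t)) = id" using ut by (auto simp: fun_eq_iff)
    qed
    then have "(\<tau> has_vector_derivative (1 / u' t)) (at s)" 
      using t(2) by (simp add: has_vector_derivative_def)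
    from vector_diff_chain_at[OF this, of c0 "c0' t"] dc0[OF Sr[OF t(1)]] 
    have "((\<lambda>s. c0 (\<tau> s)) has_vector_derivative c' s) (at s)"
      by (simp add: c'_def ts comp_def[abs_def])
    then have "(c has_vector_derivative c' s) (at s)"
      by (simp add: c_def[abs_def])
    moreover have "c s \<in> \<Gamma>"
      unfolding c_def ts c0_def x_def by (rule tubular_coordinates(2)[OF inU[OF Sr[OF t(1)]]])
    moreover have "c' s \<bullet> T = 1" using ut by (simp add: c'_def ts u'_def)
    ultimately show ?thesis by blast
  qed
  have "\<tau> 0 = 0" using \<tau>u[OF z] \<open>u 0 = 0\<close> by simp
  then have "c 0 = \<xi>" by (simp add: c_def c0_def x_def px)
  then show ?thesis using \<delta>(1) main unfolding T_def by blast
qed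

text \<open>With a \<open>C\<^sup>2\<close> parametrization at hand, the derivative of the unit tangent exists; being orthogonal to the tangent,
  it is a multiple of the normal.\<close>

lemma curvature_witness_exists:
  assumes \<xi>: "\<xi> \<in> \<Gamma>"
  shows "\<exists>k. curvature_witness \<xi> k"
proof -
  define T where "T = rot (\<nu> \<xi>)"
  define N where "N = \<nu> \<xi>"
  have \<xi>U: "\<xi> \<in> U" using \<xi> Gamma_subset_U by blast
  have nN: "norm N = 1" using norm_nu[OF \<xi>U] N_def by simp
  have N1: "N \<bullet> N = 1" and T1: "T \<bullet> T = 1" and NT: "N \<bullet> T = 0"
    using norm_nu[OF \<xi>U] by (simp_all add: T_def N_def norm_eq_1)
  obtain \<delta> c c' where \<delta>: "\<delta> > 0" and c0: "c 0 = \<xi>"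
    and c: "\<And>t. t \<in> {-\<delta><..<\<delta>} \<Longrightarrow> c t \<in> \<Gamma>"
      "\<And>t. t \<in> {-\<delta><..<\<delta>} \<Longrightarrow> (c has_vector_derivative c' t) (at t)"
      "\<And>t. t \<in> {-\<delta><..<\<delta>} \<Longrightarrow> c' t \<bullet> T = 1"
    using local_graph_parametrization[OF \<xi>] unfolding T_def by metis
  define I where "I = {-\<delta><..<\<delta>}"
  have oI: "open I" and z: "0 \<in> I" using \<delta> by (auto simp: I_def)
  define a where "a t = \<nu> (c t) \<bullet> N" for t
  define b where "b t = \<nu> (c t) \<bullet> T" for t
  have cU: "c t \<in> U" if "t \<in> I" for t using c(1) that Gamma_subset_U by (auto simp: I_def)
  have orth: "\<nu> (c t) \<bullet> c' t = 0" if "t \<in> I" for t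
    by (rule curve_in_Gamma_orthogonal[OF oI that]) (use c that I_def in auto)
  \<comment> \<open>In the frame at \<open>\<xi>\<close>, the velocity has tangential component 1; orthogonality to \<open>\<nu>\<close>
    determines the other component as a quotient of functions that are \<open>C\<^sup>1\<close> along the curve.\<close>
  have c'_dec: "c' t = (N \<bullet> c' t) *\<^sub>R N + T" if "t \<in> I" for t
    using orthonormal_expansion[OF nN, of "c' t"] c(3)[of t] that
    by (simp add: T_def N_def I_def inner_commute)
  have ab: "b t + (N \<bullet> c' t) * a t = 0" if "t \<in> I" for t
    using orth[OF that] unfolding a_def b_def
    by (subst (asm) c'_dec[OF that]) (simp add: inner_add_right add.commute)
  have a0: "a t \<noteq> 0" if "t \<in> I" for t
  proof
    assume "a t = 0"
    then have "b t = 0" using ab[OF that] by simp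
    have "\<nu> (c t) = 0"
      using orthonormal_expansion[OF nN, of "\<nu> (c t)"] \<open>a t = 0\<close> \<open>b t = 0\<close>
      by (simp add: a_def b_def T_def N_def inner_commute)
    then show False using norm_nu[OF cU[OF that]] by simp
  qed
  have c'_eq: "c' t = T - (b t / a t) *\<^sub>R N" if "t \<in> I" for t
  proof -
    have "N \<bullet> c' t = - (b t / a t)" using ab[OF that] a0[OF that] by (simp add: field_simps)
    then show ?thesis using c'_dec[OF that] by simp
  qed
  define n' where "n' t = (level_curvature (c t) * (rot (\<nu> (c t)) \<bullet> c' t)) *\<^sub>R rot (\<nu> (c t))" for t
  define c'' where "c'' t = - (((n' t \<bullet> T) * a t - b t * (n' t \<bullet> N)) / (a t * a t)) *\<^sub>R N" for t
  have dc: "(c has_derivative (\<lambda>s. s *\<^sub>R c' t)) (at t)" if "t \<in> I" for t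
    using c(2)[of t] that by (simp add: has_vector_derivative_def I_def)
  have dn: "((\<lambda>t. \<nu> (c t)) has_derivative (\<lambda>s. s *\<^sub>R n' t)) (at t)" if "t \<in> I" for t
  proof -
    have "((\<lambda>t. \<nu> (c t)) has_derivative (\<lambda>s. Hess (c t) (s *\<^sub>R c' t))) (at t)"
      by (rule has_derivative_compose[OF dc[OF that] nu_has_derivative[OF cU[OF that]]])
    then show ?thesis
      by (simp add: H_eq[OF cU[OF that]] n'_def mult.left_commute)
  qed
  have dq: "((\<lambda>t. T - (b t / a t) *\<^sub>R N) has_vector_derivative c'' t) (at t)" if "t \<in> I" for t
  proof -
    have "(b has_real_derivative n' t \<bullet> T) (at t)" "(a has_real_derivative n' t \<bullet> N) (at t)"
      unfolding has_field_derivative_def a_def b_def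
      using dn[OF that] by (auto intro!: derivative_eq_intros simp: mult.commute)
    then have "((\<lambda>t. b t / a t) has_real_derivative ((n' t \<bullet> T) * a t - b t * (n' t \<bullet> N)) / (a t * a t)) (at t)"
      using a0[OF that] by (rule DERIV_divide)
    from has_vector_derivative_diff[OF has_vector_derivative_const[of T]
        has_vector_derivative_scaleR[OF this has_vector_derivative_const[of N]]]
    show ?thesis by (simp add: c''_def)
  qed
  have dc': "(c' has_vector_derivative c'' t) (at t)" if "t \<in> I" for t
    by (rule has_vector_derivative_transform_within_open[OF dq[OF that] oI that]) (simp add: c'_eq)
  have cc: "continuous_on I c" "continuous_on I c'"
    using dc has_derivative_continuous dc' has_vector_derivative_continuous
    by (metis continuous_at_imp_continuous_on)+
  have cI: "c ` I \<subseteq> U" using cU by blast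
  have contn: "continuous_on I (\<lambda>t. \<nu> (c t))"
    by (rule continuous_on_compose2[OF continuous_nu cc(1) cI])
  have cont: "continuous_on I c''"
    unfolding c''_def n'_def a_def b_def
    by (intro continuous_intros contn cc continuous_on_compose2[OF continuous_level_curvature cc(1) cI])
       (use a0 in \<open>auto simp: a_def\<close>)
  have c'0: "c' 0 = T"
    using c'_eq[OF z] NT by (simp add: b_def c0 N_def[symmetric])
  have c'n: "c' t \<noteq> 0" if "t \<in> I" for t
    using c(3)[of t] that by (auto simp: I_def)
  have "(\<lambda>t. inverse (norm (c' t)) *\<^sub>R c' t) differentiable (at 0)"
  proof -
    have d1: "c' differentiable (at 0)" using dc'[OF z] differentiableI_vector by blast
    have "(\<lambda>t. norm (c' t)) differentiable (at 0)"
      by (rule differentiable_compose[OF differentiable_norm_at[OF c'n[OF z]] d1])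
    then show ?thesis
      using c'n[OF z] by (intro differentiable_scaleR differentiable_inverse d1) auto
  qed
  then have "(\<lambda>t. sgn (c' t)) differentiable (at 0)" by (simp add: sgn_div_norm[abs_def])
  then obtain w where w: "((\<lambda>t. sgn (c' t)) has_vector_derivative w) (at 0)"
    using vector_derivative_works by blast
  have "((\<lambda>t. sgn (c' t) \<bullet> sgn (c' t)) has_derivative
      (\<lambda>s. sgn (c' 0) \<bullet> (s *\<^sub>R w) + (s *\<^sub>R w) \<bullet> sgn (c' 0))) (at 0)"
    by (intro has_derivative_inner w[unfolded has_vector_derivative_def])
  moreover have "((\<lambda>t. sgn (c' t) \<bullet> sgn (c' t)) has_derivative (\<lambda>s. 0)) (at 0)"
    by (rule has_derivative_transform_within_open[OF _ oI z, of "\<lambda>_. 1"])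
       (use c'n in \<open>simp_all add: norm_eq_1[symmetric] norm_sgn\<close>)
  ultimately have "(\<lambda>s. sgn (c' 0) \<bullet> (s *\<^sub>R w) + (s *\<^sub>R w) \<bullet> sgn (c' 0)) = (\<lambda>s. 0)"
    by (rule has_derivative_unique)
  from fun_cong[OF this, of 1] have "sgn (c' 0) \<bullet> w = 0" by (simp add: inner_commute)
  moreover have "sgn (c' 0) = T" using T1 by (simp add: c'0 sgn_div_norm norm_eq_sqrt_inner)
  ultimately have "T \<bullet> w = 0" by simp
  then have weq: "w = (N \<bullet> w) *\<^sub>R N"
    using orthonormal_expansion[OF nN, of w] by (simp add: T_def N_def)
  have nT: "norm (c' 0) = 1" using T1 c'0 by (simp add: norm_eq_sqrt_inner)
  have "curvature_witness \<xi> (N \<bullet> w)"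
    unfolding curvature_witness_def outward_normal_eq[OF \<xi>]
  proof (rule exI[of _ \<delta>], rule conjI[OF \<delta>], rule exI[of _ c], rule exI[of _ c'],
      rule exI[of _ c''], intro conjI ballI)
    show "((\<lambda>t. sgn (c' t)) has_vector_derivative (norm (c' 0) * (N \<bullet> w)) *\<^sub>R \<nu> \<xi>) (at 0)"
      using w weq by (simp add: nT N_def)
  qed (use \<delta> c0 c dc' c'n cont I_def in auto)
  then show ?thesis by blast
qed

lemma curvature_eq:
  assumes "\<xi> \<in> \<Gamma>"
  shows "curvature \<Omega> \<xi> = \<bar>level_curvature \<xi>\<bar>"
proof -
  have "signed_curvature \<Omega> \<xi> = (THE k. curvature_witness \<xi> k)"
    by (simp add: signed_curvature_def curvature_witness_def)
  also have "\<dots> = - level_curvature \<xi>"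
    using curvature_witness_exists[OF assms] curvature_witness_unique[OF assms]
    by (metis the_equality)
  finally show ?thesis by (simp add: curvature_def)
qed

text \<open>Without this bound, the supremum defining \<^const>\<open>max_curvature\<close> would be meaningless.\<close>

lemma curvature_bdd_above: "bdd_above (curvature \<Omega> ` (S \<inter> \<Gamma>))"
proof -
  have "compact (level_curvature ` \<Gamma>)"
    by (intro compact_continuous_image continuous_on_subset[OF continuous_level_curvature] compact_Gamma
        Gamma_subset_U)
  then have "bounded (level_curvature ` \<Gamma>)" by (rule compact_imp_bounded)
  then obtain B where "\<forall>\<xi>\<in>\<Gamma>. \<bar>level_curvature \<xi>\<bar> \<le> B" by (auto simp: bounded_iff)
  then show ?thesis using curvature_eq by (intro bdd_aboveI[of _ B]) auto
qed

end

section \<open>Estimates on a positively cut triangle\<close>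

lemma cos_less_imp_gt:
  assumes "cos x < cos y" "0 \<le> x" "y \<le> pi"
  shows "y < x"
  using cos_monotone_0_pi_le[of x y] assms by force

text \<open>The difference of the two sides factors as \<open>4 sin (d/2) sin (t/2) sin ((t - d)/2)\<close>.\<close>

lemma sin_increment_le:
  assumes "0 \<le> d" "d \<le> t" "t \<le> pi"
  shows "sin t - sin (t - d) \<le> sin d"
proof -
  have t2: "2 * (t/2) = t" "2 * (d/2) = d" by auto
  have s: "sin t = 2 * sin (t/2) * cos (t/2)" "cos t = 1 - 2 * (sin (t/2))\<^sup>2"
    "sin d = 2 * sin (d/2) * cos (d/2)" "cos d = 1 - 2 * (sin (d/2))\<^sup>2"
    using sin_double[of "t/2"] sin_double[of "d/2"] cos_double_sin[of "t/2"] cos_double_sin[of "d/2"]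
    unfolding t2 by auto
  have p: "0 \<le> sin (t/2)" "0 \<le> sin (d/2)" "0 \<le> sin (t/2 - d/2)"
    using assms by (auto intro!: sin_ge_zero)
  have "sin d - (sin t - sin (t - d)) = sin d * (1 - cos t) - sin t * (1 - cos d)"
    by (simp add: sin_diff algebra_simps)
  also have "\<dots> = 4 * sin (d/2) * sin (t/2) * sin (t/2 - d/2)"
    unfolding s sin_diff by (simp add: power2_eq_square algebra_simps)
  also have "\<dots> \<ge> 0" using p by simp
  finally show ?thesis by simp
qed

text \<open>\<open>(a, b)\<close> are the components of a unit normal along and across the positive edge. The
  hypotheses say that it points away from the negative vertex and is nearly nondecreasing along the
  edge; they confine the normal to a sector on the far side of the edge. Here \<open>s\<close> bounds the variation of
  the normal on the triangle, and \<open>\<eta>\<close> is the scaled decrease of the signed distance towards the negative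
  vertex. In terms of the polar angle \<open>t\<close> of \<open>(a, b)\<close>, the condition \<open>toward\<close> puts \<open>t\<close> between \<open>\<beta> + \<theta>\<close>
  and \<open>2 pi - (\<beta> - \<theta>)\<close>; as \<open>\<beta> + \<theta> > pi/2 + d\<close>, where \<open>sin d = s/2\<close>, the condition \<open>along\<close> then raises
  the lower bound to \<open>3 pi/2 - d\<close>.\<close>

lemma normal_sector:
  fixes a b s \<sigma> \<eta> \<theta> \<beta> :: real
  assumes ab: "a\<^sup>2 + b\<^sup>2 = 1" and \<theta>: "0 < \<theta>" "\<theta> < pi/2" and s: "0 < s" "3/2 \<le> \<sigma>"
    and lt: "\<sigma> * s < cos \<theta>" "\<sigma> * s < sin (\<theta>/2)"
    and \<eta>: "0 < \<eta>" "\<eta> \<le> sin \<theta> + s"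
    and \<beta>: "0 \<le> \<beta>" "\<beta> \<le> pi" "cos \<beta> = \<sigma> * s - \<eta>"
    and along: "- s/2 \<le> a" and toward: "a * cos \<theta> + b * sin \<theta> \<le> s - \<eta>"
  shows "0 < sin (\<beta> - \<theta>)" "b \<le> - sin (\<beta> - \<theta>)"
proof -
  have sle: "3/2 * s \<le> \<sigma> * s" using s by (intro mult_right_mono) auto
  define d where "d = arcsin (s/2)"
  have s1: "s/2 < sin (\<theta>/2)" using lt(2) sle s(1) by linarith
  have s2: "s/2 < 1" using s1 sin_le_one[of "\<theta>/2"] by linarith
  have sd: "sin d = s/2" unfolding d_def by (rule sin_arcsin) (use s(1) s2 in linarith)+
  have d: "0 < d" "d \<le> pi/2"
    using arcsin_bounded[of "s/2"] arcsin_less_arcsin[of 0 "s/2"] s s2 unfolding d_def by auto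
  have d2: "d < \<theta>/2"
  proof (rule ccontr)
    assume "\<not> d < \<theta>/2"
    then have "sin (\<theta>/2) \<le> sin d" using d \<theta> by (intro sin_monotone_2pi_le) auto
    then show False using s1 sd by simp
  qed
  have b1: "\<theta> < \<beta>" by (rule cos_less_imp_gt) (use \<beta> \<eta> lt \<theta> in auto)
  have b2: "pi/2 - \<theta>/2 < \<beta>"
    by (rule cos_less_imp_gt) (use \<beta> \<eta> lt \<theta> in \<open>auto simp: cos_diff\<close>)
  \<comment> \<open>Here \<open>\<sigma> \<ge> 3/2\<close> enters: otherwise \<open>\<eta> > \<sigma> s + sin (\<theta> - d) \<ge> sin \<theta> + s\<close>, contrary to
    the assumed bound.\<close>
  have b3: "\<beta> - \<theta> \<le> pi/2 - d"
  proof (rule ccontr)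
    assume "\<not> \<beta> - \<theta> \<le> pi/2 - d"
    then have "cos \<beta> < cos (pi/2 + (\<theta> - d))" using d2 \<beta> \<theta> by (intro cos_monotone_0_pi) auto
    also have "\<dots> = - sin (\<theta> - d)" by (simp add: cos_add)
    finally have "\<sigma> * s - \<eta> < - sin (\<theta> - d)" using \<beta>(3) by simp
    moreover have "sin \<theta> - sin (\<theta> - d) \<le> s/2"
      using sin_increment_le[of d \<theta>] d d2 \<theta> sd by simp
    ultimately show False using \<eta> sle by linarith
  qed
  show pos: "0 < sin (\<beta> - \<theta>)" using b1 b3 d by (intro sin_gt_zero) auto
  obtain t where t: "0 \<le> t" "t < 2 * pi" "a = cos t" "b = sin t"
    using sincos_total_2pi[OF ab] by blast
  have ct: "cos (t - \<theta>) \<le> cos \<beta>"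
    using toward \<beta>(3) sle s(1) unfolding t cos_diff by linarith
  have t1: "\<beta> \<le> t - \<theta>"
  proof (rule ccontr)
    assume "\<not> \<beta> \<le> t - \<theta>"
    then have "\<bar>t - \<theta>\<bar> < \<beta>" using t b1 by auto
    then have "cos \<beta> < cos \<bar>t - \<theta>\<bar>" using \<beta> by (intro cos_monotone_0_pi) auto
    then show False using ct by simp
  qed
  have t2: "t - \<theta> \<le> 2 * pi - \<beta>"
  proof (rule ccontr)
    assume "\<not> t - \<theta> \<le> 2 * pi - \<beta>"
    then have "cos \<beta> < cos (2 * pi - (t - \<theta>))" using \<beta> t \<theta> by (intro cos_monotone_0_pi) auto
    then show False using ct by (simp add: cos_diff)
  qed
  have t3: "3 * pi/2 - d \<le> t"
  proof (rule ccontr)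
    assume "\<not> 3 * pi/2 - d \<le> t"
    then have "\<bar>t - pi\<bar> < pi/2 - d" using t1 b2 d2 by auto
    then have "cos (pi/2 - d) < cos \<bar>t - pi\<bar>" using d by (intro cos_monotone_0_pi) auto
    then have "sin d < - cos t" by (simp add: cos_diff)
    then show False using along sd t by simp
  qed
  define u where "u = t - 3 * pi/2"
  have "\<bar>u\<bar> \<le> pi/2 - (\<beta> - \<theta>)" using t3 t2 b3 unfolding u_def by auto
  then have "cos (pi/2 - (\<beta> - \<theta>)) \<le> cos \<bar>u\<bar>"
    using b1 by (intro cos_monotone_0_pi_le) auto
  then have "sin (\<beta> - \<theta>) \<le> cos u" by (simp add: cos_diff)
  also have "cos u = - sin t"
  proof -
    have "cos u = cos (t - pi/2 - pi)" unfolding u_def by (simp add: algebra_simps)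
    also have "\<dots> = - cos (t - pi/2)" by (rule cos_minus_pi)
    also have "\<dots> = - sin t" by (simp add: cos_diff)
    finally show ?thesis .
  qed
  finally show "b \<le> - sin (\<beta> - \<theta>)" using t by simp
qed

text \<open>The positive edge of the triangle is \<open>[p, q]\<close>, with \<open>p\<close> the proximal vertex.\<close>

locale cut_triangle = tubular_curve +
  fixes K :: "(real^2) set" and p q w :: "real^2"
  assumes tri: "is_triangle K p q w"
    and phi_p: "0 \<le> signed_distance \<Omega> p"
    and phi_le: "signed_distance \<Omega> p \<le> signed_distance \<Omega> q"
    and phi_w: "signed_distance \<Omega> w < 0"
    and h_less: "diameter K < r"
    and angle_less: "interior_angle K p < pi/2"
    and pos: "0 < shape_parameter K * curvature_const \<Omega> K * diameter K"
    and less_cos: "shape_parameter K * curvature_const \<Omega> K * diameter K < cos (interior_angle K p)"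
    and less_sin: "shape_parameter K * curvature_const \<Omega> K * diameter K < sin (interior_angle K p / 2)"
begin

abbreviation "h \<equiv> diameter K"
abbreviation "\<sigma> \<equiv> shape_parameter K"
abbreviation "M \<equiv> max_curvature \<Omega> K"
abbreviation "C \<equiv> curvature_const \<Omega> K"
abbreviation "\<theta> \<equiv> interior_angle K p"

lemma h_pos: "0 < h"
  by (rule triangle_diameter_pos[OF tri])

lemma Gamma_nonempty: "\<Gamma> \<noteq> {}"
  using segment_meets_Gamma[OF phi_w phi_p] by blast

text \<open>A segment from the given point to a vertex on the other side meets \<open>\<Gamma>\<close>.\<close>

lemma infdist_le_h:
  assumes x: "x \<in> K"
  shows "infdist x \<Gamma> \<le> h"
proof -
  note V = triangle_vertices[OF tri]
  obtain y z where yz: "y \<in> K" "z \<in> closed_segment x y" "z \<in> \<Gamma>"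
  proof (cases "\<phi> x < 0")
    case True
    then show ?thesis using segment_meets_Gamma[OF True phi_p] that V by blast
  next
    case False
    then show ?thesis using segment_meets_Gamma[OF phi_w, of x] that V
      by (metis closed_segment_commute not_less)
  qed
  have "z \<in> K" using yz x triangle_compact(2)[OF tri] by (meson closed_segment_subset subsetD)
  then show ?thesis using infdist_le[OF yz(3), of x] triangle_dist_le[OF tri x] by force
qed

lemma abs_phi_le_h: "x \<in> K \<Longrightarrow> \<bar>\<phi> x\<bar> \<le> h"
  using infdist_le_h abs_signed_distance by simp

lemma K_subset_U: "x \<in> K \<Longrightarrow> x \<in> U"
  using infdist_le_h[of x] h_less infdist_proj[OF Gamma_nonempty, of x]
    closest_point_in_set[OF closed_Gamma Gamma_nonempty, of x] mem_U[of "\<pi> x" x] by force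

text \<open>This makes the maximal curvature of the triangle an upper bound for the curvature at the foot
  points of the triangle.\<close>

lemma foot_in_neighbourhood:
  assumes x: "x \<in> K"
  shows "\<pi> x \<in> closure (nbhd (interior K) h) \<inter> \<Gamma>"
proof
  show "\<pi> x \<in> \<Gamma>" by (rule tubular_coordinates(2)[OF K_subset_U[OF x]])
  have "closure (interior K) = K"
    using convex_closure_interior triangle_interior_nonempty triangle_compact[OF tri] tri closure_closed
    by metis
  then have xc: "x \<in> closure (interior K)" using x by simp
  have d: "dist x (\<pi> x) \<le> h" using infdist_le_h[OF x] infdist_proj[OF Gamma_nonempty] by simp
  show "\<pi> x \<in> closure (nbhd (interior K) h)"
    unfolding closure_approachable
  proof (intro allI impI)
    fix e :: real assume e: "e > 0"
    obtain y where y: "y \<in> interior K" "dist y x < e/2"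
      using xc e unfolding closure_approachable by (meson half_gt_zero)
    define m where "m = min 1 (e / (2 * (h + e)))"
    have m: "0 < m" "m \<le> 1" "m * (h + e) \<le> e/2"
      using e h_pos by (auto simp: m_def field_simps min_def)
    define z where "z = \<pi> x - (m *\<^sub>R (\<pi> x - x) + (x - y))"
    have zy: "z = y + (1 - m) *\<^sub>R (\<pi> x - x)" by (simp add: z_def algebra_simps)
    have "dist y z = (1 - m) * dist x (\<pi> x)" using m by (simp add: zy dist_norm norm_minus_commute)
    also have "\<dots> \<le> (1 - m) * h" using d m by (intro mult_left_mono) auto
    also have "\<dots> < h" using m h_pos by simp
    finally have "z \<in> nbhd (interior K) h" using y unfolding nbhd_def by auto
    moreover have "dist z (\<pi> x) < e"
    proof -
      have "dist z (\<pi> x) = norm (m *\<^sub>R (\<pi> x - x) + (x - y))"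
        unfolding dist_commute[of z] by (simp add: z_def dist_norm del: minus_diff_eq)
      also have "\<dots> \<le> m * dist x (\<pi> x) + dist y x"
        using norm_triangle_ineq[of "m *\<^sub>R (\<pi> x - x)" "x - y"] m
        by (simp add: dist_norm norm_minus_commute)
      also have "m * dist x (\<pi> x) \<le> m * (h + e)" using d e m by (intro mult_left_mono) auto
      finally show ?thesis using m y(2) by linarith
    qed
    ultimately show "\<exists>z\<in>nbhd (interior K) h. dist z (\<pi> x) < e" by blast
  qed
qed

lemma level_curvature_foot_le:
  assumes x: "x \<in> K"
  shows "\<bar>level_curvature (\<pi> x)\<bar> \<le> M"
proof -
  have "curvature \<Omega> (\<pi> x) \<le> M"
    unfolding max_curvature_def by (rule cSUP_upper[OF foot_in_neighbourhood[OF x] curvature_bdd_above])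
  then show ?thesis using curvature_eq foot_in_neighbourhood[OF x] by simp
qed

lemma constants:
  shows sigma_ge: "3/2 \<le> \<sigma>" and C_pos: "0 < C" and M_pos: "0 < M" and Mh_less: "M * h < 1"
proof -
  show s: "3/2 \<le> \<sigma>" by (rule shape_parameter_ge[OF tri])
  show C: "0 < C" using pos s h_pos by (simp add: zero_less_mult_iff)
  have "0 \<le> M" using level_curvature_foot_le[OF triangle_vertices(1)[OF tri]] by linarith
  then show "0 < M" "M * h < 1"
    using C h_pos unfolding curvature_const_def by (auto simp: zero_less_divide_iff not_less)
qed

text \<open>With \<open>b = \<phi> x level_curvature (\<pi> x)\<close>, the stretching factor is \<open>1 / (1 + b)\<close>, and \<open>\<bar>b\<bar> \<le> M h < 1\<close>.\<close>

lemma stretch_bounds: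
  assumes x: "x \<in> K"
  shows "1 / (1 + M * h) \<le> 1 - \<phi> x * level_curvature x" "1 - \<phi> x * level_curvature x \<le> 1 / (1 - M * h)"
    "\<bar>level_curvature x\<bar> \<le> C"
proof -
  note xU = K_subset_U[OF x]
  define a where "a = 1 - \<phi> x * level_curvature x"
  define b where "b = \<phi> x * level_curvature (\<pi> x)"
  have "\<bar>b\<bar> \<le> h * M" unfolding b_def abs_mult
    using abs_phi_le_h[OF x] level_curvature_foot_le[OF x] by (intro mult_mono) auto
  then have b: "-(M * h) \<le> b" "b \<le> M * h" by (auto simp: mult.commute)
  have eq: "a * (1 + b) = 1" unfolding a_def b_def by (rule level_curvature_foot'[OF xU])
  have pos: "0 < 1 + b" "0 < 1 - M * h" "0 < 1 + M * h" using b Mh_less M_pos h_pos by auto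
  have a: "a = 1 / (1 + b)" using eq pos by (simp add: field_simps)
  show l: "1 / (1 + M * h) \<le> 1 - \<phi> x * level_curvature x"
    using b pos unfolding a_def[symmetric] a by (simp add: frac_le)
  show u: "1 - \<phi> x * level_curvature x \<le> 1 / (1 - M * h)"
    using b pos unfolding a_def[symmetric] a by (simp add: frac_le)
  have "\<bar>level_curvature x\<bar> = a * \<bar>level_curvature (\<pi> x)\<bar>"
    using level_curvature_foot[OF xU] a pos unfolding a_def[symmetric] by (metis abs_mult abs_of_pos zero_less_divide_1_iff)
  also have "\<dots> \<le> (1 / (1 - M * h)) * M"
    using u a pos level_curvature_foot_le[OF x] unfolding a_def[symmetric] by (intro mult_mono) auto
  finally show "\<bar>level_curvature x\<bar> \<le> C" by (simp add: curvature_const_def)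
qed

lemma nu_lipschitz:
  assumes "x \<in> K" "y \<in> K"
  shows "norm (\<nu> y - \<nu> x) \<le> C * dist x y"
proof -
  have "norm (\<nu> x - \<nu> y) \<le> C * norm (x - y)"
  proof (rule differentiable_bound[OF triangle_compact(2)[OF tri] _ _ assms])
    fix z assume z: "z \<in> K"
    show "(\<nu> has_derivative Hess z) (at z within K)"
      by (rule has_derivative_at_withinI[OF nu_has_derivative[OF K_subset_U[OF z]]])
    show "onorm (Hess z) \<le> C"
    proof (rule onorm_le)
      fix v
      have "\<bar>rot (\<nu> z) \<bullet> v\<bar> \<le> norm v"
        using Cauchy_Schwarz_ineq2[of "rot (\<nu> z)" v] norm_nu[OF K_subset_U[OF z]] by simp
      then have "\<bar>level_curvature z\<bar> * \<bar>rot (\<nu> z) \<bullet> v\<bar> \<le> C * norm v"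
        using stretch_bounds(3)[OF z] C_pos by (intro mult_mono) auto
      then show "norm (Hess z v) \<le> C * norm v"
        using norm_nu[OF K_subset_U[OF z]] by (simp add: H_eq[OF K_subset_U[OF z]] abs_mult)
    qed
  qed
  then show ?thesis by (simp add: dist_norm norm_minus_commute)
qed

lemma phi_along_segment:
  assumes "x \<in> K" "y \<in> K" "0 \<le> t" "t \<le> 1"
  shows "x + t *\<^sub>R (y - x) \<in> K"
    "((\<lambda>t. \<phi> (x + t *\<^sub>R (y - x))) has_real_derivative \<nu> (x + t *\<^sub>R (y - x)) \<bullet> (y - x)) (at t)"
proof -
  have "x + t *\<^sub>R (y - x) \<in> closed_segment x y"
    using assms by (auto simp: in_segment algebra_simps intro!: exI[of _ t])
  then show z: "x + t *\<^sub>R (y - x) \<in> K"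
    using assms triangle_compact(2)[OF tri] by (meson closed_segment_subset subsetD)
  have line: "((\<lambda>t. x + t *\<^sub>R (y - x)) has_derivative (\<lambda>s. s *\<^sub>R (y - x))) (at t)"
    by (auto intro!: derivative_eq_intros)
  show "((\<lambda>t. \<phi> (x + t *\<^sub>R (y - x))) has_real_derivative \<nu> (x + t *\<^sub>R (y - x)) \<bullet> (y - x)) (at t)"
    using has_derivative_compose[OF line signed_distance_has_derivative[OF K_subset_U[OF z]]]
    by (simp add: has_field_derivative_def mult_commute_abs)
qed

lemma phi_mean_value:
  assumes "x \<in> K" "y \<in> K" "x \<noteq> y"
  shows "\<exists>z\<in>closed_segment x y. \<phi> y - \<phi> x = \<nu> z \<bullet> (y - x)"
proof -
  have "\<exists>t. 0 < t \<and> t < 1 \<and> \<phi> (x + 1 *\<^sub>R (y - x)) - \<phi> (x + 0 *\<^sub>R (y - x)) =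
      (1 - 0) * (\<nu> (x + t *\<^sub>R (y - x)) \<bullet> (y - x))"
    by (rule MVT2) (use phi_along_segment(2)[OF assms(1,2)] in auto)
  then obtain t where "0 < t" "t < 1" "\<phi> y - \<phi> x = \<nu> (x + t *\<^sub>R (y - x)) \<bullet> (y - x)" by auto
  moreover have "x + t *\<^sub>R (y - x) \<in> closed_segment x y"
    using \<open>0 < t\<close> \<open>t < 1\<close> by (auto simp: in_segment algebra_simps intro!: exI[of _ t])
  ultimately show ?thesis by blast
qed

lemma phi_taylor:
  assumes x: "x \<in> K" and y: "y \<in> K"
  shows "\<bar>\<phi> y - \<phi> x - \<nu> x \<bullet> (y - x)\<bar> \<le> C/2 * (dist x y)\<^sup>2"
proof -
  define D where "D = dist x y"
  define z where "z t = x + t *\<^sub>R (y - x)" for t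
  have diff: "\<bar>(\<nu> (z t) - \<nu> x) \<bullet> (y - x)\<bar> \<le> C * D\<^sup>2 * t" if "0 \<le> t" "t \<le> 1" for t
  proof -
    have "\<bar>(\<nu> (z t) - \<nu> x) \<bullet> (y - x)\<bar> \<le> norm (\<nu> (z t) - \<nu> x) * norm (y - x)"
      by (rule Cauchy_Schwarz_ineq2)
    also have "\<dots> \<le> (C * dist x (z t)) * norm (y - x)"
      using nu_lipschitz[OF x phi_along_segment(1)[OF x y that]]
      by (intro mult_right_mono) (auto simp: z_def)
    also have "\<dots> = C * D\<^sup>2 * t"
      using that by (simp add: z_def D_def dist_norm norm_minus_commute power2_eq_square)
    finally show ?thesis .
  qed
  have main: "e * (\<phi> y - \<phi> x - \<nu> x \<bullet> (y - x)) \<le> C/2 * D\<^sup>2" if e: "\<bar>e\<bar> = 1" for e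
  proof -
    define g where "g t = e * (\<phi> (z t) - t * (\<nu> x \<bullet> (y - x))) - C/2 * D\<^sup>2 * t\<^sup>2" for t
    have "g 1 \<le> g 0"
    proof (rule DERIV_nonpos_imp_nonincreasing[of 0 1 g])
      fix t :: real assume t: "0 \<le> t" "t \<le> 1"
      have "(g has_real_derivative e * (\<nu> (z t) \<bullet> (y - x) - \<nu> x \<bullet> (y - x)) - C * D\<^sup>2 * t) (at t)"
        unfolding g_def z_def
        by (auto intro!: derivative_eq_intros phi_along_segment(2)[OF x y t])
      moreover have "e * (\<nu> (z t) \<bullet> (y - x) - \<nu> x \<bullet> (y - x)) - C * D\<^sup>2 * t \<le> 0"
      proof -
        have "e * (\<nu> (z t) \<bullet> (y - x) - \<nu> x \<bullet> (y - x)) \<le> \<bar>e\<bar> * \<bar>(\<nu> (z t) - \<nu> x) \<bullet> (y - x)\<bar>"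
          by (metis abs_ge_self abs_mult inner_diff_left)
        then show ?thesis using diff[OF t] e by simp
      qed
      ultimately show "\<exists>d. (g has_real_derivative d) (at t) \<and> d \<le> 0" by blast
    qed simp
    then show ?thesis by (simp add: g_def z_def algebra_simps)
  qed
  show ?thesis using main[of 1] main[of "-1"] unfolding D_def abs_le_iff by simp
qed

lemma edge_subset: "x \<in> closed_segment p q \<Longrightarrow> x \<in> K"
  using triangle_closed_segment[OF tri] by blast

text \<open>Taylor expansions from \<open>x\<close> to the end points, weighted so that the gradient terms cancel.\<close>

lemma phi_lower_bound:
  assumes x: "x \<in> closed_segment p q"
  shows "- (C/2 * (dist x p * dist x q)) \<le> \<phi> x"
proof -
  obtain u where u: "0 \<le> u" "u \<le> 1" "x = (1 - u) *\<^sub>R p + u *\<^sub>R q"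
    using x by (auto simp: in_segment)
  note xK = edge_subset[OF x] and V = triangle_vertices[OF tri]
  define L where "L = dist p q"
  have xp: "p - x = - u *\<^sub>R (q - p)" "q - x = (1 - u) *\<^sub>R (q - p)"
    by (simp_all add: u algebra_simps)
  have d: "dist x p = u * L" "dist x q = (1 - u) * L"
    unfolding dist_norm L_def norm_minus_commute[of x] xp using u by (simp_all add: norm_minus_commute)
  have p1: "\<phi> p \<le> \<phi> x - u * (\<nu> x \<bullet> (q - p)) + C/2 * (u * L)\<^sup>2"
    using phi_taylor[OF xK V(1), unfolded d xp abs_le_iff] by simp
  have q1: "\<phi> q \<le> \<phi> x + (1 - u) * (\<nu> x \<bullet> (q - p)) + C/2 * ((1 - u) * L)\<^sup>2"
    using phi_taylor[OF xK V(2), unfolded d xp abs_le_iff] by simp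
  have "0 \<le> (1 - u) * \<phi> p + u * \<phi> q" using u phi_p phi_le by simp
  also have "\<dots> \<le> (1 - u) * (\<phi> x - u * (\<nu> x \<bullet> (q - p)) + C/2 * (u * L)\<^sup>2)
      + u * (\<phi> x + (1 - u) * (\<nu> x \<bullet> (q - p)) + C/2 * ((1 - u) * L)\<^sup>2)"
    using p1 q1 u by (intro add_mono mult_left_mono) auto
  also have "\<dots> = \<phi> x + C/2 * ((u * L) * ((1 - u) * L))"
    by (simp add: power2_eq_square field_simps)
  finally show ?thesis unfolding d by simp
qed

text \<open>The decrease of the signed distance from the proximal to the negative vertex, per unit
  diameter; \<open>\<beta>\<close> bounds from below the angle between the normal and the edge to the negative
  vertex.\<close>

definition \<eta> :: real where "\<eta> = (\<phi> p - \<phi> w) / h"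
definition \<beta> :: real where "\<beta> = arccos (C * \<sigma> * h - \<eta>)"

abbreviation "edge_dir \<equiv> sgn (q - p)"
abbreviation "edge_nor \<equiv> sgn (cross (q - p) (w - p)) *\<^sub>R rot (sgn (q - p))"

text \<open>The edge direction and the unit vector orthogonal to it on the side of \<open>w\<close> form an orthonormal frame in which
  the direction of the other edge at \<open>p\<close> has polar angle \<open>\<theta>\<close>.\<close>

lemma frame:
  shows "norm edge_dir = 1" "q - p = dist p q *\<^sub>R edge_dir"
    "w - p = dist p w *\<^sub>R (cos \<theta> *\<^sub>R edge_dir + sin \<theta> *\<^sub>R edge_nor)"
proof -
  note D = is_triangleD[OF tri]
  show n1: "norm edge_dir = 1" using D by (simp add: norm_sgn)
  have pq: "norm (q - p) > 0" using D by simp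
  show qp: "q - p = dist p q *\<^sub>R edge_dir"
    using pq by (simp add: sgn_div_norm dist_norm norm_minus_commute)
  note tr = interior_angle_trig[OF tri]
  define A where "A = cross (q - p) (w - p)"
  have "edge_dir \<bullet> (w - p) = norm (w - p) * cos \<theta>"
    using tr(3) pq by (simp add: sgn_div_norm)
  moreover have "rot edge_dir \<bullet> (w - p) = sgn A * (norm (w - p) * sin \<theta>)"
  proof -
    have "rot edge_dir \<bullet> (w - p) = A / norm (q - p)"
      by (simp add: A_def cross_rot[symmetric] sgn_div_norm cross_simps(5) divide_inverse mult.commute)
    also have "A = sgn A * (norm (q - p) * norm (w - p) * sin \<theta>)"
      using tr(4) unfolding A_def[symmetric] by (metis sgn_mult_abs)
    finally show ?thesis using pq by simp
  qed
  ultimately show "w - p = dist p w *\<^sub>R (cos \<theta> *\<^sub>R edge_dir + sin \<theta> *\<^sub>R edge_nor)"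
    using orthonormal_expansion[OF n1, of "w - p"]
    by (simp add: A_def dist_norm norm_minus_commute scaleR_add_right mult_ac)
qed

lemma theta_pos: "0 < \<theta>"
  using interior_angle_trig(1)[OF tri] .

lemma eta_bounds: "0 < \<eta>" "\<eta> \<le> 1"
proof -
  show "0 < \<eta>" using phi_p phi_w h_pos by (simp add: \<eta>_def)
  have "\<phi> p - \<phi> w \<le> h"
    using signed_distance_lipschitz[of p w] triangle_dist_le[OF tri triangle_vertices(1,3)[OF tri]] by linarith
  then show "\<eta> \<le> 1" using h_pos by (simp add: \<eta>_def)
qed

lemma beta: "0 \<le> \<beta>" "\<beta> \<le> pi" "cos \<beta> = \<sigma> * (C * h) - \<eta>"
proof -
  have e: "C * \<sigma> * h = \<sigma> * (C * h)" by simp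
  have "-1 \<le> \<sigma> * (C * h) - \<eta>" "\<sigma> * (C * h) - \<eta> \<le> 1"
    using eta_bounds pos less_cos cos_le_one[of \<theta>] unfolding mult.assoc[symmetric] by linarith+
  then show "0 \<le> \<beta>" "\<beta> \<le> pi" "cos \<beta> = \<sigma> * (C * h) - \<eta>"
    unfolding \<beta>_def e by (auto intro: arccos_lbound arccos_ubound)
qed

text \<open>The three inequalities required by \<open>normal_sector\<close> come from the mean value theorem on the two
  edges at \<open>p\<close> and from Taylor expansions at \<open>x\<close>.\<close>

lemma normal_on_edge:
  assumes x: "x \<in> closed_segment p q"
  shows "0 < sin (\<beta> - \<theta>)" "\<nu> x \<bullet> edge_nor \<le> - sin (\<beta> - \<theta>)"
proof -
  note V = triangle_vertices[OF tri] and D = is_triangleD[OF tri]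
  define d where "d = cos \<theta> *\<^sub>R edge_dir + sin \<theta> *\<^sub>R edge_nor"
  have n1: "edge_nor \<bullet> edge_nor = 1" "edge_dir \<bullet> edge_dir = 1" "edge_dir \<bullet> edge_nor = 0"
    using frame(1) D by (simp_all add: norm_eq_1 sgn_if)
  have d1: "norm d = 1"
    unfolding norm_eq_1 d_def using n1
    by (simp add: inner_add_left inner_add_right inner_commute power2_eq_square[symmetric]
        power_mult_distrib)
  have wp: "w - p = dist p w *\<^sub>R d" using frame(3) by (simp add: d_def)
  have pw: "0 < dist p w" "dist p w \<le> h" using D triangle_dist_le[OF tri V(1,3)] by auto
  have pq: "0 < dist p q" "dist p q \<le> h" using D triangle_dist_le[OF tri V(1,2)] by auto
  define a where "a y = \<nu> y \<bullet> edge_dir" for y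
  define b where "b y = \<nu> y \<bullet> edge_nor" for y
  have ab: "(a y)\<^sup>2 + (b y)\<^sup>2 = 1" if "y \<in> K" for y
  proof -
    have "\<nu> y = a y *\<^sub>R edge_dir + b y *\<^sub>R edge_nor"
      using orthonormal_expansion[OF frame(1), of "\<nu> y"] D
      by (simp add: a_def b_def sgn_if inner_commute)
    then have "\<nu> y \<bullet> \<nu> y = (a y)\<^sup>2 + (b y)\<^sup>2"
      using n1 by (simp add: inner_add_left inner_add_right power2_eq_square inner_commute)
    then show ?thesis using norm_nu[OF K_subset_U[OF that]] by (simp add: norm_eq_1)
  qed
  have dab: "\<nu> y \<bullet> d = a y * cos \<theta> + b y * sin \<theta>" for y
    by (simp add: d_def a_def b_def inner_add_right mult.commute)
  obtain z where z: "z \<in> closed_segment p w" "\<phi> w - \<phi> p = \<nu> z \<bullet> (w - p)"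
    using phi_mean_value[OF V(1,3)] D by blast
  obtain y where y: "y \<in> closed_segment p q" "\<phi> q - \<phi> p = \<nu> y \<bullet> (q - p)"
    using phi_mean_value[OF V(1,2)] D by blast
  have zK: "z \<in> K" using z V triangle_compact(2)[OF tri] by (meson closed_segment_subset subsetD)
  have yK: "y \<in> K" and xK: "x \<in> K" using y x edge_subset by auto
  have zd: "\<eta> * h = dist p w * (- (\<nu> z \<bullet> d))"
    using z(2) h_pos unfolding wp \<eta>_def by simp
  have diff: "\<nu> u \<bullet> d \<le> \<nu> v \<bullet> d + C * h" if "u \<in> K" "v \<in> K" for u v
  proof -
    have "\<nu> u \<bullet> d - \<nu> v \<bullet> d \<le> norm (\<nu> u - \<nu> v)"
      using Cauchy_Schwarz_ineq2[of "\<nu> u - \<nu> v" d] d1 by (simp add: inner_diff_left)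
    also have "\<dots> \<le> C * dist v u" by (rule nu_lipschitz[OF that(2,1)])
    also have "\<dots> \<le> C * h" using C_pos triangle_dist_le[OF tri that(2,1)] by simp
    finally show ?thesis by simp
  qed
  have st: "0 < sin \<theta>" "0 < cos \<theta>"
    using theta_pos angle_less by (auto intro!: sin_gt_zero cos_gt_zero)
  have "0 < sin (\<beta> - \<theta>) \<and> b x \<le> - sin (\<beta> - \<theta>)"
  proof -
    \<comment> \<open>Some normal on the positive edge makes an angle of at most \<open>pi/2\<close> with it, so its
      component against the direction of the other edge is at most \<open>sin \<theta>\<close>.\<close>
    have up: "\<eta> \<le> sin \<theta> + C * h"
    proof -
      have "dist p q * a y = \<phi> q - \<phi> p"
        unfolding y(2) by (subst frame(2)) (simp add: a_def)
      then have "0 \<le> dist p q * a y" using phi_le by simp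
      then have "0 \<le> a y" using pq by (simp add: zero_le_mult_iff)
      moreover have "- 1 \<le> b y"
      proof -
        have "(b y)\<^sup>2 \<le> 1\<^sup>2" using ab[OF yK] by (metis le_add_same_cancel2 one_power2 zero_le_power2)
        then have "\<bar>b y\<bar> \<le> 1" using abs_le_square_iff[of "b y" 1] by simp
        then show ?thesis by simp
      qed
      ultimately have "0 \<le> a y * cos \<theta>" "(-1) * sin \<theta> \<le> b y * sin \<theta>"
        using st by (simp, intro mult_right_mono, simp_all)
      then have "- (\<nu> y \<bullet> d) \<le> sin \<theta>" unfolding dab by simp
      then have "- (\<nu> z \<bullet> d) \<le> sin \<theta> + C * h" using diff[OF yK zK] by linarith
      then have "\<eta> * h \<le> dist p w * (sin \<theta> + C * h)"
        unfolding zd using pw by (intro mult_left_mono) auto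
      also have "\<dots> \<le> h * (sin \<theta> + C * h)"
        using pw st C_pos h_pos by (intro mult_right_mono) auto
      finally show ?thesis using h_pos by (simp add: mult.commute)
    qed
    have toward: "a x * cos \<theta> + b x * sin \<theta> \<le> C * h - \<eta>"
    proof -
      have "0 < \<eta> * h" using eta_bounds h_pos by simp
      then have "0 < - (\<nu> z \<bullet> d)" using zd pw by (metis zero_less_mult_pos)
      then have "\<eta> * h \<le> h * (- (\<nu> z \<bullet> d))" unfolding zd using pw by (intro mult_right_mono) auto
      then have "h * \<eta> \<le> h * (- (\<nu> z \<bullet> d))" by (simp only: mult.commute)
      then have "\<eta> \<le> - (\<nu> z \<bullet> d)" using h_pos by (simp only: mult_le_cancel_left_pos)
      then show ?thesis using diff[OF xK zK] dab by simp
    qed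
    \<comment> \<open>The squares of the distances to \<open>p\<close> and \<open>q\<close> add up to at most the square of the edge length;
      this gains the factor 1/2 over the mean value theorem.\<close>
    have along: "- (C * h)/2 \<le> a x"
    proof -
      have t: "\<phi> q \<le> \<phi> x + \<nu> x \<bullet> (q - x) + C/2 * (dist x q)\<^sup>2"
        "\<phi> x + \<nu> x \<bullet> (p - x) - C/2 * (dist x p)\<^sup>2 \<le> \<phi> p"
        using phi_taylor[OF xK V(2), unfolded abs_le_iff] phi_taylor[OF xK V(1), unfolded abs_le_iff]
        by simp_all
      have e: "\<nu> x \<bullet> (q - x) - \<nu> x \<bullet> (p - x) = dist p q * a x"
      proof -
        have "\<nu> x \<bullet> (q - x) - \<nu> x \<bullet> (p - x) = \<nu> x \<bullet> (q - p)" by (simp add: inner_diff_right)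
        also have "\<dots> = dist p q * a x" by (subst frame(2)) (simp add: a_def)
        finally show ?thesis .
      qed
      have s: "dist p q = dist x p + dist x q"
        using x between_mem_segment between by (metis dist_commute)
      have "(dist x p)\<^sup>2 + (dist x q)\<^sup>2 \<le> (dist p q)\<^sup>2"
        unfolding s power2_sum by simp
      then have "C/2 * ((dist x p)\<^sup>2 + (dist x q)\<^sup>2) \<le> C/2 * (dist p q)\<^sup>2"
        using C_pos by (intro mult_left_mono) auto
      then have "0 \<le> dist p q * a x + C/2 * (dist p q)\<^sup>2"
        using t e phi_le by (simp add: distrib_left)
      then have "0 \<le> dist p q * (a x + C/2 * dist p q)" by (simp add: power2_eq_square algebra_simps)
      then have "0 \<le> a x + C/2 * dist p q" using pq by (simp add: zero_le_mult_iff)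
      moreover have "C/2 * dist p q \<le> C/2 * h" using C_pos pq by (intro mult_left_mono) auto
      ultimately show ?thesis by simp
    qed
    have sC: "0 < C * h" using C_pos h_pos by simp
    have lc: "\<sigma> * (C * h) < cos \<theta>" and ls: "\<sigma> * (C * h) < sin (\<theta>/2)"
      using less_cos less_sin by (simp_all add: mult.assoc)
    show ?thesis using normal_sector[OF ab[OF xK] theta_pos angle_less sC sigma_ge lc ls eta_bounds(1) up beta along toward]
      by blast
  qed
  then show "0 < sin (\<beta> - \<theta>)" "\<nu> x \<bullet> edge_nor \<le> - sin (\<beta> - \<theta>)" by (auto simp: b_def)
qed

lemma normal_points_away:
  assumes x: "x \<in> closed_segment p q"
  shows "cross (q - p) (\<nu> x) * cross (q - p) (w - p) < 0"
proof -
  define A where "A = cross (q - p) (w - p)"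
  have A0: "A \<noteq> 0" using is_triangleD[OF tri] A_def by simp
  have "\<nu> x \<bullet> edge_nor < 0" using normal_on_edge[OF x] by linarith
  also have "\<nu> x \<bullet> edge_nor = sgn A * cross (q - p) (\<nu> x) / dist p q"
    unfolding A_def[symmetric]
    by (simp add: inner_commute[of "\<nu> x"] cross_rot[symmetric] sgn_div_norm cross_simps(5) divide_inverse
        dist_norm norm_minus_commute mult_ac)
  finally have "sgn A * cross (q - p) (\<nu> x) < 0" using is_triangleD(2)[OF tri]
    by (simp add: divide_less_0_iff)
  then show ?thesis unfolding A_def[symmetric] using A0
    by (auto simp: sgn_if mult_less_0_iff split: if_splits)
qed

lemma tangential_component:
  assumes x: "x \<in> closed_segment p q"
  shows "sin (\<beta> - \<theta>) \<le> \<bar>rot (\<nu> x) \<bullet> edge_dir\<bar>" "\<bar>rot (\<nu> x) \<bullet> edge_dir\<bar> \<le> 1"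
proof -
  have "\<bar>\<nu> x \<bullet> edge_nor\<bar> = \<bar>rot (\<nu> x) \<bullet> edge_dir\<bar>"
  proof -
    have "rot (\<nu> x) \<bullet> edge_dir = - (rot edge_dir \<bullet> \<nu> x)"
      unfolding cross_rot[symmetric] by (rule cross_commute)
    then show ?thesis using is_triangleD(1)[OF tri] by (simp add: abs_mult sgn_if inner_commute)
  qed
  then show "sin (\<beta> - \<theta>) \<le> \<bar>rot (\<nu> x) \<bullet> edge_dir\<bar>" using normal_on_edge[OF x] by simp
  show "\<bar>rot (\<nu> x) \<bullet> edge_dir\<bar> \<le> 1"
    using Cauchy_Schwarz_ineq2[of "rot (\<nu> x)" edge_dir] frame(1)
      norm_nu[OF K_subset_U[OF edge_subset[OF x]]] by simp
qed

end

section \<open>The projection along an edge transversal to the normal field\<close>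

context tubular_curve
begin

lemma proj_differentiable: "x \<in> U \<Longrightarrow> \<pi> differentiable (at x)"
  using proj_has_derivative differentiableI by blast

text \<open>The derivative of \<open>\<pi>\<close> depends on the tangential component of the direction only.\<close>

lemma segment_jacobian_proj:
  assumes x: "x \<in> U"
  shows "segment_jacobian \<pi> a b x = \<bar>1 - \<phi> x * level_curvature x\<bar> * \<bar>rot (\<nu> x) \<bullet> sgn (b - a)\<bar>"
    "norm (frechet_derivative \<pi> (at x) ((1 / dist a b) *\<^sub>R (a - b))) = segment_jacobian \<pi> a b x"
proof -
  let ?D = "\<lambda>v. ((1 - \<phi> x * level_curvature x) * (rot (\<nu> x) \<bullet> v)) *\<^sub>R rot (\<nu> x)"
  have D: "(\<pi> has_derivative ?D) (at x)" by (rule proj_has_derivative[OF x])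
  have line: "((\<lambda>t. x + t *\<^sub>R sgn (b - a)) has_derivative (\<lambda>t. t *\<^sub>R sgn (b - a))) (at 0)"
    by (auto intro!: derivative_eq_intros)
  have "((\<lambda>t. \<pi> (x + t *\<^sub>R sgn (b - a))) has_derivative (\<lambda>t. ?D (t *\<^sub>R sgn (b - a)))) (at 0)"
    using has_derivative_compose[OF line, of \<pi> ?D] D by simp
  then have "((\<lambda>t. \<pi> (x + t *\<^sub>R sgn (b - a))) has_vector_derivative ?D (sgn (b - a))) (at 0)"
    by (simp add: has_vector_derivative_def mult.left_commute)
  then have "vector_derivative (\<lambda>t. \<pi> (x + t *\<^sub>R sgn (b - a))) (at 0) = ?D (sgn (b - a))"
    by (rule vector_derivative_at)
  then show 1: "segment_jacobian \<pi> a b x = \<bar>1 - \<phi> x * level_curvature x\<bar> * \<bar>rot (\<nu> x) \<bullet> sgn (b - a)\<bar>"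
    using norm_nu[OF x] by (simp add: segment_jacobian_def abs_mult)
  have "(1 / dist a b) *\<^sub>R (a - b) = - sgn (b - a)"
    by (simp add: sgn_div_norm dist_norm norm_minus_commute divide_inverse scaleR_diff_right)
  then show "norm (frechet_derivative \<pi> (at x) ((1 / dist a b) *\<^sub>R (a - b))) = segment_jacobian \<pi> a b x"
    using 1 norm_nu[OF x] by (simp add: frechet_derivative_at[OF D, symmetric] abs_mult)
qed

text \<open>Both points lie on the normal line through their common foot point.\<close>

lemma same_proj:
  assumes "x \<in> U" "y \<in> U" "\<pi> x = \<pi> y"
  shows "\<nu> x = \<nu> y" "y = x + (\<phi> y - \<phi> x) *\<^sub>R \<nu> x"
proof -
  show nu: "\<nu> x = \<nu> y" using assms(3) by (simp add: \<nu>_def)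
  have "y = \<pi> x + \<phi> y *\<^sub>R \<nu> x" using tubular_coordinates(3)[OF assms(2)] assms(3) nu by metis
  also have "\<pi> x = x - \<phi> x *\<^sub>R \<nu> x" using tubular_coordinates(3)[OF assms(1)] by (metis add_diff_cancel_right')
  finally show "y = x + (\<phi> y - \<phi> x) *\<^sub>R \<nu> x" by (simp add: algebra_simps)
qed

text \<open>The inverse of the projection on a transversal segment intersects the normal line with the
  line of the segment; it is \<open>C\<^sup>1\<close> because \<open>\<nu>\<close> is.\<close>

lemma transversal_segment_C1_diffeomorphism:
  assumes U: "closed_segment a b \<subseteq> U"
    and tr: "\<And>x. x \<in> closed_segment a b \<Longrightarrow> cross (b - a) (\<nu> x) \<noteq> 0"
  shows "\<exists>g. C1_diffeomorphism (open_segment a b) (\<pi> ` open_segment a b) \<pi> g"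
proof -
  define n where "n = rot (b - a)"
  define g where "g y = n \<bullet> \<nu> y" for y
  define F where "F y = y - ((n \<bullet> (y - a)) / g y) *\<^sub>R \<nu> y" for y
  define W where "W = U \<inter> g -` (- {0})"
  define S where "S = open_segment a b"
  have SU: "S \<subseteq> U" using U segment_open_subset_closed S_def by blast
  have contg: "continuous_on U g" unfolding g_def by (intro continuous_intros continuous_nu)
  have oW: "open W" unfolding W_def
    by (rule continuous_open_preimage[OF contg open_U]) auto
  have pW: "\<pi> x \<in> W" and Fp: "F (\<pi> x) = x" if "x \<in> S" for x
  proof -
    have xU: "x \<in> U" and xs: "x \<in> closed_segment a b"
      using that SU segment_open_subset_closed S_def by blast+
    have g0: "g (\<pi> x) \<noteq> 0" using tr[OF xs] by (simp add: g_def n_def nu_proj[OF xU] cross_rot)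
    then show "\<pi> x \<in> W" using tubular_coordinates(2)[OF xU] Gamma_subset_U by (auto simp: W_def)
    obtain u where "x = (1 - u) *\<^sub>R a + u *\<^sub>R b" using xs by (auto simp: in_segment)
    then have "x - a = u *\<^sub>R (b - a)" by (simp add: algebra_simps)
    then have nx: "n \<bullet> (x - a) = 0" by (simp add: n_def)
    have px: "\<pi> x = x - \<phi> x *\<^sub>R \<nu> x" using tubular_coordinates(3)[OF xU] by (metis add_diff_cancel_right')
    have "n \<bullet> (\<pi> x - a) = n \<bullet> (x - a) - \<phi> x * (n \<bullet> \<nu> x)"
      by (subst px) (simp add: inner_diff_right)
    then have "n \<bullet> (\<pi> x - a) = n \<bullet> (x - a) - \<phi> x * g (\<pi> x)"
      by (simp only: g_def nu_proj[OF xU])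
    then have "(n \<bullet> (\<pi> x - a)) / g (\<pi> x) = - \<phi> x" using nx g0 by simp
    then show "F (\<pi> x) = x" using tubular_coordinates(3)[OF xU] by (simp add: F_def nu_proj[OF xU])
  qed
  define DF where "DF y v = v - (((n \<bullet> (y - a)) / g y) *\<^sub>R Hess y v
      + (((n \<bullet> v) * g y - (n \<bullet> (y - a)) * (n \<bullet> Hess y v)) / (g y * g y)) *\<^sub>R \<nu> y)" for y v
  have DF: "(F has_derivative DF y) (at y)" if "y \<in> W" for y
  proof -
    have yU: "y \<in> U" and g0: "g y \<noteq> 0" using that by (auto simp: W_def)
    have dg: "(g has_derivative (\<lambda>v. n \<bullet> Hess y v)) (at y)"
      unfolding g_def by (intro has_derivative_inner_right nu_has_derivative yU)
    have df: "((\<lambda>y. n \<bullet> (y - a)) has_derivative (\<lambda>v. n \<bullet> v)) (at y)"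
      by (auto intro!: derivative_eq_intros)
    have "((\<lambda>y. (n \<bullet> (y - a)) / g y) has_derivative
       (\<lambda>v. ((n \<bullet> v) * g y - (n \<bullet> (y - a)) * (n \<bullet> Hess y v)) / (g y * g y))) (at y)"
      by (rule has_derivative_divide'[OF df dg g0])
    from has_derivative_diff[OF has_derivative_ident has_derivative_scaleR[OF this nu_has_derivative[OF yU]]]
    show ?thesis unfolding F_def DF_def .
  qed
  have "C1_on_open W F"
  proof (rule C1_on_open_finite_dim[OF DF])
    fix v
    have WU: "W \<subseteq> U" by (auto simp: W_def)
    show "continuous_on W (\<lambda>y. DF y v)"
      unfolding DF_def
      by (intro continuous_intros continuous_on_subset[OF contg WU]
          continuous_on_subset[OF continuous_nu WU] continuous_on_subset[OF continuous_on_H WU])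
         (auto simp: W_def)
  qed
  then have C1F: "C1_on_set (\<pi> ` S) F"
    unfolding C1_on_set_def using oW pW by blast
  have C1p: "C1_on_set S \<pi>"
    unfolding C1_on_set_def using open_U SU tubular unfolding tubular_radius_def by blast
  have "continuous_on (\<pi> ` S) F"
    using DF pW has_derivative_continuous continuous_at_imp_continuous_on by (metis imageE)
  then have "homeomorphism S (\<pi> ` S) \<pi> F"
    unfolding homeomorphism_def using Fp continuous_on_subset[OF continuous_proj SU]
    by (auto simp: image_image)
  then show ?thesis using C1F C1p unfolding C1_diffeomorphism_def S_def by blast
qed

end

context cut_triangle
begin

lemma angles_and_jacobian:
  "\<exists>\<beta>\<in>{0..pi}.
          cos \<beta> = C * \<sigma> * h - (min (\<phi> p) (\<phi> q) - \<phi> w) / h \<and>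
          0 < sin (\<beta> - \<theta>) / (1 + M * h) \<and>
          (\<forall>x\<in>closed_segment p q.
             sin (\<beta> - \<theta>) / (1 + M * h) \<le> segment_jacobian \<pi> p q x \<and>
             segment_jacobian \<pi> p q x \<le> 1 / (1 - M * h))"
proof (intro bexI[of _ \<beta>] conjI ballI)
  have m: "min (\<phi> p) (\<phi> q) = \<phi> p" using phi_le by simp
  show "cos \<beta> = C * \<sigma> * h - (min (\<phi> p) (\<phi> q) - \<phi> w) / h"
    unfolding m beta(3) by (simp add: \<eta>_def)
  show "\<beta> \<in> {0..pi}" using beta by simp
  have Mh: "0 < 1 + M * h" "0 < 1 - M * h" using M_pos h_pos Mh_less by (simp_all add: add_pos_pos)
  show "0 < sin (\<beta> - \<theta>) / (1 + M * h)"
    using normal_on_edge(1)[of p] Mh by simp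
  fix x assume x: "x \<in> closed_segment p q"
  note xK = edge_subset[OF x] and t = tangential_component[OF x]
  define f where "f = 1 - \<phi> x * level_curvature x"
  have f: "1 / (1 + M * h) \<le> f" "f \<le> 1 / (1 - M * h)"
    using stretch_bounds(1,2)[OF xK] by (simp_all add: f_def)
  have f0: "0 < f" using f(1) Mh by (smt (verit) divide_pos_pos)
  have J: "segment_jacobian \<pi> p q x = f * \<bar>rot (\<nu> x) \<bullet> edge_dir\<bar>"
    using segment_jacobian_proj(1)[OF K_subset_U[OF xK]] f0 by (simp add: f_def)
  have "sin (\<beta> - \<theta>) / (1 + M * h) = (1 / (1 + M * h)) * sin (\<beta> - \<theta>)" by simp
  also have "\<dots> \<le> f * \<bar>rot (\<nu> x) \<bullet> edge_dir\<bar>"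
    using f f0 t Mh normal_on_edge(1)[OF x] by (intro mult_mono) auto
  finally show "sin (\<beta> - \<theta>) / (1 + M * h) \<le> segment_jacobian \<pi> p q x" unfolding J .
  have "f * \<bar>rot (\<nu> x) \<bullet> edge_dir\<bar> \<le> f * 1" using t f0 by (intro mult_left_mono) auto
  then show "segment_jacobian \<pi> p q x \<le> 1 / (1 - M * h)" unfolding J using f by simp
qed

lemma phi_bounds_on_edge:
  assumes x: "x \<in> closed_segment p q"
  shows "- C * h\<^sup>2 < \<phi> x" "\<phi> x \<le> h"
proof -
  have "dist x p * dist x q \<le> h * h"
    using triangle_dist_le[OF tri edge_subset[OF x]] triangle_vertices[OF tri] h_pos
    by (intro mult_mono) auto
  then have "C/2 * (dist x p * dist x q) \<le> C/2 * (h * h)" using C_pos by (intro mult_left_mono) auto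
  also have "\<dots> < C * h\<^sup>2" using C_pos h_pos by (simp add: power2_eq_square)
  finally show "- C * h\<^sup>2 < \<phi> x" using phi_lower_bound[OF x] by simp
  show "\<phi> x \<le> h" using abs_phi_le_h[OF edge_subset[OF x]] by simp
qed

end

section \<open>Curves immersed in a triangulation\<close>

locale immersed_curve = tubular_curve +
  fixes \<T> :: "(real^2) set set"
  assumes triangulation: "planar_triangulation \<T>"
    and immersed: "immersed (frontier \<Omega>) \<T>"
    and h_r: "\<And>K. K \<in> positively_cut_triangles \<Omega> \<T> \<Longrightarrow> diameter K < r"
    and acute: "\<And>K. K \<in> positively_cut_triangles \<Omega> \<T> \<Longrightarrow> conditioning_angle \<Omega> K < pi/2"
    and cond_pos: "\<And>K. K \<in> positively_cut_triangles \<Omega> \<T> \<Longrightarrow>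
       0 < shape_parameter K * curvature_const \<Omega> K * diameter K"
    and cond_less: "\<And>K. K \<in> positively_cut_triangles \<Omega> \<T> \<Longrightarrow>
       shape_parameter K * curvature_const \<Omega> K * diameter K
         < min (cos (conditioning_angle \<Omega> K)) (sin (conditioning_angle \<Omega> K / 2))"
    and cond_adj: "\<And>K \<alpha>. K \<in> positively_cut_triangles \<Omega> \<T> \<Longrightarrow> is_adjacent_angle \<Omega> \<T> K \<alpha> \<Longrightarrow>
       curvature_const \<Omega> K * diameter K < 1/2 * sin \<alpha>"
begin

abbreviation "\<P> \<equiv> positively_cut_triangles \<Omega> \<T>"
abbreviation "\<Gamma>\<^sub>h \<equiv> \<Union>(positive_edges \<Omega> \<T>)"

text \<open>A positively cut triangle together with its vertices, those of the positive edge first.\<close>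

definition pos_tri :: "(real^2) set \<Rightarrow> real^2 \<Rightarrow> real^2 \<Rightarrow> real^2 \<Rightarrow> bool" where
  "pos_tri K p q w \<longleftrightarrow> K \<in> \<P> \<and> is_triangle K p q w \<and> 0 \<le> \<phi> p \<and> 0 \<le> \<phi> q \<and> \<phi> w < 0"

lemma pos_triD:
  assumes "pos_tri K p q w"
  shows "K \<in> \<P>" "K \<in> \<T>" "is_triangle K p q w" "0 \<le> \<phi> p" "0 \<le> \<phi> q" "\<phi> w < 0"
  using assms by (auto simp: pos_tri_def positively_cut_triangles_def)

lemma pos_tri_sym: "pos_tri K p q w \<Longrightarrow> pos_tri K q p w"
  using is_triangle_perm(3) by (auto simp: pos_tri_def)

lemma mesh_triangle: "K \<in> \<T> \<Longrightarrow> \<exists>p q w. is_triangle K p q w"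
  using triangulation simplex_2_is_triangle by (auto simp: planar_triangulation_def)

lemma finite_mesh: "finite \<T>"
  using triangulation by (auto simp: planar_triangulation_def triangulation_def)

lemma mesh_inter_face:
  assumes "K \<in> \<T>" "K' \<in> \<T>"
  shows "K \<inter> K' face_of K" "K \<inter> K' face_of K'"
  using triangulation assms unfolding planar_triangulation_def triangulation_def
  by (metis Int_commute)+

lemma positively_cut_iff:
  assumes t: "is_triangle K p q w" and "0 \<le> \<phi> p" "0 \<le> \<phi> q"
  shows "positively_cut \<Omega> K \<longleftrightarrow> \<phi> w < 0"
proof -
  note D = is_triangleD[OF t]
  have "{v. v extreme_point_of K \<and> 0 \<le> \<phi> v} = {v\<in>{p, q, w}. 0 \<le> \<phi> v}"
    by (rule triangle_extreme_set[OF t])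
  also have "\<dots> = (if \<phi> w < 0 then {p, q} else {p, q, w})" using assms by auto
  finally have e: "{v. v extreme_point_of K \<and> 0 \<le> \<phi> v} = (if \<phi> w < 0 then {p, q} else {p, q, w})" .
  have "card {p, q} = 2" "card {p, q, w} = 3" using D by auto
  then show ?thesis unfolding positively_cut_def e by auto
qed

lemma pos_tri_positive_edge:
  assumes "pos_tri K p q w"
  shows "positive_edge_of \<Omega> K (closed_segment p q)"
  using pos_triD[OF assms] triangle_edge
  by (auto simp: positive_edge_of_def positively_cut_triangles_def extreme_point_of_segment)

lemma positive_edge_of_pos_tri:
  assumes K: "K \<in> \<T>" and e: "positive_edge_of \<Omega> K (closed_segment p q)"
  shows "\<exists>w. pos_tri K p q w"
proof -
  have edge: "closed_segment p q edge_of K" and cut: "positively_cut \<Omega> K"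
    and pq: "0 \<le> \<phi> p" "0 \<le> \<phi> q"
    using e by (auto simp: positive_edge_of_def extreme_point_of_segment)
  obtain a b c where "is_triangle K a b c" using mesh_triangle[OF K] by blast
  then obtain w where t: "is_triangle K p q w" using triangle_of_edge edge by blast
  then have "\<phi> w < 0" using positively_cut_iff[OF t pq] cut by simp
  then show ?thesis using t pq cut K by (auto simp: pos_tri_def positively_cut_triangles_def)
qed

lemma positive_edge_cases:
  assumes "K \<in> \<T>" "positive_edge_of \<Omega> K e"
  obtains p q w where "pos_tri K p q w" "e = closed_segment p q"
proof -
  obtain a b c where "is_triangle K a b c" using mesh_triangle assms by blast
  moreover have "e edge_of K" using assms(2) by (simp add: positive_edge_of_def)
  ultimately obtain p q where "e = closed_segment p q" using triangle_edge_cases by metis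
  then show thesis using that positive_edge_of_pos_tri assms by metis
qed

text \<open>The vertices of the triangle are sorted by the sign of \<open>\<phi>\<close>.\<close>

lemma pos_tri_unique:
  assumes "pos_tri K p q w" "pos_tri K p' q' w'"
  shows "{p, q} = {p', q'}" "w = w'"
proof -
  note 1 = pos_triD[OF assms(1)] and 2 = pos_triD[OF assms(2)]
  have "{v\<in>{p, q, w}. 0 \<le> \<phi> v} = {v\<in>{p', q', w'}. 0 \<le> \<phi> v}"
    unfolding triangle_extreme_set[OF 1(3), symmetric] triangle_extreme_set[OF 2(3), symmetric] ..
  moreover have "{v\<in>{p, q, w}. 0 \<le> \<phi> v} = {p, q}" "{v\<in>{p', q', w'}. 0 \<le> \<phi> v} = {p', q'}"
    using 1 2 by auto
  ultimately show "{p, q} = {p', q'}" by simp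
  have "{v\<in>{p, q, w}. \<phi> v < 0} = {v\<in>{p', q', w'}. \<phi> v < 0}"
    unfolding triangle_extreme_set[OF 1(3), symmetric] triangle_extreme_set[OF 2(3), symmetric] ..
  moreover have "{v\<in>{p, q, w}. \<phi> v < 0} = {w}" "{v\<in>{p', q', w'}. \<phi> v < 0} = {w'}"
    using 1 2 by auto
  ultimately show "w = w'" by simp
qed

lemma infdist_eq_phi: "0 \<le> \<phi> x \<Longrightarrow> infdist x \<Gamma> = \<phi> x"
  using abs_signed_distance[of x] by simp

text \<open>Either end of the positive edge can be the proximal vertex.\<close>

lemma pos_tri_cut_triangle:
  assumes P: "pos_tri K p q w"
  shows "cut_triangle \<Omega> r K p q w \<and> conditioning_angle \<Omega> K = interior_angle K p \<or>
         cut_triangle \<Omega> r K q p w \<and> conditioning_angle \<Omega> K = interior_angle K q"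
proof -
  note D = pos_triD[OF P]
  have e: "positive_edge_of \<Omega> K (closed_segment p q)" "positive_edge_of \<Omega> K (closed_segment q p)"
    using pos_tri_positive_edge[OF P] pos_tri_positive_edge[OF pos_tri_sym[OF P]] by auto
  have "\<exists>v. proximal_vertex \<Omega> K v"
  proof -
    have "proximal_vertex \<Omega> K p \<or> proximal_vertex \<Omega> K q"
      unfolding proximal_vertex_def using e
      by (metis linorder_le_cases linorder_less_linear)
    then show ?thesis by blast
  qed
  define v where "v = (SOME v. proximal_vertex \<Omega> K v)"
  have "proximal_vertex \<Omega> K v" unfolding v_def by (rule someI_ex) fact
  then obtain u where u: "positive_edge_of \<Omega> K (closed_segment v u)" "infdist v \<Gamma> \<le> infdist u \<Gamma>"
    unfolding proximal_vertex_def by auto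
  obtain w' where P': "pos_tri K v u w'" using positive_edge_of_pos_tri[OF D(2) u(1)] by blast
  have eq: "{v, u} = {p, q}" "w' = w" using pos_tri_unique[OF P' P] by auto
  have ang: "conditioning_angle \<Omega> K = interior_angle K v"
    by (simp add: conditioning_angle_def v_def)
  note D' = pos_triD[OF P'] 
  have "\<phi> v \<le> \<phi> u" using u(2) D' infdist_eq_phi by simp
  then have "cut_triangle \<Omega> r K v u w"
    using D' eq h_r[OF D(1)] acute[OF D(1)] cond_pos[OF D(1)] cond_less[OF D(1)]
    by unfold_locales (auto simp: ang)
  then show ?thesis using eq(1) ang by (auto simp: doubleton_eq_iff)
qed

lemma pos_tri_properties:
  assumes P: "pos_tri K p q w"
  shows pos_tri_subset_U: "K \<subseteq> U"
    and pos_tri_normal: "x \<in> closed_segment p q \<Longrightarrow> cross (q - p) (\<nu> x) * cross (q - p) (w - p) < 0"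
    and pos_tri_lower: "x \<in> closed_segment p q \<Longrightarrow> - (curvature_const \<Omega> K / 2 * (dist x p * dist x q)) \<le> \<phi> x"
    and pos_tri_C_pos: "0 < curvature_const \<Omega> K"
proof -
  have "K \<subseteq> U \<and> (\<forall>x\<in>closed_segment p q. cross (q - p) (\<nu> x) * cross (q - p) (w - p) < 0 \<and>
    - (curvature_const \<Omega> K / 2 * (dist x p * dist x q)) \<le> \<phi> x) \<and> 0 < curvature_const \<Omega> K"
    using pos_tri_cut_triangle[OF P]
  proof (elim disjE conjE)
    assume "cut_triangle \<Omega> r K p q w"
    then interpret cut_triangle \<Omega> r K p q w .
    show ?thesis using K_subset_U normal_points_away phi_lower_bound C_pos by blast
  next
    assume "cut_triangle \<Omega> r K q p w"
    then interpret cut_triangle \<Omega> r K q p w .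
    have "cross (q - p) n * cross (q - p) (w - p) = cross (p - q) n * cross (p - q) (w - q)" for n
      by (simp add: cross_def algebra_simps)
    then show ?thesis using K_subset_U normal_points_away phi_lower_bound C_pos
      by (auto simp: closed_segment_commute[of p q] mult.commute[of "dist _ p"])
  qed
  then show "K \<subseteq> U" "x \<in> closed_segment p q \<Longrightarrow> cross (q - p) (\<nu> x) * cross (q - p) (w - p) < 0"
    "x \<in> closed_segment p q \<Longrightarrow> - (curvature_const \<Omega> K / 2 * (dist x p * dist x q)) \<le> \<phi> x"
    "0 < curvature_const \<Omega> K" by blast+
qed

lemma pos_tri_phi_and_jacobian:
  assumes P: "pos_tri K p q w"
  shows "\<forall>x\<in>closed_segment p q. - curvature_const \<Omega> K * (diameter K)\<^sup>2 < \<phi> x \<and> \<phi> x \<le> diameter K"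
      (is "\<forall>x\<in>_. ?phi x")
    and "\<exists>\<beta>\<in>{0..pi}.
          cos \<beta> = curvature_const \<Omega> K * shape_parameter K * diameter K
             - (min (\<phi> p) (\<phi> q) - \<phi> w) / diameter K \<and>
          0 < sin (\<beta> - conditioning_angle \<Omega> K) / (1 + max_curvature \<Omega> K * diameter K) \<and>
          (\<forall>x\<in>open_segment p q.
             sin (\<beta> - conditioning_angle \<Omega> K) / (1 + max_curvature \<Omega> K * diameter K) \<le> segment_jacobian \<pi> p q x \<and>
             \<pi> differentiable (at x) \<and>
             segment_jacobian \<pi> p q x =
               norm (frechet_derivative \<pi> (at x) ((1 / dist p q) *\<^sub>R (p - q))) \<and>
             segment_jacobian \<pi> p q x \<le> 1 / (1 - max_curvature \<Omega> K * diameter K))"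
      (is "\<exists>\<beta>\<in>_. ?cos \<beta> \<and> ?pos \<beta> \<and> (\<forall>x\<in>_. ?lower \<beta> x \<and> _ \<and> ?jac x \<and> ?upper x)")
proof -
  have U: "x \<in> U" if "x \<in> closed_segment p q" for x
    using pos_tri_subset_U[OF P] triangle_closed_segment[OF pos_triD(3)[OF P]] that by blast
  have sym: "segment_jacobian \<pi> q p x = segment_jacobian \<pi> p q x" if "x \<in> closed_segment p q" for x
  proof -
    have "sgn (p - q) = - sgn (q - p)" by (metis minus_diff_eq sgn_minus)
    then show ?thesis unfolding segment_jacobian_proj(1)[OF U[OF that]] by simp
  qed
  have *: "(\<forall>x\<in>closed_segment p q. ?phi x) \<and>
     (\<exists>\<beta>\<in>{0..pi}. ?cos \<beta> \<and> ?pos \<beta> \<and> (\<forall>x\<in>closed_segment p q. ?lower \<beta> x \<and> ?upper x))"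
    using pos_tri_cut_triangle[OF P]
  proof (elim disjE conjE)
    assume a: "cut_triangle \<Omega> r K p q w" "conditioning_angle \<Omega> K = interior_angle K p"
    then interpret cut_triangle \<Omega> r K p q w by simp
    show ?thesis unfolding a(2) using phi_bounds_on_edge angles_and_jacobian by blast
  next
    assume a: "cut_triangle \<Omega> r K q p w" "conditioning_angle \<Omega> K = interior_angle K q"
    then interpret cut_triangle \<Omega> r K q p w by simp
    show ?thesis unfolding a(2)
      using phi_bounds_on_edge angles_and_jacobian
      by (simp add: closed_segment_commute[of q p] min.commute[of "\<phi> q"] sym cong: ball_cong)
  qed
  then show "\<forall>x\<in>closed_segment p q. ?phi x" by (rule conjunct1)
  from conjunct2[OF *]
  show "\<exists>\<beta>\<in>{0..pi}. ?cos \<beta> \<and> ?pos \<beta> \<and>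
      (\<forall>x\<in>open_segment p q. ?lower \<beta> x \<and> \<pi> differentiable (at x) \<and> ?jac x \<and> ?upper x)"
  proof (rule bexE)
    fix \<beta> assume \<beta>: "\<beta> \<in> {0..pi}"
      and **: "?cos \<beta> \<and> ?pos \<beta> \<and> (\<forall>x\<in>closed_segment p q. ?lower \<beta> x \<and> ?upper x)"
    have "?lower \<beta> x \<and> \<pi> differentiable (at x) \<and> ?jac x \<and> ?upper x" if "x \<in> open_segment p q" for x
    proof -
      have x: "x \<in> closed_segment p q" using that segment_open_subset_closed by blast
      show ?thesis
        using ** x proj_differentiable[OF U[OF x]] segment_jacobian_proj(2)[OF U[OF x], symmetric] by blast
    qed
    then show ?thesis using ** \<beta> by blast
  qed
qed

lemma positive_edge_diffeomorphism:
  assumes "pos_tri K p q w"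
  shows "\<exists>g. C1_diffeomorphism (open_segment p q) (\<pi> ` open_segment p q) \<pi> g"
proof (rule transversal_segment_C1_diffeomorphism)
  show "closed_segment p q \<subseteq> U"
    using pos_tri_subset_U[OF assms] triangle_closed_segment[OF pos_triD(3)[OF assms]] by blast
  show "cross (q - p) (\<nu> x) \<noteq> 0" if "x \<in> closed_segment p q" for x
    using pos_tri_normal[OF assms that] by auto
qed

end

section \<open>Local structure of the triangulation\<close>

lemma finite_closed_near_point:
  fixes \<F> :: "('a::metric_space) set set"
  assumes "finite \<F>" "\<And>F. F \<in> \<F> \<Longrightarrow> closed F"
  shows "\<exists>\<epsilon>>0. \<forall>F\<in>\<F>. ball y \<epsilon> \<inter> F \<noteq> {} \<longrightarrow> y \<in> F"
proof -
  let ?W = "- \<Union>{F\<in>\<F>. y \<notin> F}"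
  have "open ?W" using assms by (intro open_Compl closed_Union) auto
  moreover have "y \<in> ?W" by blast
  ultimately obtain \<epsilon> where "\<epsilon> > 0" "ball y \<epsilon> \<subseteq> ?W" by (meson open_contains_ball)
  then show ?thesis by (intro exI[of _ \<epsilon>]) blast
qed

text \<open>Otherwise the property holds at the supremum of its earlier failures, by closedness, and therefore also
  shortly before.\<close>

lemma closed_left_propagates:
  fixes a b x\<^sub>0 :: real
  assumes cl: "closed {x\<in>{a..b}. P x}" and x0: "x\<^sub>0 \<in> {a..b}" "P x\<^sub>0"
    and left: "\<And>x. a < x \<Longrightarrow> x \<le> b \<Longrightarrow> P x \<Longrightarrow> \<exists>\<delta>>0. \<forall>t. x - \<delta> < t \<and> t < x \<longrightarrow> P t"
    and t: "t \<in> {a..x\<^sub>0}"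
  shows "P t"
proof (rule ccontr)
  assume nt: "\<not> P t"
  define S where "S = {t\<in>{a..x\<^sub>0}. \<not> P t}"
  define m where "m = Sup S"
  have bdd: "bdd_above S" by (rule bdd_aboveI[of _ "x\<^sub>0"]) (auto simp: S_def)
  have tS: "t \<in> S" using t nt by (simp add: S_def)
  have tm: "t \<le> m" unfolding m_def by (rule cSup_upper[OF tS bdd])
  have m0: "m \<le> x\<^sub>0" unfolding m_def using tS by (intro cSup_least) (auto simp: S_def)
  have above: "P u" if "m < u" "u \<le> x\<^sub>0" for u
  proof (rule ccontr)
    assume "\<not> P u"
    then have "u \<in> S" using that tm t by (simp add: S_def)
    then have "u \<le> m" unfolding m_def by (rule cSup_upper[OF _ bdd])
    then show False using that by simp
  qed
  have Pm: "P m"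
  proof (cases "m = x\<^sub>0")
    case False
    then have lt: "m < x\<^sub>0" using m0 by simp
    have "m \<in> closure {x\<in>{a..b}. P x}"
      unfolding closure_approachable
    proof (intro allI impI)
      fix e :: real assume "e > 0"
      define u where "u = min x\<^sub>0 (m + e/2)"
      have "m < u" "u \<le> x\<^sub>0" "dist u m < e" using lt \<open>e > 0\<close> by (auto simp: u_def dist_real_def)
      then show "\<exists>y\<in>{x\<in>{a..b}. P x}. dist y m < e" using above[of u] tm t x0 by (intro bexI[of _ u]) auto
    qed
    then show ?thesis using cl by (simp add: closure_closed)
  qed (use x0 in simp)
  have am: "a < m" using tm t nt Pm by (metis atLeastAtMost_iff order_le_less order_less_le_trans)
  obtain \<delta> where \<delta>: "\<delta> > 0" "\<And>t. m - \<delta> < t \<Longrightarrow> t < m \<Longrightarrow> P t"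
    using left[OF am _ Pm] m0 x0 by auto
  have "m \<le> m - \<delta>"
    unfolding m_def[of] 
  proof (rule cSup_least)
    show "S \<noteq> {}" using tS by blast
    fix u assume u: "u \<in> S"
    then have "u \<le> m" unfolding m_def by (rule cSup_upper[OF _ bdd])
    moreover have "\<not> P u" using u by (simp add: S_def)
    ultimately show "u \<le> Sup S - \<delta>" using \<delta> Pm unfolding m_def by (metis not_le order_le_less)
  qed
  then show False using \<delta> by simp
qed

text \<open>If the sine decreased, the larger angle would be obtuse and the sum of the two at least a
  straight angle; the projections of the two other sides on \<open>[p, q]\<close> would then not add up to its length.\<close>

lemma sin_le_sin_of_angle_le:
  assumes t: "is_triangle K p q w" and le: "interior_angle K p \<le> interior_angle K q"
  shows "sin (interior_angle K p) \<le> sin (interior_angle K q)"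
proof (rule ccontr)
  define \<alpha> where "\<alpha> = interior_angle K p"
  define \<beta> where "\<beta> = interior_angle K q"
  note D = is_triangleD[OF t]
  note tp = interior_angle_trig[OF t, folded \<alpha>_def]
  note tq = interior_angle_trig[OF is_triangle_perm(3)[OF t], folded \<beta>_def]
  assume "\<not> sin (interior_angle K p) \<le> sin (interior_angle K q)"
  then have lt: "sin \<beta> < sin \<alpha>" by (simp add: \<alpha>_def \<beta>_def)
  define x where "x = norm (w - p)"
  define y where "y = norm (w - q)"
  define L where "L = norm (q - p)"
  have pos: "0 < x" "0 < y" "0 < L" using D by (simp_all add: x_def y_def L_def)
  have sb: "0 < sin \<beta>" using tq by (simp add: sin_gt_zero)
  have "cross (p - q) (w - q) = - cross (q - p) (w - p)" by (simp add: cross_def algebra_simps)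
  then have "L * x * sin \<alpha> = L * y * sin \<beta>"
    using tp(4) tq(4) unfolding x_def y_def L_def by (simp add: norm_minus_commute)
  then have "x * sin \<alpha> = y * sin \<beta>" using pos by simp
  moreover have "x * sin \<beta> < x * sin \<alpha>" using lt pos by simp
  ultimately have "x * sin \<beta> < y * sin \<beta>" by simp
  then have xy: "x < y" using sb by simp
  have "(q - p) \<bullet> (w - p) + (p - q) \<bullet> (w - q) = (q - p) \<bullet> (q - p)"
    by (simp add: inner_diff_left inner_diff_right algebra_simps)
  then have "L * (x * cos \<alpha> + y * cos \<beta>) = L * L"
    using tp(3) tq(3) unfolding x_def y_def L_def
    by (simp add: norm_minus_commute power2_norm_eq_inner[symmetric] power2_eq_square algebra_simps)
  then have proj: "x * cos \<alpha> + y * cos \<beta> = L" using pos by simp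
  have cb: "cos \<beta> < 0"
  proof (rule ccontr)
    assume "\<not> cos \<beta> < 0"
    then have "\<beta> \<le> pi/2" using tq(1,2) cos_lt_zero_pi[of \<beta>] by force
    then have "sin \<alpha> \<le> sin \<beta>" using le tp(1) unfolding \<alpha>_def \<beta>_def
      by (intro sin_monotone_2pi_le) auto
    then show False using lt by simp
  qed
  have "(sin \<beta>)\<^sup>2 < (sin \<alpha>)\<^sup>2" using lt sb by (intro power_strict_mono) auto
  then have "(cos \<alpha>)\<^sup>2 < (cos \<beta>)\<^sup>2" by (simp add: sin_squared_eq)
  then have ca: "cos \<alpha> < - cos \<beta>" using cb by (smt (verit) power2_minus power_mono)
  have "x * cos \<alpha> + y * cos \<beta> < 0"
  proof (cases "cos \<alpha> \<le> 0")
    case True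
    then have "x * cos \<alpha> \<le> 0" "y * cos \<beta> < 0" using pos cb by (auto simp: mult_le_0_iff mult_less_0_iff)
    then show ?thesis by simp
  next
    case False
    then have "x * cos \<alpha> < y * cos \<alpha>" using xy by simp
    moreover have "y * cos \<alpha> < y * (- cos \<beta>)" using ca pos(2) by (rule mult_strict_left_mono)
    ultimately show ?thesis by simp
  qed
  then show False using proj pos by simp
qed

context immersed_curve
begin

lemma mesh_interior_disjoint:
  assumes "K \<in> \<T>" "K' \<in> \<T>" "z \<in> interior K" "z \<in> K'"
  shows "K = K'"
proof -
  have full: "A \<inter> B = A" if "A \<in> \<T>" "B \<in> \<T>" "z \<in> interior A" "z \<in> B" for A B
    using face_of_disjoint_interior[OF mesh_inter_face(1)[OF that(1,2)]] that interior_subset by blast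
  have KK: "K \<inter> K' = K" by (rule full) (use assms in auto)
  then have "interior K \<subseteq> interior K'" by (intro interior_mono) blast
  then have "K' \<inter> K = K'" by (intro full) (use assms interior_subset in auto)
  then show ?thesis using KK by blast
qed

text \<open>Vertices and edges count as faces here, so that all of them that come close to \<open>y\<close> contain \<open>y\<close>.\<close>

lemma mesh_near_point:
  shows "\<exists>\<epsilon>>0. \<forall>K\<in>\<T>. \<forall>F. F face_of K \<longrightarrow> ball y \<epsilon> \<inter> F \<noteq> {} \<longrightarrow> y \<in> F"
proof -
  define \<F> where "\<F> = (\<Union>K\<in>\<T>. {F. F face_of K})"
  have pt: "polytope K" if "K \<in> \<T>" for K
    using triangulation that simplex_imp_polytope by (auto simp: planar_triangulation_def)
  have "finite \<F>" unfolding \<F>_def using finite_mesh pt finite_polytope_faces by blast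
  moreover have "closed F" if "F \<in> \<F>" for F
    using that pt polytope_imp_compact polytope_imp_convex compact_imp_closed face_of_imp_compact
    unfolding \<F>_def by blast
  ultimately obtain \<epsilon> where "\<epsilon> > 0" "\<forall>F\<in>\<F>. ball y \<epsilon> \<inter> F \<noteq> {} \<longrightarrow> y \<in> F"
    using finite_closed_near_point by blast
  then show ?thesis by (intro exI[of _ \<epsilon>]) (auto simp: \<F>_def)
qed

lemma triangle_face_of_self: "is_triangle K p q w \<Longrightarrow> K face_of K"
  using triangle_compact(2) by (simp add: face_of_refl_eq)

text \<open>The intersection of the two triangles is a face that contains a relatively interior point of the
  edge, hence the whole edge.\<close>

lemma mesh_share_edge:
  assumes K0: "K0 \<in> \<T>" "is_triangle K0 p q w0" and K: "K \<in> \<T>"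
    and z: "z \<in> open_segment p q" "z \<in> K"
  shows "\<exists>w. is_triangle K p q w" "K \<noteq> K0 \<Longrightarrow> K0 \<inter> K = closed_segment p q"
proof -
  have *: "(\<exists>w. is_triangle K p q w) \<and> K0 \<inter> K = closed_segment p q" if "K \<noteq> K0"
  proof -
    note V = triangle_vertices[OF K0(2)]
    define F where "F = K0 \<inter> K"
    have F: "F face_of K0" "F face_of K" using mesh_inter_face[OF K0(1) K] by (auto simp: F_def)
    have zF: "z \<in> F" using z triangle_closed_segment[OF K0(2)] segment_open_subset_closed F_def by blast
    have pqF: "p \<in> F" "q \<in> F" using face_ofD[OF F(1) z(1) V(1,2) zF] by auto
    obtain c where c: "c \<subseteq> {p, q, w0}" "F = convex hull c"
      using triangle_face_iff[OF K0(2), of F] F(1) by auto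
    have ext: "v \<in> c" if "v \<in> {p, q}" for v
    proof -
      have "v extreme_point_of F"
        using extreme_point_of_face[OF F(1)] triangle_extreme_iff[OF K0(2)] that pqF by blast
      then show ?thesis unfolding c(2) by (rule extreme_point_of_convex_hull)
    qed
    have "w0 \<notin> c"
    proof
      assume "w0 \<in> c"
      then have "c = {p, q, w0}" using c(1) ext by blast
      then have "F = K0" using c(2) is_triangleD(5)[OF K0(2)] by simp
      then have "K0 \<subseteq> K" by (auto simp: F_def)
      moreover have "interior K0 \<noteq> {}" by (rule triangle_interior_nonempty[OF K0(2)])
      ultimately show False using mesh_interior_disjoint[OF K0(1) K] that interior_subset by blast
    qed
    then have "c = {p, q}" using c(1) ext by blast
    then have Fe: "F = closed_segment p q" using c(2) by (simp add: segment_convex_hull)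
    have "closed_segment p q edge_of K"
      using F(2) triangle_edge[OF K0(2)] by (simp add: Fe edge_of_def)
    then show ?thesis using triangle_of_edge mesh_triangle[OF K] Fe F_def by blast
  qed
  show "\<exists>w. is_triangle K p q w" using * K0(2) by (cases "K = K0") auto
  show "K \<noteq> K0 \<Longrightarrow> K0 \<inter> K = closed_segment p q" using * by blast
qed

lemma mesh_near_edge:
  assumes "K0 \<in> \<T>" "is_triangle K0 p q w0" "z \<in> open_segment p q"
  shows "\<exists>\<epsilon>>0. \<forall>u\<in>ball z \<epsilon>. \<forall>K\<in>\<T>. u \<in> K \<longrightarrow> (\<exists>w. is_triangle K p q w)"
proof -
  obtain \<epsilon> where \<epsilon>: "\<epsilon> > 0" "\<forall>K\<in>\<T>. \<forall>F. F face_of K \<longrightarrow> ball z \<epsilon> \<inter> F \<noteq> {} \<longrightarrow> z \<in> F"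
    using mesh_near_point by blast
  have "\<exists>w. is_triangle K p q w" if "u \<in> ball z \<epsilon>" "K \<in> \<T>" "u \<in> K" for u K
  proof -
    have "K face_of K" using mesh_triangle[OF that(2)] triangle_face_of_self by blast
    then have "z \<in> K" using \<epsilon>(2) that by blast
    then show ?thesis using mesh_share_edge[OF assms(1,2) that(2) assms(3)] by blast
  qed
  then show ?thesis using \<epsilon>(1) by blast
qed

text \<open>Near an interior point of the edge both triangles are the same half plane, so their interiors meet.\<close>

lemma mesh_same_side:
  assumes K: "K1 \<in> \<T>" "K2 \<in> \<T>" and t: "is_triangle K1 p q w1" "is_triangle K2 p q w2"
    and side: "0 < cross (q - p) (w1 - p) * cross (q - p) (w2 - p)"
  shows "K1 = K2"
proof -
  define A where "A = cross (q - p) (w1 - p)"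
  note D = is_triangleD[OF t(1)]
  define z where "z = midpoint p q"
  have z: "z \<in> open_segment p q" using D by (simp add: z_def)
  obtain \<epsilon>1 \<epsilon>2 where e: "\<epsilon>1 > 0" "\<forall>u\<in>ball z \<epsilon>1. u \<in> K1 \<longleftrightarrow> 0 \<le> cross (q - p) (u - p) * A"
    "\<epsilon>2 > 0" "\<forall>u\<in>ball z \<epsilon>2. u \<in> K2 \<longleftrightarrow> 0 \<le> cross (q - p) (u - p) * cross (q - p) (w2 - p)"
    using triangle_near_edge[OF t(1) z] triangle_near_edge[OF t(2) z] unfolding A_def by blast
  define \<epsilon> where "\<epsilon> = min \<epsilon>1 \<epsilon>2"
  define W where "W = ball z \<epsilon> \<inter> {u. 0 < cross (q - p) (u - p) * A}"
  have "open W" unfolding W_def cross_def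
    by (intro open_Int open_ball open_Collect_less continuous_intros)
  moreover have sub: "W \<subseteq> K1" "W \<subseteq> K2"
  proof -
    show "W \<subseteq> K1" using e by (auto simp: W_def \<epsilon>_def)
    show "W \<subseteq> K2"
    proof
      fix u assume u: "u \<in> W"
      then have "0 < (cross (q - p) (u - p) * A) * (A * cross (q - p) (w2 - p))"
        using side by (simp add: W_def A_def)
      then have "0 < cross (q - p) (u - p) * cross (q - p) (w2 - p)"
        by (auto simp: zero_less_mult_iff mult_less_0_iff)
      then show "u \<in> K2" using e u by (auto simp: W_def \<epsilon>_def)
    qed
  qed
  moreover have "W \<noteq> {}"
  proof -
    have "0 < \<epsilon>" using e by (simp add: \<epsilon>_def)
    then show ?thesis using point_beside_segment[OF z, of \<epsilon> A] D(1) by (auto simp: W_def A_def)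
  qed
  ultimately obtain u where "u \<in> interior K1" "u \<in> K2" using interior_maximal by blast
  then show ?thesis using mesh_interior_disjoint[OF K] by blast
qed

definition opposite_triangle :: "real^2 \<Rightarrow> real^2 \<Rightarrow> real^2 \<Rightarrow> (real^2) set \<Rightarrow> real^2 \<Rightarrow> bool" where
  "opposite_triangle p q w K' w' \<longleftrightarrow>
     K' \<in> \<T> \<and> is_triangle K' p q w' \<and> cross (q - p) (w - p) * cross (q - p) (w' - p) < 0"

text \<open>Near an interior point of an edge without a triangle on its other side, the triangulation covers a half
  plane only.\<close>

lemma boundary_edge:
  assumes K: "K \<in> \<T>" "is_triangle K p q w" and no: "\<not> (\<exists>K' w'. opposite_triangle p q w K' w')"
  shows "closed_segment p q \<inter> interior (\<Union>\<T>) = {}"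
proof -
  define A where "A = cross (q - p) (w - p)"
  note D = is_triangleD[OF K(2)]
  have ri: "z \<notin> interior (\<Union>\<T>)" if z: "z \<in> open_segment p q" for z
  proof
    assume zi: "z \<in> interior (\<Union>\<T>)"
    obtain \<epsilon>1 \<epsilon>2 \<epsilon>3 where e: "\<epsilon>1 > 0" "\<forall>u\<in>ball z \<epsilon>1. u \<in> K \<longleftrightarrow> 0 \<le> cross (q - p) (u - p) * A"
      "\<epsilon>2 > 0" "\<forall>u\<in>ball z \<epsilon>2. \<forall>K\<in>\<T>. u \<in> K \<longrightarrow> (\<exists>w. is_triangle K p q w)"
      "\<epsilon>3 > 0" "ball z \<epsilon>3 \<subseteq> \<Union>\<T>"
      using triangle_near_edge[OF K(2) z] mesh_near_edge[OF K z] zi unfolding A_def mem_interior by blast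
    define \<epsilon> where "\<epsilon> = min \<epsilon>1 (min \<epsilon>2 \<epsilon>3)"
    have \<epsilon>: "\<epsilon> > 0" using e by (simp add: \<epsilon>_def)
    have inK: "u \<in> K" if u: "u \<in> ball z \<epsilon>" for u
    proof -
      obtain K' where K': "K' \<in> \<T>" "u \<in> K'" using u e by (auto simp: \<epsilon>_def)
      have "u \<in> ball z \<epsilon>2" using u by (simp add: \<epsilon>_def)
      then obtain w' where t': "is_triangle K' p q w'" using e(4) K' by blast
      have "A * cross (q - p) (w' - p) \<noteq> 0" using D is_triangleD(1)[OF t'] A_def by simp
      moreover have "\<not> A * cross (q - p) (w' - p) < 0"
        using no K' t' unfolding opposite_triangle_def A_def by blast
      ultimately have "0 < A * cross (q - p) (w' - p)" by linarith
      then have "K = K'" using mesh_same_side[OF K(1) K'(1) K(2) t'] by (simp add: A_def)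
      then show ?thesis using K' by simp
    qed
    obtain u where u: "u \<in> ball z \<epsilon>" "0 < cross (q - p) (u - p) * (- A)"
      using point_beside_segment[OF z \<epsilon>, of "- A"] D(1) by (auto simp: A_def)
    have "u \<in> ball z \<epsilon>1" using u(1) by (simp add: \<epsilon>_def)
    then have "0 \<le> cross (q - p) (u - p) * A" using inK[OF u(1)] e(2) by blast
    then show False using u(2) by simp
  qed
  have "open_segment p q \<subseteq> - interior (\<Union>\<T>)" using ri by blast
  then have "closure (open_segment p q) \<subseteq> - interior (\<Union>\<T>)"
    by (rule closure_minimal) (simp add: closed_Compl)
  then show ?thesis using D by (auto simp: closure_open_segment)
qed

lemma pos_triI:
  assumes "K \<in> \<T>" "is_triangle K p q w" "0 \<le> \<phi> p" "0 \<le> \<phi> q" "\<phi> w < 0"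
  shows "pos_tri K p q w"
  using assms positively_cut_iff[OF assms(2-4)]
  by (simp add: pos_tri_def positively_cut_triangles_def)

lemma positive_edges_iff: "closed_segment p q \<in> positive_edges \<Omega> \<T> \<longleftrightarrow> (\<exists>K w. pos_tri K p q w)"
  using positive_edge_of_pos_tri pos_tri_positive_edge pos_triD(2)
  unfolding positive_edges_def by blast

lemma mem_Gamma_h: "x \<in> \<Gamma>\<^sub>h \<longleftrightarrow> (\<exists>K p q w. pos_tri K p q w \<and> x \<in> closed_segment p q)"
proof
  assume "x \<in> \<Gamma>\<^sub>h"
  then obtain e K where "x \<in> e" "K \<in> \<T>" "positive_edge_of \<Omega> K e"
    by (auto simp: positive_edges_def)
  then show "\<exists>K p q w. pos_tri K p q w \<and> x \<in> closed_segment p q" using positive_edge_cases by metis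
qed (use positive_edges_iff in blast)

text \<open>On both sides of a shared positive edge, the normal would have to point away from the
  triangle.\<close>

lemma pos_tri_edge_unique:
  assumes "pos_tri K p q w" "pos_tri K' p q w'"
  shows "K = K'"
proof (rule mesh_same_side)
  show "K \<in> \<T>" "K' \<in> \<T>" "is_triangle K p q w" "is_triangle K' p q w'"
    using pos_triD assms by blast+
  have "cross (q - p) (\<nu> p) * cross (q - p) (w - p) < 0" "cross (q - p) (\<nu> p) * cross (q - p) (w' - p) < 0"
    using pos_tri_normal assms by auto
  then show "0 < cross (q - p) (w - p) * cross (q - p) (w' - p)"
    by (auto simp: mult_less_0_iff zero_less_mult_iff)
qed

lemma positive_edge_unique_triangle:
  assumes "e \<in> positive_edges \<Omega> \<T>"
  shows "\<exists>!K. K \<in> \<P> \<and> e edge_of K"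
proof -
  obtain K0 where "K0 \<in> \<T>" "positive_edge_of \<Omega> K0 e" using assms by (auto simp: positive_edges_def)
  then obtain p q w where P: "pos_tri K0 p q w" and e: "e = closed_segment p q"
    using positive_edge_cases by metis
  show ?thesis
  proof (rule ex1I[of _ K0])
    show "K0 \<in> \<P> \<and> e edge_of K0"
      using pos_triD[OF P] triangle_edge e by blast
    fix K assume K: "K \<in> \<P> \<and> e edge_of K"
    then have "positive_edge_of \<Omega> K (closed_segment p q)" "K \<in> \<T>"
      using pos_triD(4,5)[OF P] e
      by (auto simp: positive_edge_of_def positively_cut_triangles_def extreme_point_of_segment)
    then obtain w' where "pos_tri K p q w'" using positive_edge_of_pos_tri by blast
    then show "K = K0" using pos_tri_edge_unique P by blast
  qed
qed

section \<open>The polygonal domain behind the positive edges\<close>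

definition negative_triangle :: "(real^2) set \<Rightarrow> bool" where
  "negative_triangle K \<longleftrightarrow> K \<in> \<T> \<and> (\<exists>v. v extreme_point_of K \<and> \<phi> v < 0)"

text \<open>A polygonal counterpart of \<open>\<Omega>\<close> near the curve, bounded there by \<open>\<Gamma>\<^sub>h\<close>.\<close>

definition negative_region :: "(real^2) set" where "negative_region = \<Union>{K. negative_triangle K}"

text \<open>The complement of the part of \<open>\<Omega>\<close> that the interior of the triangulation leaves uncovered. In the
  uncovered part, the negative region may be bounded by edges that are not positive.\<close>

definition covered :: "(real^2) set" where "covered = {x. 0 < \<phi> x} \<union> interior (\<Union>\<T>)"

lemma closed_negative_region: "closed negative_region"
proof -
  have "finite {K. negative_triangle K}"
    by (rule finite_subset[OF _ finite_mesh]) (auto simp: negative_triangle_def)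
  moreover have "closed K" if "negative_triangle K" for K
    using that mesh_triangle[of K] triangle_compact(3) by (auto simp: negative_triangle_def)
  ultimately show ?thesis unfolding negative_region_def by (intro closed_Union) auto
qed

lemma open_covered: "open covered"
  unfolding covered_def by (intro open_Un open_Collect_less continuous_intros continuous_signed_distance) auto

lemma Gamma_subset_covered: "\<Gamma> \<subseteq> covered"
  using immersed by (auto simp: immersed_def covered_def)

lemma frontier_negative_region: "z \<in> frontier negative_region \<Longrightarrow> z \<notin> interior negative_region" "z \<in> frontier negative_region \<Longrightarrow> z \<in> negative_region"
  using closed_negative_region by (auto simp: frontier_def closure_closed)

lemma negative_triangle_subset: "negative_triangle K \<Longrightarrow> K \<subseteq> negative_region"
  by (auto simp: negative_region_def)

lemma pos_tri_negative: "pos_tri K p q w \<Longrightarrow> negative_triangle K"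
  using pos_triD[of K p q w] triangle_extreme_iff[of K p q w] unfolding negative_triangle_def
  by (auto intro!: exI[of _ w])

lemma Gamma_h_subset_negative_region: "\<Gamma>\<^sub>h \<subseteq> negative_region"
  using mem_Gamma_h pos_tri_negative negative_triangle_subset triangle_closed_segment pos_triD(3) by blast

lemma Gamma_h_subset_U: "\<Gamma>\<^sub>h \<subseteq> U"
  using mem_Gamma_h pos_tri_subset_U triangle_closed_segment pos_triD(3) by blast

text \<open>If the edge has a triangle on its other side, that triangle cannot be negative, and hence both ends of the
  edge have \<open>\<phi> \<ge> 0\<close>. Otherwise the edge does not meet \<open>\<Gamma>\<close>, so \<open>\<phi>\<close> has the
  same sign on all of it as at \<open>z\<close>.\<close>

lemma frontier_negative_region_edge:
  assumes K: "negative_triangle K" "is_triangle K a b c" and z: "z \<in> open_segment a b"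
    and fr: "z \<in> frontier negative_region" "z \<in> covered"
  shows "pos_tri K a b c"
proof -
  have KT: "K \<in> \<T>" using K by (simp add: negative_triangle_def)
  have "0 \<le> \<phi> a \<and> 0 \<le> \<phi> b"
  proof (cases "\<exists>K' c'. opposite_triangle a b c K' c'")
    case True
    then obtain K' c' where o: "K' \<in> \<T>" "is_triangle K' a b c'"
      "cross (b - a) (c - a) * cross (b - a) (c' - a) < 0"
      unfolding opposite_triangle_def by blast
    have "\<not> negative_triangle K'"
    proof
      assume "negative_triangle K'"
      then have "K \<union> K' \<subseteq> negative_region" using K(1) negative_triangle_subset by blast
      then have "z \<in> interior negative_region"
        using interior_Un_opposite_triangles[OF K(2) o(2) z o(3)] interior_mono by blast
      then show False using frontier_negative_region(1)[OF fr(1)] by blast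
    qed
    then show ?thesis using o(1) triangle_extreme_iff[OF o(2)] unfolding negative_triangle_def
      by (metis insertCI not_less)
  next
    case False
    have dis: "closed_segment a b \<inter> interior (\<Union>\<T>) = {}" by (rule boundary_edge[OF KT K(2) False])
    have zc: "z \<in> closed_segment a b" using z segment_open_subset_closed by blast
    have "0 < \<phi> z" using fr(2) dis zc by (auto simp: covered_def)
    have "0 \<le> \<phi> v" if v: "v \<in> closed_segment a b" for v
    proof (rule ccontr)
      assume "\<not> 0 \<le> \<phi> v"
      then obtain y where "y \<in> closed_segment v z" "y \<in> \<Gamma>"
        using segment_meets_Gamma[of v z] \<open>0 < \<phi> z\<close> by auto
      moreover have "closed_segment v z \<subseteq> closed_segment a b"
        using v zc by (simp add: closed_segment_subset)
      ultimately show False using dis immersed by (auto simp: immersed_def)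
    qed
    then show ?thesis by auto
  qed
  moreover then have "\<phi> c < 0" using K triangle_extreme_iff[OF K(2)]
    by (auto simp: negative_triangle_def)
  ultimately show ?thesis using pos_triI[OF KT K(2)] by blast
qed

text \<open>A small disc about \<open>y\<close> contains no vertex except possibly \<open>y\<close> and meets only edges through \<open>y\<close>, so its
  frontier points other than \<open>y\<close> are interior to such edges.\<close>

lemma star_neighbourhood:
  assumes "y \<in> covered"
  obtains \<epsilon> where "\<epsilon> > 0" "ball y \<epsilon> \<subseteq> covered"
    "\<And>u. u \<in> ball y \<epsilon> \<Longrightarrow> u \<noteq> y \<Longrightarrow> u \<in> frontier negative_region \<Longrightarrow>
       \<exists>K a b c. pos_tri K a b c \<and> u \<in> open_segment a b \<and> y \<in> closed_segment a b"
    "\<And>K v. K \<in> \<T> \<Longrightarrow> v extreme_point_of K \<Longrightarrow> v \<in> ball y \<epsilon> \<Longrightarrow> v = y"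
proof -
  obtain \<epsilon>1 where e1: "\<epsilon>1 > 0" "\<forall>K\<in>\<T>. \<forall>F. F face_of K \<longrightarrow> ball y \<epsilon>1 \<inter> F \<noteq> {} \<longrightarrow> y \<in> F"
    using mesh_near_point by blast
  obtain \<epsilon>2 where e2: "\<epsilon>2 > 0" "ball y \<epsilon>2 \<subseteq> covered" using open_covered assms by (meson open_contains_ball)
  define \<epsilon> where "\<epsilon> = min \<epsilon>1 \<epsilon>2"
  have vert: "v = y" if "K \<in> \<T>" "v extreme_point_of K" "v \<in> ball y \<epsilon>" for K v
  proof -
    have "{v} face_of K" using that by (simp add: face_of_singleton)
    then have "y \<in> {v}" using e1(2) that by (force simp: \<epsilon>_def)
    then show ?thesis by simp
  qed
  show thesis
  proof (rule that[of \<epsilon>])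
    show "\<epsilon> > 0" "ball y \<epsilon> \<subseteq> covered" using e1 e2 by (auto simp: \<epsilon>_def)
    show "\<exists>K a b c. pos_tri K a b c \<and> u \<in> open_segment a b \<and> y \<in> closed_segment a b"
      if u: "u \<in> ball y \<epsilon>" "u \<noteq> y" "u \<in> frontier negative_region" for u
    proof -
      obtain K where K: "negative_triangle K" "u \<in> K"
        using frontier_negative_region(2)[OF u(3)] by (auto simp: negative_region_def)
      then have KT: "K \<in> \<T>" by (simp add: negative_triangle_def)
      obtain p q w where t: "is_triangle K p q w" using mesh_triangle[OF KT] by blast
      show ?thesis
      proof (rule triangle_point_cases[OF t K(2)])
        assume "u \<in> interior K"
        then show ?thesis using frontier_negative_region(1)[OF u(3)] interior_mono[OF negative_triangle_subset[OF K(1)]] by blast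
      next
        assume "u extreme_point_of K"
        then show ?thesis using vert[OF KT _ u(1)] u(2) by blast
      next
        fix a b c assume t': "is_triangle K a b c" and ab: "u \<in> open_segment a b"
        have "u \<in> covered" using u(1) e2 by (auto simp: \<epsilon>_def)
        then have P: "pos_tri K a b c" using frontier_negative_region_edge[OF K(1) t' ab u(3)] by blast
        have "closed_segment a b face_of K" using triangle_edge[OF t'] by (simp add: edge_of_def)
        moreover have "u \<in> ball y \<epsilon>1 \<inter> closed_segment a b"
          using u(1) ab segment_open_subset_closed by (auto simp: \<epsilon>_def)
        ultimately have "y \<in> closed_segment a b" using e1(2) KT by blast
        then show ?thesis using P ab by blast
      qed
    qed
  qed (use vert in blast)
qed

text \<open>If \<open>z\<close> were on no positive edge, the frontier would not meet a punctured disc about \<open>z\<close>; as this is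
  connected, the disc would belong to the region.\<close>

lemma frontier_negative_region_subset:
  assumes z: "z \<in> frontier negative_region" "z \<in> covered"
  shows "z \<in> \<Gamma>\<^sub>h"
proof (rule ccontr)
  assume no: "z \<notin> \<Gamma>\<^sub>h"
  obtain \<epsilon> where \<epsilon>: "\<epsilon> > 0" "\<And>u. u \<in> ball z \<epsilon> \<Longrightarrow> u \<noteq> z \<Longrightarrow> u \<in> frontier negative_region \<Longrightarrow>
       \<exists>K a b c. pos_tri K a b c \<and> u \<in> open_segment a b \<and> z \<in> closed_segment a b"
    using star_neighbourhood[OF z(2)] by metis
  let ?B = "ball z \<epsilon> - {z}"
  have fr: "?B \<inter> frontier negative_region = {}" using \<epsilon>(2) no mem_Gamma_h by blast
  have zD: "z \<in> negative_region" using frontier_negative_region(2)[OF z(1)] .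
  then obtain K where K: "negative_triangle K" "z \<in> K" by (auto simp: negative_region_def)
  then have KT: "K \<in> \<T>" by (simp add: negative_triangle_def)
  obtain p q w where t: "is_triangle K p q w" using mesh_triangle[OF KT] by blast
  obtain v where v: "v \<in> K" "v \<noteq> z" using triangle_vertices[OF t] is_triangleD(2)[OF t] by metis
  define m where "m = min 1 (\<epsilon> / (2 * dist z v))"
  have dv: "0 < dist z v" using v by simp
  have m: "0 < m" "m \<le> 1" "m * dist z v < \<epsilon>"
    using \<epsilon>(1) dv by (auto simp: m_def min_def field_simps)
  define u where "u = z + m *\<^sub>R (v - z)"
  have "u \<in> closed_segment z v" using m by (auto simp: u_def in_segment algebra_simps intro!: exI[of _ m])
  then have "u \<in> K" using K v triangle_compact(2)[OF t] by (meson closed_segment_subset subsetD)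
  moreover have "u \<in> ?B" using m v by (auto simp: u_def dist_norm norm_minus_commute)
  ultimately have "?B \<inter> negative_region \<noteq> {}" using K negative_triangle_subset by blast
  moreover have "connected ?B" by (intro connected_punctured_ball) simp
  ultimately have "?B - negative_region = {}" using connected_Int_frontier fr by blast
  then have "ball z \<epsilon> \<subseteq> negative_region" using zD by blast
  then have "z \<in> interior negative_region" using \<epsilon>(1) mem_interior by blast
  then show False using frontier_negative_region(1)[OF z(1)] by blast
qed

text \<open>A positive edge has only one negative triangle, and near an interior point of the edge no other negative
  triangles occur.\<close>

lemma negative_region_near_positive_edge:
  assumes P: "pos_tri K p q w" and z: "z \<in> open_segment p q"
  shows "\<exists>\<epsilon>>0. \<forall>u\<in>ball z \<epsilon>. u \<in> negative_region \<longleftrightarrow> 0 \<le> cross (q - p) (u - p) * cross (q - p) (w - p)"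
proof -
  note Q = pos_triD[OF P]
  obtain \<epsilon>1 \<epsilon>2 where e: "\<epsilon>1 > 0" "\<forall>u\<in>ball z \<epsilon>1. u \<in> K \<longleftrightarrow> 0 \<le> cross (q - p) (u - p) * cross (q - p) (w - p)"
    "\<epsilon>2 > 0" "\<forall>u\<in>ball z \<epsilon>2. \<forall>K\<in>\<T>. u \<in> K \<longrightarrow> (\<exists>w. is_triangle K p q w)"
    using triangle_near_edge[OF Q(3) z] mesh_near_edge[OF Q(2,3) z] by blast
  have "u \<in> negative_region \<longleftrightarrow> u \<in> K" if u: "u \<in> ball z \<epsilon>2" for u
  proof
    assume "u \<in> negative_region"
    then obtain K' where K': "negative_triangle K'" "u \<in> K'" by (auto simp: negative_region_def)
    then have KT: "K' \<in> \<T>" by (simp add: negative_triangle_def)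
    then obtain w' where t: "is_triangle K' p q w'" using e(4) u K'(2) by blast
    then have "\<phi> w' < 0" using K' triangle_extreme_iff[OF t] Q by (auto simp: negative_triangle_def)
    then have "pos_tri K' p q w'" using pos_triI KT t Q by blast
    then show "u \<in> K" using pos_tri_edge_unique[OF P] K'(2) by simp
  next
    assume "u \<in> K" then show "u \<in> negative_region" using P pos_tri_negative negative_triangle_subset by blast
  qed
  then show ?thesis using e by (intro exI[of _ "min \<epsilon>1 \<epsilon>2"]) auto
qed

text \<open>A positive edge with a point in \<open>\<Omega>\<close> meets \<open>\<Gamma>\<close> and so is not on the boundary of the triangulation.\<close>

lemma Gamma_h_subset_covered: "\<Gamma>\<^sub>h \<subseteq> covered"
proof
  fix x assume "x \<in> \<Gamma>\<^sub>h"
  then obtain K p q w where P: "pos_tri K p q w" and x: "x \<in> closed_segment p q"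
    using mem_Gamma_h by blast
  note Q = pos_triD[OF P]
  have ne: "\<Gamma> \<noteq> {}" using x pos_tri_subset_U[OF P] triangle_closed_segment[OF Q(3)] U_nonempty by blast
  consider "0 < \<phi> x" | "\<phi> x = 0" | "\<phi> x < 0" by linarith
  then show "x \<in> covered"
  proof cases
    case 1 then show ?thesis by (simp add: covered_def)
  next
    case 2 then show ?thesis using signed_distance_eq_0_iff[OF ne] Gamma_subset_covered by blast
  next
    case 3
    then have xo: "x \<in> open_segment p q" using x Q by (auto simp: open_segment_def)
    obtain y where "y \<in> closed_segment x p" "y \<in> \<Gamma>" using segment_meets_Gamma[OF 3 Q(4)] by blast
    moreover have "closed_segment x p \<subseteq> closed_segment p q" using x by (simp add: closed_segment_subset)
    ultimately have "closed_segment p q \<inter> interior (\<Union>\<T>) \<noteq> {}" using immersed by (auto simp: immersed_def)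
    then obtain K' w' where o: "K' \<in> \<T>" "is_triangle K' p q w'"
      "cross (q - p) (w - p) * cross (q - p) (w' - p) < 0"
      using boundary_edge[OF Q(2,3)] unfolding opposite_triangle_def by blast
    have "K \<union> K' \<subseteq> \<Union>\<T>" using Q(2) o(1) by blast
    then have "x \<in> interior (\<Union>\<T>)"
      using interior_Un_opposite_triangles[OF Q(3) o(2) xo o(3)] interior_mono by blast
    then show ?thesis by (simp add: covered_def)
  qed
qed

end

section \<open>Normal lines leave the domain through the positive edges\<close>

context immersed_curve
begin

text \<open>For \<open>T\<close> a unit tangent, these are the points of the half circle of radius \<open>\<rho>\<close> about \<open>y\<close> on the
  side of \<open>T\<close>, from \<open>-\<nu> y\<close> at angle \<open>-pi/2\<close> to \<open>\<nu> y\<close> at angle \<open>pi/2\<close>. Below, \<open>T = e rot (\<nu> y)\<close> where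
  \<open>e = \<plusminus>1\<close> selects the side.\<close>

definition arc_point :: "real^2 \<Rightarrow> real^2 \<Rightarrow> real \<Rightarrow> real \<Rightarrow> real^2" where
  "arc_point y T \<rho> \<omega> = y + \<rho> *\<^sub>R (cos \<omega> *\<^sub>R T + sin \<omega> *\<^sub>R \<nu> y)"

lemma continuous_arc_point: "continuous_on S (arc_point y T \<rho>)"
  unfolding arc_point_def by (intro continuous_intros)

lemma arc_point_ends: "arc_point y T \<rho> (- pi/2) = y - \<rho> *\<^sub>R \<nu> y" "arc_point y T \<rho> (pi/2) = y + \<rho> *\<^sub>R \<nu> y"
proof -
  have "cos (- pi/2) = 0" "sin (- pi/2) = -1" by (simp_all add: cos_minus sin_minus del: minus_divide_left)
  then show "arc_point y T \<rho> (- pi/2) = y - \<rho> *\<^sub>R \<nu> y" by (simp add: arc_point_def)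
qed (simp add: arc_point_def)

lemma arc_point_dist:
  assumes "y \<in> U" "\<bar>e\<bar> = 1" "0 < \<rho>"
  shows "dist y (arc_point y (e *\<^sub>R rot (\<nu> y)) \<rho> \<omega>) = \<rho>"
proof -
  have n: "\<nu> y \<bullet> \<nu> y = 1" using norm_nu[OF assms(1)] by (simp add: norm_eq_1)
  have ee: "e * e = 1" using assms(2) by (metis abs_mult_self_eq mult_1)
  have "norm (cos \<omega> *\<^sub>R (e *\<^sub>R rot (\<nu> y)) + sin \<omega> *\<^sub>R \<nu> y) = 1"
    unfolding norm_eq_1
    by (simp add: inner_add_left inner_add_right n power2_eq_square[symmetric] power_mult_distrib)
       (simp add: power2_eq_square ee)
  then show ?thesis using assms(3) by (simp add: arc_point_def dist_norm)
qed

text \<open>Moving upwards on a half circle about a point of a positive edge, the edge is crossed out of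
  the negative region: a rotation towards \<open>\<nu> y\<close> and \<open>\<nu> y\<close> itself point to the same side of the edge.\<close>

lemma arc_crossing:
  assumes y: "y \<in> U" and e: "\<bar>e\<bar> = 1" and \<rho>: "0 < \<rho>"
    and \<omega>: "- (pi/2) \<le> \<omega>" "\<omega> \<le> pi/2"
    and P: "pos_tri K a b c" and yab: "y \<in> closed_segment a b"
    and u: "arc_point y (e *\<^sub>R rot (\<nu> y)) \<rho> \<omega> \<in> open_segment a b"
  shows "- (pi/2) < \<omega>" "\<omega> < pi/2"
    "\<exists>\<delta>>0. \<forall>\<tau>. \<bar>\<tau> - \<omega>\<bar> < \<delta> \<longrightarrow> (arc_point y (e *\<^sub>R rot (\<nu> y)) \<rho> \<tau> \<in> negative_region \<longleftrightarrow> \<tau> \<le> \<omega>)"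
proof -
  define T where "T = e *\<^sub>R rot (\<nu> y)"
  define pt where "pt = arc_point y T \<rho>"
  define A where "A = cross (b - a) (c - a)"
  note Q = pos_triD[OF P]
  have n: "\<nu> y \<bullet> \<nu> y = 1" using norm_nu[OF y] by (simp add: norm_eq_1)
  have ee: "e * e = 1" using e by (metis abs_mult_self_eq mult_1)
  have "cross (rot (\<nu> y)) (\<nu> y) = - (\<nu> y \<bullet> \<nu> y)" by (simp add: cross_def inner_real2)
  then have TN: "cross T (\<nu> y) = - e" by (simp add: T_def cross_simps n)
  have arc: "cross (pt \<omega> - y) (pt \<tau> - y) = \<rho>\<^sup>2 * (- e) * sin (\<tau> - \<omega>)" for \<tau>
    unfolding pt_def arc_point_def
    by (simp add: cross_simps TN cross_commute[of "\<nu> y"] sin_diff power2_eq_square algebra_simps)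
  have up: "cross (pt \<omega> - y) (\<nu> y) = \<rho> * (- e) * cos \<omega>"
    unfolding pt_def arc_point_def by (simp add: cross_simps TN)
  obtain s t where st: "y = (1 - s) *\<^sub>R a + s *\<^sub>R b" "pt \<omega> = (1 - t) *\<^sub>R a + t *\<^sub>R b"
    using yab u unfolding pt_def T_def in_segment by blast
  define k where "k = t - s"
  have k: "pt \<omega> - y = k *\<^sub>R (b - a)" unfolding st k_def by (simp add: algebra_simps)
  have "dist y (pt \<omega>) = \<rho>" unfolding pt_def T_def by (rule arc_point_dist[OF y e \<rho>])
  then have "pt \<omega> \<noteq> y" using \<rho> by auto
  then have k0: "k \<noteq> 0" using k by auto
  have ya: "y - a = s *\<^sub>R (b - a)" unfolding st by (simp add: algebra_simps)
  have side: "k * cross (b - a) (v - a) = cross (pt \<omega> - y) (v - y)" for v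
  proof -
    have "v - a = (v - y) + s *\<^sub>R (b - a)" using ya by (simp add: algebra_simps)
    then have "cross (b - a) (v - a) = cross (b - a) (v - y)" by (simp only: cross_simps)
    then show ?thesis by (simp add: k cross_simps(5))
  qed
  have neg: "cross (b - a) (\<nu> y) * A < 0" using pos_tri_normal[OF P yab] by (simp add: A_def)
  have knu: "k * cross (b - a) (\<nu> y) = \<rho> * (- e) * cos \<omega>" using up by (simp add: k cross_simps(5))
  have cos0: "cos \<omega> \<noteq> 0" using knu neg k0 by auto
  have "\<omega> \<noteq> - (pi/2)" "\<omega> \<noteq> pi/2" using cos0 cos_pi_half cos_minus[of "pi/2"] by metis+
  then show \<omega>': "- (pi/2) < \<omega>" "\<omega> < pi/2" using \<omega> by auto
  have cosp: "0 < cos \<omega>" by (rule cos_gt_zero_pi[OF \<omega>'])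
  obtain \<epsilon> where \<epsilon>: "\<epsilon> > 0" "\<forall>v\<in>ball (pt \<omega>) \<epsilon>. v \<in> negative_region \<longleftrightarrow> 0 \<le> cross (b - a) (v - a) * A"
    using negative_region_near_positive_edge[OF P] u unfolding pt_def T_def A_def by blast
  have "isCont pt \<omega>" unfolding pt_def
    using continuous_arc_point[of UNIV] by (simp add: continuous_on_eq_continuous_at)
  then obtain \<delta> where \<delta>: "\<delta> > 0" "\<forall>\<tau>. dist \<tau> \<omega> < \<delta> \<longrightarrow> dist (pt \<tau>) (pt \<omega>) < \<epsilon>"
    unfolding continuous_at_eps_delta using \<epsilon>(1) by blast
  have "pt \<tau> \<in> negative_region \<longleftrightarrow> \<tau> \<le> \<omega>" if \<tau>: "\<bar>\<tau> - \<omega>\<bar> < min \<delta> pi" for \<tau>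
  proof -
    have "pt \<tau> \<in> ball (pt \<omega>) \<epsilon>" using \<delta>(2) \<tau> by (auto simp: dist_real_def dist_commute)
    then have "pt \<tau> \<in> negative_region \<longleftrightarrow> 0 \<le> cross (b - a) (pt \<tau> - a) * A" using \<epsilon>(2) by blast
    also have "\<dots> \<longleftrightarrow> (cross (b - a) (pt \<tau> - a) * A) * (cross (b - a) (\<nu> y) * A) \<le> 0"
    proof -
      have "0 \<le> X \<longleftrightarrow> X * Y \<le> 0" if "Y < 0" for X Y :: real
        using that by (auto simp: mult_le_0_iff)
      then show ?thesis using neg by blast
    qed
    also have "(cross (b - a) (pt \<tau> - a) * A) * (cross (b - a) (\<nu> y) * A) =
       (A\<^sup>2 / k\<^sup>2) * ((k * cross (b - a) (pt \<tau> - a)) * (k * cross (b - a) (\<nu> y)))"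
      using k0 by (simp add: power2_eq_square field_simps)
    also have "\<dots> = (A\<^sup>2 / k\<^sup>2 * \<rho>^3 * cos \<omega>) * sin (\<tau> - \<omega>)"
    proof -
      have "(\<rho>\<^sup>2 * (- e) * S) * (\<rho> * (- e) * c) = (\<rho>^3 * c) * S" for S c
      proof -
        have "(\<rho>\<^sup>2 * (- e) * S) * (\<rho> * (- e) * c) = (e * e) * (\<rho>^3 * c) * S"
          by (simp add: power2_eq_square power3_eq_cube)
        then show ?thesis using ee by simp
      qed
      then show ?thesis unfolding side arc knu by simp
    qed
    also have "\<dots> \<le> 0 \<longleftrightarrow> sin (\<tau> - \<omega>) \<le> 0"
    proof -
      have "A \<noteq> 0" using neg by auto
      then have "0 < A\<^sup>2 / k\<^sup>2 * \<rho>^3 * cos \<omega>" using k0 \<rho> cosp by simp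
      moreover have "m * v \<le> 0 \<longleftrightarrow> v \<le> 0" if "0 < m" for m v :: real
        using that by (auto simp: mult_le_0_iff)
      ultimately show ?thesis by blast
    qed
    also have "\<dots> \<longleftrightarrow> \<tau> \<le> \<omega>"
    proof
      assume "sin (\<tau> - \<omega>) \<le> 0"
      then show "\<tau> \<le> \<omega>" using sin_gt_zero[of "\<tau> - \<omega>"] \<tau> by force
    next
      assume "\<tau> \<le> \<omega>"
      then have "0 \<le> sin (\<omega> - \<tau>)" using \<tau> by (intro sin_ge_zero) auto
      then show "sin (\<tau> - \<omega>) \<le> 0" by (simp add: sin_diff mult.commute)
    qed
    finally show ?thesis .
  qed
  then show "\<exists>\<delta>>0. \<forall>\<tau>. \<bar>\<tau> - \<omega>\<bar> < \<delta> \<longrightarrow> (arc_point y (e *\<^sub>R rot (\<nu> y)) \<rho> \<tau> \<in> negative_region \<longleftrightarrow> \<tau> \<le> \<omega>)"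
    using \<delta>(1) unfolding pt_def T_def by (intro exI[of _ "min \<delta> pi"]) auto
qed

text \<open>Within this distance of \<open>y\<close>, the frontier of the negative region consists of positive edges
  that contain \<open>y\<close>, and no vertex except possibly \<open>y\<close> occurs.\<close>

definition star_radius :: "real^2 \<Rightarrow> real \<Rightarrow> bool" where
  "star_radius y \<epsilon> \<longleftrightarrow> \<epsilon> > 0 \<and> ball y \<epsilon> \<subseteq> covered \<and>
    (\<forall>u. u \<in> ball y \<epsilon> \<longrightarrow> u \<noteq> y \<longrightarrow> u \<in> frontier negative_region \<longrightarrow>
       (\<exists>K a b c. pos_tri K a b c \<and> u \<in> open_segment a b \<and> y \<in> closed_segment a b)) \<and>
    (\<forall>K v. K \<in> \<T> \<longrightarrow> v extreme_point_of K \<longrightarrow> v \<in> ball y \<epsilon> \<longrightarrow> v = y)"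

lemma star_radius_exists:
  assumes "y \<in> covered"
  shows "\<exists>\<epsilon>. star_radius y \<epsilon>"
  using star_neighbourhood[OF assms] unfolding star_radius_def by metis

text \<open>On a half circle, the region can only be left upwards.\<close>

lemma arc_downward_closed:
  assumes y: "y \<in> U" and e: "\<bar>e\<bar> = 1" and \<rho>: "0 < \<rho>" "\<rho> < \<epsilon>" and \<epsilon>: "star_radius y \<epsilon>"
    and \<omega>: "- (pi/2) \<le> \<omega>" "\<omega> \<le> pi/2" "arc_point y (e *\<^sub>R rot (\<nu> y)) \<rho> \<omega> \<in> negative_region"
    and \<tau>: "- (pi/2) \<le> \<tau>" "\<tau> \<le> \<omega>"
  shows "arc_point y (e *\<^sub>R rot (\<nu> y)) \<rho> \<tau> \<in> negative_region"
proof -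
  define pt where "pt = arc_point y (e *\<^sub>R rot (\<nu> y)) \<rho>"
  have cont: "continuous_on S pt" for S unfolding pt_def by (rule continuous_arc_point)
  have "pt \<tau> \<in> negative_region"
  proof (rule closed_left_propagates[where P = "\<lambda>\<omega>. pt \<omega> \<in> negative_region" and a = "- (pi/2)" and b = "pi/2"])
    have "closed ({- (pi/2)..pi/2} \<inter> pt -` negative_region)"
      by (rule continuous_closed_preimage[OF cont _ closed_negative_region]) simp
    then show "closed {x \<in> {- (pi/2)..pi/2}. pt x \<in> negative_region}"
      by (simp add: Int_def vimage_def conj_commute)
    show "\<omega> \<in> {- (pi/2)..pi/2}" "pt \<omega> \<in> negative_region" "\<tau> \<in> {- (pi/2)..\<omega>}" using \<omega> \<tau> by (auto simp: pt_def)
    fix x assume x: "- (pi/2) < x" "x \<le> pi/2" "pt x \<in> negative_region"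
    show "\<exists>\<delta>>0. \<forall>t. x - \<delta> < t \<and> t < x \<longrightarrow> pt t \<in> negative_region"
    proof (cases "pt x \<in> interior negative_region")
      case True
      have "open (pt -` interior negative_region)"
        by (rule open_vimage[OF open_interior cont])
      then obtain \<delta> where "\<delta> > 0" "ball x \<delta> \<subseteq> pt -` interior negative_region" using True by (meson open_contains_ball vimageI2)
      then show ?thesis using interior_subset by (intro exI[of _ \<delta>]) (force simp: dist_real_def)
    next
      case False
      then have fr: "pt x \<in> frontier negative_region" using x(3) closed_negative_region by (simp add: frontier_def)
      have "dist y (pt x) = \<rho>" unfolding pt_def by (rule arc_point_dist[OF y e \<rho>(1)])
      then have "pt x \<in> ball y \<epsilon>" "pt x \<noteq> y" using \<rho> by auto
      then obtain K a b c where K: "pos_tri K a b c" "pt x \<in> open_segment a b" "y \<in> closed_segment a b"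
        using \<epsilon> fr unfolding star_radius_def by blast
      obtain \<delta> where \<delta>: "\<delta> > 0" "\<forall>\<tau>. \<bar>\<tau> - x\<bar> < \<delta> \<longrightarrow> (pt \<tau> \<in> negative_region \<longleftrightarrow> \<tau> \<le> x)"
        using arc_crossing(3)[OF y e \<rho>(1) less_imp_le[OF x(1)] x(2) K(1,3) K(2)[unfolded pt_def]]
        unfolding pt_def by blast
      then show ?thesis by (intro exI[of _ \<delta>]) auto
    qed
  qed
  then show ?thesis by (simp add: pt_def)
qed

text \<open>A unit vector with a positive component along the tangent has polar angle strictly between \<open>-pi/2\<close>
  and \<open>pi/2\<close>. The end point \<open>a\<close> is outside the disc, so the edge crosses all the half circles.\<close>

lemma edge_direction_on_arc:
  assumes P: "pos_tri K b a c" and yab: "y \<in> closed_segment b a" "y \<noteq> a" and \<epsilon>: "star_radius y \<epsilon>"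
    and e: "\<bar>e\<bar> = 1" "0 < (a - y) \<bullet> (e *\<^sub>R rot (\<nu> y))"
  shows "\<exists>\<omega>. - (pi/2) < \<omega> \<and> \<omega> < pi/2 \<and>
    (\<forall>\<rho>. 0 < \<rho> \<and> \<rho> < \<epsilon> \<longrightarrow> arc_point y (e *\<^sub>R rot (\<nu> y)) \<rho> \<omega> \<in> open_segment y a)"
proof -
  note Q = pos_triD[OF P]
  note ya = yab(2)
  have y: "y \<in> U" using pos_tri_subset_U[OF P] triangle_closed_segment[OF Q(3)] yab by blast
  define T where "T = e *\<^sub>R rot (\<nu> y)"
  define N where "N = \<nu> y"
  have nN: "norm N = 1" using norm_nu[OF y] by (simp add: N_def)
  have ee: "e * e = 1" using e by (metis abs_mult_self_eq mult_1)
  define L where "L = dist y a"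
  have L: "0 < L" using ya by (simp add: L_def)
  define d where "d = (1/L) *\<^sub>R (a - y)"
  have nd: "norm d = 1" using L by (simp add: d_def L_def dist_norm norm_minus_commute)
  have dec: "d = (d \<bullet> T) *\<^sub>R T + (d \<bullet> N) *\<^sub>R N"
    using orthonormal_expansion[OF nN, of d] ee
    by (simp add: T_def N_def inner_commute add.commute mult.assoc[symmetric] mult.commute)
  have T1: "T \<bullet> T = 1" "N \<bullet> N = 1" "T \<bullet> N = 0" "N \<bullet> T = 0"
    using nN ee by (simp_all add: T_def N_def norm_eq_1 mult.assoc[symmetric])
  have sq: "(d \<bullet> T)\<^sup>2 + (d \<bullet> N)\<^sup>2 = 1"
  proof -
    have "d \<bullet> d = ((d \<bullet> T) *\<^sub>R T + (d \<bullet> N) *\<^sub>R N) \<bullet> ((d \<bullet> T) *\<^sub>R T + (d \<bullet> N) *\<^sub>R N)" using dec by metis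
    then show ?thesis using nd T1 by (simp add: inner_add_left inner_add_right norm_eq_1 power2_eq_square)
  qed
  have dT: "0 < d \<bullet> T" using e(2) L by (simp add: d_def T_def)
  then have "(d \<bullet> N)\<^sup>2 < 1" using sq by (smt (verit) zero_less_power)
  then have dN: "-1 < d \<bullet> N" "d \<bullet> N < 1" by (auto simp: abs_square_less_1 abs_less_iff)
  define \<omega> where "\<omega> = arcsin (d \<bullet> N)"
  have \<omega>: "- (pi/2) < \<omega>" "\<omega> < pi/2" using arcsin_lt_bounded[OF dN] by (auto simp: \<omega>_def)
  have sin: "sin \<omega> = d \<bullet> N" using dN by (simp add: \<omega>_def)
  have "(cos \<omega>)\<^sup>2 = (d \<bullet> T)\<^sup>2" using sq sin by (simp add: cos_squared_eq)
  then have cos: "cos \<omega> = d \<bullet> T" using dT cos_gt_zero_pi[OF \<omega>] by (simp add: power2_eq_iff_nonneg)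
  have pt: "arc_point y T \<rho> \<omega> = y + \<rho> *\<^sub>R d" for \<rho>
    unfolding arc_point_def sin cos using dec by (simp add: N_def)
  have "\<epsilon> \<le> L"
  proof (rule ccontr)
    assume "\<not> \<epsilon> \<le> L"
    then have "a \<in> ball y \<epsilon>" by (simp add: L_def)
    moreover have "a extreme_point_of K" using triangle_extreme_iff[OF Q(3)] by blast
    ultimately show False using \<epsilon> Q(2) ya unfolding star_radius_def by blast
  qed
  then have "arc_point y T \<rho> \<omega> \<in> open_segment y a" if "0 < \<rho>" "\<rho> < \<epsilon>" for \<rho>
  proof -
    have "0 < \<rho>/L" "\<rho>/L < 1" using that L \<open>\<epsilon> \<le> L\<close> by auto
    moreover have "y + \<rho> *\<^sub>R d = (1 - \<rho>/L) *\<^sub>R y + (\<rho>/L) *\<^sub>R a"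
      by (simp add: d_def algebra_simps)
    ultimately show ?thesis unfolding pt in_segment using ya by blast
  qed
  then show ?thesis using \<omega> unfolding T_def by blast
qed

lemma open_segment_subset_right:
  assumes "y \<in> closed_segment b a" "y \<noteq> a"
  shows "open_segment y a \<subseteq> open_segment b a"
proof
  fix u assume "u \<in> open_segment y a"
  then obtain t where t: "0 < t" "t < 1" "u = (1 - t) *\<^sub>R y + t *\<^sub>R a" by (auto simp: in_segment)
  obtain s where s: "0 \<le> s" "s \<le> 1" "y = (1 - s) *\<^sub>R b + s *\<^sub>R a"
    using assms(1) by (auto simp: in_segment)
  have s1: "s < 1" using s assms(2) by (cases "s = 1") auto
  have "b \<noteq> a" using assms by auto
  have "0 < (1 - t) * (1 - s)" using t s1 by simp
  moreover have "(1 - t) * (1 - s) = 1 - (s + t * (1 - s))" by (simp add: algebra_simps)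
  moreover have "0 \<le> t * (1 - s)" "0 < s + t * (1 - s)" using t s s1 by (auto simp: add_nonneg_pos)
  moreover have "u = (1 - (s + t * (1 - s))) *\<^sub>R b + (s + t * (1 - s)) *\<^sub>R a"
    unfolding t(3) s(3) by (simp add: algebra_simps)
  ultimately show "u \<in> open_segment b a"
    unfolding in_segment using \<open>b \<noteq> a\<close> by (intro conjI exI[of _ "s + t * (1 - s)"]) auto
qed

lemma edge_transversal:
  assumes P: "pos_tri K b a c" and y: "y \<in> closed_segment b a" "y \<noteq> a"
  shows "(a - y) \<bullet> rot (\<nu> y) \<noteq> 0"
proof -
  obtain s where s: "0 \<le> s" "s \<le> 1" "y = (1 - s) *\<^sub>R b + s *\<^sub>R a" using y(1) by (auto simp: in_segment)
  have s1: "s < 1" using s y(2) by (cases "s = 1") auto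
  have ay: "a - y = (1 - s) *\<^sub>R (a - b)" unfolding s(3) by (simp add: algebra_simps)
  have "cross (a - b) (\<nu> y) \<noteq> 0" using pos_tri_normal[OF P y(1)] by auto
  then have "cross (a - y) (\<nu> y) \<noteq> 0" unfolding ay cross_simps using s1 by simp
  moreover have "cross (a - y) (\<nu> y) = - ((a - y) \<bullet> rot (\<nu> y))"
    by (simp add: cross_def inner_real2)
  ultimately show ?thesis by simp
qed

text \<open>Some positive edge at \<open>y\<close> meets one of the half circles; below it all points of the half circle are in the
  region, above it none is.\<close>

lemma Gamma_h_crossing:
  assumes y: "y \<in> \<Gamma>\<^sub>h" and \<epsilon>: "star_radius y \<epsilon>" and \<rho>: "0 < \<rho>" "\<rho> < \<epsilon>"
  shows "y - \<rho> *\<^sub>R \<nu> y \<in> negative_region" "y + \<rho> *\<^sub>R \<nu> y \<notin> negative_region"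
proof -
  obtain K b a c where P: "pos_tri K b a c" and yab: "y \<in> closed_segment b a" and ya: "y \<noteq> a"
    using y mem_Gamma_h
  proof -
    obtain K p q w where "pos_tri K p q w" "y \<in> closed_segment p q" using y mem_Gamma_h by blast
    moreover have "p \<noteq> q" using calculation pos_triD(3) is_triangleD(2) by blast
    ultimately show ?thesis
      using that[of K p q w] that[of K q p w] pos_tri_sym closed_segment_commute by metis
  qed
  note Q = pos_triD[OF P]
  have yU: "y \<in> U" using y Gamma_h_subset_U by blast
  define e where "e = (if 0 < (a - y) \<bullet> rot (\<nu> y) then 1 else -1 :: real)"
  have e: "\<bar>e\<bar> = 1" by (simp add: e_def)
  have pos: "0 < (a - y) \<bullet> (e *\<^sub>R rot (\<nu> y))"
    using edge_transversal[OF P yab ya] by (auto simp: e_def)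
  obtain \<omega> where \<omega>: "- (pi/2) < \<omega>" "\<omega> < pi/2"
    "arc_point y (e *\<^sub>R rot (\<nu> y)) \<rho> \<omega> \<in> open_segment y a"
    using edge_direction_on_arc[OF P yab ya \<epsilon> e pos] \<rho> by blast
  then have u: "arc_point y (e *\<^sub>R rot (\<nu> y)) \<rho> \<omega> \<in> open_segment b a"
    using open_segment_subset_right[OF yab ya] by blast
  define pt where "pt = arc_point y (e *\<^sub>R rot (\<nu> y)) \<rho>"
  obtain \<delta> where \<delta>: "\<delta> > 0" "\<And>\<tau>. \<bar>\<tau> - \<omega>\<bar> < \<delta> \<Longrightarrow> pt \<tau> \<in> negative_region \<longleftrightarrow> \<tau> \<le> \<omega>"
    using arc_crossing(3)[OF yU e \<rho>(1) _ _ P yab u] \<omega> unfolding pt_def by auto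
  have "pt \<omega> \<in> negative_region" using \<delta>(2)[of \<omega>] \<delta>(1) by simp
  then have "pt (- (pi/2)) \<in> negative_region"
    using arc_downward_closed[OF yU e \<rho> \<epsilon>, of \<omega> "- (pi/2)"] \<omega> unfolding pt_def by simp
  then show "y - \<rho> *\<^sub>R \<nu> y \<in> negative_region" using arc_point_ends(1) by (simp add: pt_def)
  show "y + \<rho> *\<^sub>R \<nu> y \<notin> negative_region"
  proof
    assume "y + \<rho> *\<^sub>R \<nu> y \<in> negative_region"
    then have top: "pt (pi/2) \<in> negative_region" using arc_point_ends(2) by (simp add: pt_def)
    define \<tau> where "\<tau> = min (pi/2) (\<omega> + \<delta>/2)"
    have \<tau>: "\<omega> < \<tau>" "\<tau> \<le> pi/2" "\<bar>\<tau> - \<omega>\<bar> < \<delta>"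
      using \<delta>(1) \<omega>(1,2) unfolding \<tau>_def by linarith+
    have "pt \<tau> \<in> negative_region"
      using arc_downward_closed[OF yU e \<rho> \<epsilon> _ _ top[unfolded pt_def], of \<tau>] \<tau> \<omega> unfolding pt_def by simp
    then show False using \<delta>(2)[OF \<tau>(3)] \<tau>(1) by simp
  qed
qed

text \<open>At each positive edge the half circle leaves the negative region upwards, and it does not enter it
  again.\<close>

lemma edge_on_side_unique:
  assumes P: "pos_tri K y a c" "pos_tri K' y a' c'"
    and e: "\<bar>e\<bar> = 1" "0 < (a - y) \<bullet> (e *\<^sub>R rot (\<nu> y))" "0 < (a' - y) \<bullet> (e *\<^sub>R rot (\<nu> y))"
  shows "a = a'"
proof -
  note Q = pos_triD[OF P(1)] and Q' = pos_triD[OF P(2)]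
  have yG: "y \<in> \<Gamma>\<^sub>h" using P(1) mem_Gamma_h by (metis ends_in_segment(1))
  have yU: "y \<in> U" using yG Gamma_h_subset_U by blast
  obtain \<epsilon> where \<epsilon>: "star_radius y \<epsilon>" using star_radius_exists yG Gamma_h_subset_covered by blast
  define \<rho> where "\<rho> = \<epsilon>/2"
  have \<rho>: "0 < \<rho>" "\<rho> < \<epsilon>" using \<epsilon> by (auto simp: \<rho>_def star_radius_def)
  define pt where "pt = arc_point y (e *\<^sub>R rot (\<nu> y)) \<rho>"
  have ya: "y \<noteq> a" "y \<noteq> a'" using is_triangleD(2) Q(3) Q'(3) by blast+
  have dir: "\<exists>\<omega>. - (pi/2) < \<omega> \<and> \<omega> < pi/2 \<and> pt \<omega> \<in> open_segment y a"
    if "pos_tri K y a c" "0 < (a - y) \<bullet> (e *\<^sub>R rot (\<nu> y))" "y \<noteq> a" for K a c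
    using edge_direction_on_arc[OF that(1) _ that(3) \<epsilon> e(1) that(2)] \<rho> unfolding pt_def by auto
  obtain \<omega> where \<omega>: "- (pi/2) < \<omega>" "\<omega> < pi/2" "pt \<omega> \<in> open_segment y a"
    using dir[OF P(1) e(2) ya(1)] by blast
  obtain \<omega>' where \<omega>': "- (pi/2) < \<omega>'" "\<omega>' < pi/2" "pt \<omega>' \<in> open_segment y a'"
    using dir[OF P(2) e(3) ya(2)] by blast
  have le: "\<omega>2 \<le> \<omega>1"
    if le1: "pos_tri K1 y a1 c1" "pt \<omega>1 \<in> open_segment y a1" "- (pi/2) < \<omega>1" "\<omega>1 < pi/2"
      and le2: "pos_tri K2 y a2 c2" "pt \<omega>2 \<in> open_segment y a2" "- (pi/2) < \<omega>2" "\<omega>2 < pi/2" for K1 a1 c1 \<omega>1 K2 a2 c2 \<omega>2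
  proof (rule ccontr)
    assume "\<not> \<omega>2 \<le> \<omega>1"
    then have lt: "\<omega>1 < \<omega>2" by simp
    have cr: "\<exists>\<delta>>0. \<forall>\<tau>. \<bar>\<tau> - \<omega>\<bar> < \<delta> \<longrightarrow> (pt \<tau> \<in> negative_region \<longleftrightarrow> \<tau> \<le> \<omega>)"
      if "pos_tri K y a c" "pt \<omega> \<in> open_segment y a" "- (pi/2) < \<omega>" "\<omega> < pi/2" for K a c \<omega>
      using arc_crossing(3)[OF yU e(1) \<rho>(1) _ _ that(1)] that(2-4) unfolding pt_def by auto
    obtain \<delta> where \<delta>: "\<delta> > 0" "\<And>\<tau>. \<bar>\<tau> - \<omega>1\<bar> < \<delta> \<Longrightarrow> pt \<tau> \<in> negative_region \<longleftrightarrow> \<tau> \<le> \<omega>1"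
      using cr[OF le1] by blast
    have top: "pt \<omega>2 \<in> negative_region" using cr[OF le2] by fastforce
    define \<tau> where "\<tau> = min \<omega>2 (\<omega>1 + \<delta>/2)"
    have \<tau>: "\<omega>1 < \<tau>" "\<tau> \<le> \<omega>2" "\<bar>\<tau> - \<omega>1\<bar> < \<delta>" using \<delta>(1) lt by (auto simp: \<tau>_def)
    have "pt \<tau> \<in> negative_region"
      using arc_downward_closed[OF yU e(1) \<rho> \<epsilon> _ _ top[unfolded pt_def], of \<tau>] \<tau> le1(3) le2(3,4)
      unfolding pt_def by simp
    then show False using \<delta>(2)[OF \<tau>(3)] \<tau>(1) by simp
  qed
  have "\<omega> = \<omega>'" using le[OF P(1) \<omega>(3,1,2) P(2) \<omega>'(3,1,2)] le[OF P(2) \<omega>'(3,1,2) P(1) \<omega>(3,1,2)] by simp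
  then have u: "pt \<omega> \<in> open_segment y a" "pt \<omega> \<in> open_segment y a'" using \<omega> \<omega>' by auto
  have "pt \<omega> \<in> K'" using u(2) triangle_closed_segment[OF Q'(3)] segment_open_subset_closed by blast
  then obtain w where t: "is_triangle K' y a w" using mesh_share_edge(1)[OF Q(2,3) Q'(2) u(1)] by blast
  have "closed_segment y a edge_of K'" using triangle_edge[OF t] .
  then have "positive_edge_of \<Omega> K' (closed_segment y a)"
    using Q Q'(1) by (auto simp: positive_edge_of_def positively_cut_triangles_def extreme_point_of_segment)
  then obtain w' where "pos_tri K' y a w'" using positive_edge_of_pos_tri Q'(2) by blast
  then have "{y, a} = {y, a'}" using pos_tri_unique(1) P(2) by blast
  then show ?thesis using ya by (auto simp: doubleton_eq_iff)
qed

text \<open>Each half circle runs from inside the region to its complement.\<close>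

lemma edge_on_side_exists:
  assumes P: "pos_tri K y a c" and e: "\<bar>e\<bar> = 1"
  shows "\<exists>K' a' c'. pos_tri K' y a' c' \<and> 0 < (a' - y) \<bullet> (e *\<^sub>R rot (\<nu> y))"
proof -
  note Q = pos_triD[OF P(1)]
  have yG: "y \<in> \<Gamma>\<^sub>h" using P(1) mem_Gamma_h by (metis ends_in_segment(1))
  have yU: "y \<in> U" using yG Gamma_h_subset_U by blast
  obtain \<epsilon> where \<epsilon>: "star_radius y \<epsilon>" using star_radius_exists yG Gamma_h_subset_covered by blast
  define \<rho> where "\<rho> = \<epsilon>/2"
  have \<rho>: "0 < \<rho>" "\<rho> < \<epsilon>" using \<epsilon> by (auto simp: \<rho>_def star_radius_def)
  define T where "T = e *\<^sub>R rot (\<nu> y)"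
  define pt where "pt = arc_point y T \<rho>"
  have bot: "pt (- (pi/2)) \<in> negative_region" and top: "pt (pi/2) \<notin> negative_region"
    using Gamma_h_crossing[OF yG \<epsilon> \<rho>] arc_point_ends unfolding pt_def by simp_all
  have "connected (pt ` {- (pi/2)..pi/2})"
    by (intro connected_continuous_image) (simp_all add: pt_def continuous_arc_point)
  then have "pt ` {- (pi/2)..pi/2} \<inter> frontier negative_region \<noteq> {}"
  proof (rule connected_Int_frontier)
    have ends: "- (pi/2) \<in> {- (pi/2)..pi/2}" "pi/2 \<in> {- (pi/2)..pi/2}" by auto
    show "pt ` {- (pi/2)..pi/2} \<inter> negative_region \<noteq> {}" using imageI[OF ends(1), of pt] bot by blast
    show "pt ` {- (pi/2)..pi/2} - negative_region \<noteq> {}" using imageI[OF ends(2), of pt] top by blast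
  qed
  then obtain \<omega> where \<omega>: "- (pi/2) \<le> \<omega>" "\<omega> \<le> pi/2" "pt \<omega> \<in> frontier negative_region" by auto
  have "dist y (pt \<omega>) = \<rho>" unfolding pt_def T_def by (rule arc_point_dist[OF yU e \<rho>(1)])
  then have "pt \<omega> \<in> ball y \<epsilon>" and ne: "pt \<omega> \<noteq> y" using \<rho> by auto
  then obtain K' a' b' c' where K': "pos_tri K' a' b' c'" "pt \<omega> \<in> open_segment a' b'" "y \<in> closed_segment a' b'"
    using \<epsilon> \<omega>(3) unfolding star_radius_def by blast
  have \<omega>': "- (pi/2) < \<omega>" "\<omega> < pi/2"
    using arc_crossing(1,2)[OF yU e \<rho>(1) \<omega>(1,2) K'(1,3)] K'(2) unfolding pt_def T_def by auto
  have yab: "y \<in> {a', b'}"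
  proof (rule ccontr)
    assume "y \<notin> {a', b'}"
    then have yo: "y \<in> open_segment a' b'" using K'(3) by (auto simp: open_segment_def)
    obtain w where t: "is_triangle K a' b' w"
      using mesh_share_edge(1)[OF pos_triD(2,3)[OF K'(1)] Q(2) yo] triangle_vertices[OF Q(3)] by blast
    have "y extreme_point_of K" using triangle_extreme_iff[OF Q(3)] by blast
    then show False using yo triangle_vertices[OF t] unfolding extreme_point_of_def by blast
  qed
  obtain d' where P': "pos_tri K' y d' c'" and u: "pt \<omega> \<in> open_segment y d'"
  proof (cases "y = a'")
    case True then show ?thesis using that K' by blast
  next
    case False
    then have "y = b'" using yab by simp
    then show ?thesis using that[of a'] pos_tri_sym[OF K'(1)] K'(2) open_segment_commute by metis
  qed
  obtain t where t: "0 < t" "pt \<omega> = (1 - t) *\<^sub>R y + t *\<^sub>R d'" using u by (auto simp: in_segment)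
  have "t *\<^sub>R (d' - y) = pt \<omega> - y" unfolding t(2) by (simp add: algebra_simps)
  also have "\<dots> = \<rho> *\<^sub>R (cos \<omega> *\<^sub>R T + sin \<omega> *\<^sub>R \<nu> y)" by (simp add: pt_def arc_point_def)
  finally have eq: "t *\<^sub>R (d' - y) = \<rho> *\<^sub>R (cos \<omega> *\<^sub>R T + sin \<omega> *\<^sub>R \<nu> y)" .
  have ee: "e * e = 1" using e by (metis abs_mult_self_eq mult_1)
  have T1: "T \<bullet> T = 1" "\<nu> y \<bullet> T = 0"
    using norm_nu[OF yU] ee by (simp_all add: T_def norm_eq_1 mult.assoc[symmetric])
  have "t * ((d' - y) \<bullet> T) = (t *\<^sub>R (d' - y)) \<bullet> T" by simp
  also have "\<dots> = \<rho> * cos \<omega>" unfolding eq by (simp add: inner_add_left T1)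
  also have "\<dots> > 0" using \<rho> cos_gt_zero_pi[OF \<omega>'] by simp
  finally have "0 < (d' - y) \<bullet> T" using t(1) by (simp add: zero_less_mult_iff)
  then show ?thesis using P' unfolding T_def by blast
qed

lemma two_edges_at_vertex:
  assumes P: "pos_tri K y a c"
  shows "\<exists>a'. a' \<noteq> a \<and> (\<exists>K c. pos_tri K y a' c) \<and> (\<forall>b K c. pos_tri K y b c \<longrightarrow> b = a \<or> b = a')"
proof -
  have tr: "(b - y) \<bullet> rot (\<nu> y) \<noteq> 0" if "pos_tri K y b c" for K b c
    using edge_transversal[OF that] is_triangleD(2) pos_triD(3)[OF that] by auto
  define e where "e = (if 0 < (a - y) \<bullet> rot (\<nu> y) then 1 else -1 :: real)"
  have e: "\<bar>e\<bar> = 1" "\<bar>- e\<bar> = 1" by (auto simp: e_def)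
  have pos: "0 < (a - y) \<bullet> (e *\<^sub>R rot (\<nu> y))" using tr[OF P] by (auto simp: e_def)
  obtain K' a' c' where P': "pos_tri K' y a' c'" and neg: "0 < (a' - y) \<bullet> ((- e) *\<^sub>R rot (\<nu> y))"
    using edge_on_side_exists[OF P e(2)] by blast
  have "a' \<noteq> a" using pos neg by auto
  moreover have "b = a \<or> b = a'" if b: "pos_tri K'' y b c''" for b K'' c''
  proof (cases "0 < (b - y) \<bullet> (e *\<^sub>R rot (\<nu> y))")
    case True
    then show ?thesis using edge_on_side_unique[OF b P e(1) True pos] by blast
  next
    case False
    then have "0 < (b - y) \<bullet> ((- e) *\<^sub>R rot (\<nu> y))" using tr[OF b] by (auto simp: e_def split: if_splits)
    then show ?thesis using edge_on_side_unique[OF b P' e(2) _ neg] by blast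
  qed
  ultimately show ?thesis using P' by blast
qed

end

section \<open>The projection of the positive edges is a homeomorphism\<close>

context immersed_curve
begin

lemma min_angle_sin_le:
  assumes t: "is_triangle K p q w"
  defines "\<alpha> \<equiv> min (interior_angle K p) (interior_angle K q)"
  shows "sin \<alpha> \<le> sin (interior_angle K p)" "sin \<alpha> \<le> sin (interior_angle K q)"
  using sin_le_sin_of_angle_le[OF t] sin_le_sin_of_angle_le[OF is_triangle_perm(3)[OF t]]
  by (auto simp: \<alpha>_def min_def)

text \<open>A displacement changes the distance to a line by at most its length; the products with the sines
  are the distances of \<open>x\<close> to the two other edges.\<close>

lemma pushed_point_in_interior:
  assumes t: "is_triangle K p q w" and x: "x \<in> open_segment p q"
    and n: "norm n = 1" and inward: "0 < cross (q - p) n * cross (q - p) (w - p)"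
    and s: "0 < s" "s < dist x p * sin (interior_angle K p)" "s < dist x q * sin (interior_angle K q)"
  shows "x + s *\<^sub>R n \<in> interior K"
proof -
  define y where "y = x + s *\<^sub>R n"
  have main: "0 < cross (y - p) (w - p) / cross (q - p) (w - p)"
    if t: "is_triangle K p q w" and x: "x \<in> open_segment p q"
      and s: "0 < s" "s < dist x p * sin (interior_angle K p)" for p q
  proof -
    define A where "A = cross (q - p) (w - p)"
    note D = is_triangleD[OF t]
    obtain u where u: "0 < u" "u < 1" "x = (1 - u) *\<^sub>R p + u *\<^sub>R q" using x by (auto simp: in_segment)
    have xp: "x - p = u *\<^sub>R (q - p)" unfolding u by (simp add: algebra_simps)
    have d: "dist x p = u * norm (q - p)" using u(1,2) by (simp add: dist_norm xp)
    have yA: "cross (y - p) (w - p) = u * A + s * cross n (w - p)"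
    proof -
      have "y - p = u *\<^sub>R (q - p) + s *\<^sub>R n" unfolding y_def xp[symmetric] by simp
      then show ?thesis by (simp only: cross_simps(1,5) A_def)
    qed
    have w: "norm (w - p) > 0" using D by simp
    have "\<bar>s * cross n (w - p)\<bar> \<le> s * norm (w - p)"
      using abs_cross_le[of n "w - p"] n s by (simp add: abs_mult)
    also have "\<dots> < dist x p * sin (interior_angle K p) * norm (w - p)"
      using s(2) w by (rule mult_strict_right_mono)
    also have "\<dots> = u * \<bar>A\<bar>"
      using interior_angle_trig(4)[OF t] by (simp add: d A_def)
    finally have lt: "\<bar>s * cross n (w - p)\<bar> < u * \<bar>A\<bar>" .
    show ?thesis unfolding yA A_def[symmetric]
    proof (cases "A > 0")
      case True
      then show "0 < (u * A + s * cross n (w - p)) / A" using lt by auto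
    next
      case False
      then have "A < 0" using D(1) A_def by simp
      then show "0 < (u * A + s * cross n (w - p)) / A" using lt by (auto simp: zero_less_divide_iff)
    qed
  qed
  note D = is_triangleD[OF t]
  define A where "A = cross (q - p) (w - p)"
  have A0: "A \<noteq> 0" using D A_def by simp
  have 1: "0 < cross (y - p) (w - p) / A" using main[OF t x s(1,2)] by (simp add: A_def)
  define Z where "Z = A - cross (y - p) (w - p) - cross (q - p) (y - p)"
  have q: "0 < cross (y - q) (w - q) / cross (p - q) (w - q)"
    by (rule main[OF is_triangle_perm(3)[OF t]]) (use x s in \<open>auto simp: open_segment_commute\<close>)
  have e1: "cross (p - q) (w - q) = - A" by (simp add: A_def cross_def algebra_simps)
  have e2: "cross (y - q) (w - q) = - Z"
    unfolding Z_def by (simp add: A_def cross_def algebra_simps)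
  have "0 < Z / A" using q unfolding e1 e2 by simp
  then have "0 < (A - cross (y - p) (w - p) - cross (q - p) (y - p)) / A"
    by (simp only: Z_def)
  then have 3: "cross (y - p) (w - p) / A + cross (q - p) (y - p) / A < 1"
    using A0 by (simp add: diff_divide_distrib)
  have 2: "0 < cross (q - p) (y - p) / A"
  proof -
    obtain u where "x = (1 - u) *\<^sub>R p + u *\<^sub>R q" using x by (auto simp: in_segment)
    then have "y - p = u *\<^sub>R (q - p) + s *\<^sub>R n" by (simp add: y_def algebra_simps)
    then have "cross (q - p) (y - p) = s * cross (q - p) n" by (simp add: cross_simps(2,6,7))
    then show ?thesis using inward s(1) 
      by (auto simp: A_def zero_less_mult_iff zero_less_divide_iff mult_less_0_iff)
  qed
  show ?thesis using 1 2 3 unfolding triangle_interior_iff[OF t] A_def y_def by blast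
qed

text \<open>Below \<open>\<Gamma>\<close>, the normal line above a point of a positive edge runs in the adjacent
  triangle: the point has depth at most \<open>C/2\<close> times the product of its distances to the end points of the
  edge, and the condition on the adjacent angle makes this less than its distances to the other
  edges.\<close>

lemma above_submerged_point:
  assumes x: "x \<in> \<Gamma>\<^sub>h" and neg: "\<phi> x < 0" and t: "0 < t" "t \<le> - \<phi> x"
  shows "x + t *\<^sub>R \<nu> x \<notin> negative_region"
proof -
  obtain K p q w where P: "pos_tri K p q w" and xc: "x \<in> closed_segment p q"
    using x mem_Gamma_h by blast
  note Q = pos_triD[OF P]
  have xU: "x \<in> U" using x Gamma_h_subset_U by blast
  have xo: "x \<in> open_segment p q" using xc Q neg by (auto simp: open_segment_def)
  obtain y where "y \<in> closed_segment x p" "y \<in> \<Gamma>" using segment_meets_Gamma[OF neg Q(4)] by blast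
  moreover have "closed_segment x p \<subseteq> closed_segment p q" using xc by (simp add: closed_segment_subset)
  ultimately have yG: "y \<in> closed_segment p q \<inter> \<Gamma>" by blast
  then have "closed_segment p q \<inter> interior (\<Union>\<T>) \<noteq> {}" using immersed by (auto simp: immersed_def)
  then obtain K' w' where o: "K' \<in> \<T>" "is_triangle K' p q w'"
    "cross (q - p) (w - p) * cross (q - p) (w' - p) < 0"
    using boundary_edge[OF Q(2,3)] unfolding opposite_triangle_def by blast
  have KK: "K' \<noteq> K"
  proof
    assume "K' = K"
    then have "{p, q, w'} = {p, q, w}"
      using triangle_extreme_iff[OF o(2)] triangle_extreme_iff[OF Q(3)] by blast
    then have "w' = w" using is_triangleD(2-4)[OF Q(3)] is_triangleD(2-4)[OF o(2)]
      by (metis insert_iff empty_iff)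
    then show False using o(3) by (simp add: mult_less_0_iff)
  qed
  have "x \<in> K'" using xc triangle_closed_segment[OF o(2)] by blast
  then have int: "K \<inter> K' = closed_segment p q"
    using mesh_share_edge(2)[OF Q(2,3) o(1) xo] KK by blast
  define \<alpha> where "\<alpha> = min (interior_angle K' p) (interior_angle K' q)"
  have "is_adjacent_angle \<Omega> \<T> K \<alpha>"
    unfolding is_adjacent_angle_def \<alpha>_def
    using pos_tri_positive_edge[OF P] yG o(1) int by blast
  then have adj: "curvature_const \<Omega> K * diameter K < 1/2 * sin \<alpha>" by (rule cond_adj[OF Q(1)])
  have nn: "\<not> negative_triangle K'"
  proof
    assume "negative_triangle K'"
    then have "\<phi> w' < 0" using triangle_extreme_iff[OF o(2)] Q by (auto simp: negative_triangle_def)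
    then have "pos_tri K' p q w'" using pos_triI o Q by blast
    then show False using pos_tri_edge_unique P KK by blast
  qed
  have le_h: "dist x p \<le> diameter K" "dist x q \<le> diameter K"
    using triangle_dist_le[OF Q(3)] triangle_closed_segment[OF Q(3)] xc triangle_vertices[OF Q(3)] by blast+
  have dpos: "0 < dist x p" "0 < dist x q" using xo by (auto simp: open_segment_def)
  note C = pos_tri_C_pos[OF P]
  have "0 < curvature_const \<Omega> K * diameter K" using C less_le_trans[OF dpos(1) le_h(1)] by (rule mult_pos_pos)
  then have sa: "0 < sin \<alpha>" using adj by simp
  have depth: "t \<le> curvature_const \<Omega> K / 2 * (dist x p * dist x q)"
    using pos_tri_lower[OF P xc] t by linarith
  have lt: "t < d1 * sin \<alpha>" if "d1 * d2 = dist x p * dist x q" "0 < d1" "0 < d2" "d2 \<le> diameter K" for d1 d2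
  proof -
    have "t \<le> (curvature_const \<Omega> K / 2 * d2) * d1" using depth unfolding that(1)[symmetric] by (simp add: mult_ac)
    also have "\<dots> \<le> (curvature_const \<Omega> K / 2 * diameter K) * d1"
      using that C by (intro mult_right_mono mult_left_mono) auto
    also have "\<dots> < (sin \<alpha>) * d1"
      using that adj sa by (intro mult_strict_right_mono) auto
    finally show ?thesis by (simp add: mult.commute)
  qed
  have l1: "t < dist x p * sin (interior_angle K' p)"
  proof -
    have "t < dist x p * sin \<alpha>" by (rule lt[of _ "dist x q"]) (use dpos le_h in auto)
    also have "\<dots> \<le> dist x p * sin (interior_angle K' p)"
      using min_angle_sin_le(1)[OF o(2)] unfolding \<alpha>_def by (intro mult_left_mono) auto
    finally show ?thesis .
  qed
  have l2: "t < dist x q * sin (interior_angle K' q)"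
  proof -
    have "t < dist x q * sin \<alpha>" by (rule lt[of _ "dist x p"]) (use dpos le_h in auto)
    also have "\<dots> \<le> dist x q * sin (interior_angle K' q)"
      using min_angle_sin_le(2)[OF o(2)] unfolding \<alpha>_def by (intro mult_left_mono) auto
    finally show ?thesis .
  qed
  have inward: "0 < cross (q - p) (\<nu> x) * cross (q - p) (w' - p)"
    using pos_tri_normal[OF P xc] o(3) by (auto simp: zero_less_mult_iff mult_less_0_iff)
  have "x + t *\<^sub>R \<nu> x \<in> interior K'"
    by (rule pushed_point_in_interior[OF o(2) xo norm_nu[OF xU] inward t(1) l1 l2])
  then show ?thesis
    using mesh_interior_disjoint[OF o(1)] nn unfolding negative_region_def negative_triangle_def by blast
qed

lemma crossing_radius:
  assumes "y \<in> \<Gamma>\<^sub>h"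
  shows "\<exists>\<epsilon>>0. ball y \<epsilon> \<subseteq> covered \<and> (\<forall>\<rho>. 0 < \<rho> \<and> \<rho> < \<epsilon> \<longrightarrow> y - \<rho> *\<^sub>R \<nu> y \<in> negative_region \<and> y + \<rho> *\<^sub>R \<nu> y \<notin> negative_region)"
proof -
  obtain \<epsilon> where \<epsilon>: "star_radius y \<epsilon>" using star_radius_exists assms Gamma_h_subset_covered by blast
  then show ?thesis using Gamma_h_crossing[OF assms \<epsilon>] by (auto simp: star_radius_def)
qed

text \<open>Otherwise the segment of the normal line from \<open>x\<^sub>1\<close> to \<open>x\<^sub>2\<close>, followed downwards from \<open>x\<^sub>2\<close>, could never leave the
  negative region, although it lies outside that region just above \<open>x\<^sub>1\<close>.\<close>

lemma proj_injective_aux: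
  assumes x: "x\<^sub>1 \<in> \<Gamma>\<^sub>h" "x\<^sub>2 \<in> \<Gamma>\<^sub>h" and eq: "\<pi> x\<^sub>1 = \<pi> x\<^sub>2"
  shows "\<phi> x\<^sub>2 \<le> \<phi> x\<^sub>1"
proof (rule ccontr)
  assume "\<not> \<phi> x\<^sub>2 \<le> \<phi> x\<^sub>1"
  then have less: "\<phi> x\<^sub>1 < \<phi> x\<^sub>2" by simp
  have U: "x\<^sub>1 \<in> U" "x\<^sub>2 \<in> U" using x Gamma_h_subset_U by auto
  define \<xi> where "\<xi> = \<pi> x\<^sub>1"
  define N where "N = \<nu> \<xi>"
  have \<xi>: "\<xi> \<in> \<Gamma>" unfolding \<xi>_def by (rule tubular_coordinates(2)[OF U(1)])
  define f where "f s = \<xi> + s *\<^sub>R N" for s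
  have f1: "f (\<phi> x\<^sub>1) = x\<^sub>1" "f (\<phi> x\<^sub>2) = x\<^sub>2"
    using tubular_coordinates(3)[OF U(1)] tubular_coordinates(3)[OF U(2)] nu_proj[OF U(1)] nu_proj[OF U(2)] eq
    by (simp_all add: f_def \<xi>_def N_def)
  have f: "\<phi> (f s) = s" "\<nu> (f s) = N" if "\<phi> x\<^sub>1 \<le> s" "s \<le> \<phi> x\<^sub>2" for s
    using normal_line(2,4)[OF \<xi>, of s] that tubular_coordinates(1)[OF U(1)] tubular_coordinates(1)[OF U(2)]
    by (auto simp: f_def N_def)
  have cont: "continuous_on S f" for S unfolding f_def by (intro continuous_intros)
  have all: "f s \<in> negative_region" if s: "s \<in> {\<phi> x\<^sub>1..\<phi> x\<^sub>2}" for s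
  proof (rule closed_left_propagates[where P = "\<lambda>s. f s \<in> negative_region" and a = "\<phi> x\<^sub>1" and b = "\<phi> x\<^sub>2"])
    have "closed ({\<phi> x\<^sub>1..\<phi> x\<^sub>2} \<inter> f -` negative_region)"
      by (rule continuous_closed_preimage[OF cont _ closed_negative_region]) simp
    then show "closed {s \<in> {\<phi> x\<^sub>1..\<phi> x\<^sub>2}. f s \<in> negative_region}"
      by (simp add: Int_def vimage_def conj_commute)
    show "\<phi> x\<^sub>2 \<in> {\<phi> x\<^sub>1..\<phi> x\<^sub>2}" using less by simp
    show "f (\<phi> x\<^sub>2) \<in> negative_region" using f1 x Gamma_h_subset_negative_region by auto
    show "s \<in> {\<phi> x\<^sub>1..\<phi> x\<^sub>2}" by (rule s)
    fix s assume s: "\<phi> x\<^sub>1 < s" "s \<le> \<phi> x\<^sub>2" "f s \<in> negative_region"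
    have fs: "\<phi> (f s) = s" "\<nu> (f s) = N" using f s by auto
    show "\<exists>\<delta>>0. \<forall>t. s - \<delta> < t \<and> t < s \<longrightarrow> f t \<in> negative_region"
    proof (cases "f s \<in> interior negative_region")
      case True
      have "open (f -` interior negative_region)" by (rule open_vimage[OF open_interior cont])
      then obtain \<delta> where "\<delta> > 0" "ball s \<delta> \<subseteq> f -` interior negative_region" using True by (meson open_contains_ball vimageI2)
      then show ?thesis using interior_subset by (intro exI[of _ \<delta>]) (force simp: dist_real_def)
    next
      case False
      then have fr: "f s \<in> frontier negative_region" using s(3) closed_negative_region by (simp add: frontier_def)
      have "f s \<in> covered"
      proof (rule ccontr)
        assume nG: "f s \<notin> covered"
        have "s < 0"
        proof (rule ccontr)
          assume "\<not> s < 0"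
          then consider "s = 0" | "0 < s" by linarith
          then show False
          proof cases
            case 1 then show False using nG Gamma_subset_covered \<xi> by (auto simp: f_def)
          next
            case 2 then show False using nG fs by (simp add: covered_def)
          qed
        qed
        \<comment> \<open>At an uncovered point below \<open>\<Gamma>\<close>, the adjacent triangle of \<open>x\<^sub>1\<close> takes effect.\<close>
        have "\<nu> x\<^sub>1 = N" using nu_proj[OF U(1)] by (simp add: N_def \<xi>_def)
        then have "f s = x\<^sub>1 + (s - \<phi> x\<^sub>1) *\<^sub>R \<nu> x\<^sub>1"
          using f1(1) by (simp add: f_def algebra_simps)
        then have "f s \<notin> negative_region" using above_submerged_point[OF x(1), of "s - \<phi> x\<^sub>1"] s \<open>s < 0\<close> by simp
        then show False using s(3) by simp
      qed
      then have "f s \<in> \<Gamma>\<^sub>h" using frontier_negative_region_subset fr by blast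
      then obtain \<delta> where \<delta>: "\<delta> > 0" "\<And>\<rho>. 0 < \<rho> \<Longrightarrow> \<rho> < \<delta> \<Longrightarrow> f s - \<rho> *\<^sub>R N \<in> negative_region"
        using crossing_radius[of "f s"] fs(2) by auto
      have "f t \<in> negative_region" if "s - \<delta> < t" "t < s" for t
        using \<delta>(2)[of "s - t"] that by (simp add: f_def algebra_simps)
      then show ?thesis using \<delta>(1) by blast
    qed
  qed
  obtain \<epsilon> where \<epsilon>: "\<epsilon> > 0" "\<And>\<rho>. 0 < \<rho> \<Longrightarrow> \<rho> < \<epsilon> \<Longrightarrow> x\<^sub>1 + \<rho> *\<^sub>R \<nu> x\<^sub>1 \<notin> negative_region"
    using crossing_radius[OF x(1)] by auto
  define \<rho> where "\<rho> = min (\<epsilon>/2) (\<phi> x\<^sub>2 - \<phi> x\<^sub>1)"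
  have \<rho>: "0 < \<rho>" "\<rho> < \<epsilon>" "\<phi> x\<^sub>1 + \<rho> \<le> \<phi> x\<^sub>2" using \<epsilon>(1) less by (auto simp: \<rho>_def)
  have "f (\<phi> x\<^sub>1 + \<rho>) = x\<^sub>1 + \<rho> *\<^sub>R \<nu> x\<^sub>1"
    using f1(1) nu_proj[OF U(1)] by (simp add: f_def N_def \<xi>_def algebra_simps)
  then show False using all[of "\<phi> x\<^sub>1 + \<rho>"] \<rho> \<epsilon>(2)[OF \<rho>(1,2)] by simp
qed

lemma proj_injective: "inj_on \<pi> \<Gamma>\<^sub>h"
proof (rule inj_onI)
  fix x y assume xy: "x \<in> \<Gamma>\<^sub>h" "y \<in> \<Gamma>\<^sub>h" "\<pi> x = \<pi> y"
  then have "\<phi> x = \<phi> y" using proj_injective_aux[of x y] proj_injective_aux[of y x] by simp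
  then show "x = y" using same_proj(2)[of x y] xy Gamma_h_subset_U by auto
qed

text \<open>A frontier point on the normal line below \<open>y\<close> would belong to \<open>\<Gamma>\<^sub>h\<close>, and the region would be left above it.\<close>

lemma below_Gamma_h_interior:
  assumes y: "y \<in> \<Gamma>\<^sub>h"
  shows "\<exists>\<epsilon>>0. \<forall>\<rho>. 0 < \<rho> \<and> \<rho> < \<epsilon> \<longrightarrow> y - \<rho> *\<^sub>R \<nu> y \<in> interior negative_region"
proof -
  have yU: "y \<in> U" using y Gamma_h_subset_U by blast
  obtain \<epsilon> where \<epsilon>: "\<epsilon> > 0" "ball y \<epsilon> \<subseteq> covered" "\<And>\<rho>. 0 < \<rho> \<Longrightarrow> \<rho> < \<epsilon> \<Longrightarrow> y - \<rho> *\<^sub>R \<nu> y \<in> negative_region"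
    using crossing_radius[OF y] by auto
  define \<epsilon>' where "\<epsilon>' = min \<epsilon> (r - \<bar>\<phi> y\<bar>)"
  have "\<epsilon>' > 0" using \<epsilon> tubular_coordinates(1)[OF yU] by (simp add: \<epsilon>'_def)
  moreover have "y - \<rho> *\<^sub>R \<nu> y \<in> interior negative_region" if \<rho>: "0 < \<rho>" "\<rho> < \<epsilon>'" for \<rho>
  proof (rule ccontr)
    define z where "z = y - \<rho> *\<^sub>R \<nu> y"
    assume "y - \<rho> *\<^sub>R \<nu> y \<notin> interior negative_region"
    moreover have zD: "z \<in> negative_region" using \<epsilon>(3) \<rho> by (simp add: \<epsilon>'_def z_def)
    ultimately have "z \<in> frontier negative_region" using closed_negative_region by (simp add: frontier_def z_def)
    moreover have "z \<in> ball y \<epsilon>" using \<rho> norm_nu[OF yU] by (simp add: z_def \<epsilon>'_def dist_norm)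
    ultimately have zG: "z \<in> \<Gamma>\<^sub>h" using frontier_negative_region_subset \<epsilon>(2) by blast
    have zl: "z = \<pi> y + (\<phi> y - \<rho>) *\<^sub>R \<nu> (\<pi> y)"
      using tubular_coordinates(3)[OF yU] by (simp add: z_def nu_proj[OF yU] algebra_simps)
    have nz: "\<nu> z = \<nu> y"
    proof -
      have "\<rho> < r - \<bar>\<phi> y\<bar>" using \<rho> by (simp add: \<epsilon>'_def)
      then have "\<bar>\<phi> y - \<rho>\<bar> < r" using \<rho>(1) by linarith
      then show ?thesis
        unfolding zl using normal_line(4)[OF tubular_coordinates(2)[OF yU]] nu_proj[OF yU] by simp
    qed
    obtain \<delta> where \<delta>: "\<delta> > 0" "\<And>\<tau>. 0 < \<tau> \<Longrightarrow> \<tau> < \<delta> \<Longrightarrow> z + \<tau> *\<^sub>R \<nu> z \<notin> negative_region"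
      using crossing_radius[OF zG] by auto
    define \<tau> where "\<tau> = min (\<delta>/2) (\<rho>/2)"
    have \<tau>: "0 < \<tau>" "\<tau> < \<delta>" "\<tau> < \<rho>" using \<delta> \<rho> by (auto simp: \<tau>_def)
    have "z + \<tau> *\<^sub>R \<nu> z = y - (\<rho> - \<tau>) *\<^sub>R \<nu> y" by (simp add: nz) (simp add: z_def algebra_simps)
    then show False using \<delta>(2)[OF \<tau>(1,2)] \<epsilon>(3)[of "\<rho> - \<tau>"] \<tau> \<rho> by (simp add: \<epsilon>'_def)
  qed
  ultimately show ?thesis by blast
qed

text \<open>Near a point of \<open>\<Gamma>\<^sub>h\<close>, the neighbouring normal lines also lead from the interior of the negative region to its
  complement.\<close>

lemma proj_image_open:
  assumes x: "x \<in> \<Gamma>\<^sub>h"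
  shows "\<exists>\<delta>>0. ball (\<pi> x) \<delta> \<inter> \<Gamma> \<subseteq> \<pi> ` \<Gamma>\<^sub>h"
proof -
  have xU: "x \<in> U" using x Gamma_h_subset_U by blast
  obtain \<epsilon>1 where \<epsilon>1: "\<epsilon>1 > 0" "ball x \<epsilon>1 \<subseteq> covered" "\<And>\<rho>. 0 < \<rho> \<Longrightarrow> \<rho> < \<epsilon>1 \<Longrightarrow> x + \<rho> *\<^sub>R \<nu> x \<notin> negative_region"
    using crossing_radius[OF x] by auto
  obtain \<epsilon>2 where \<epsilon>2: "\<epsilon>2 > 0" "\<And>\<rho>. 0 < \<rho> \<Longrightarrow> \<rho> < \<epsilon>2 \<Longrightarrow> x - \<rho> *\<^sub>R \<nu> x \<in> interior negative_region"
    using below_Gamma_h_interior[OF x] by auto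
  define s where "s = \<phi> x"
  define \<rho> where "\<rho> = Min {\<epsilon>1/2, \<epsilon>2/2, (r - \<bar>s\<bar>)/2}"
  have rs: "\<bar>s\<bar> < r" unfolding s_def by (rule tubular_coordinates(1)[OF xU])
  have \<rho>: "0 < \<rho>" "\<rho> < \<epsilon>1" "\<rho> < \<epsilon>2" "\<rho> \<le> \<epsilon>1/2" "\<bar>s\<bar> + \<rho> < r"
  proof -
    show p: "0 < \<rho>" using \<epsilon>1(1) \<epsilon>2(1) rs by (simp add: \<rho>_def)
    show l1: "\<rho> \<le> \<epsilon>1/2" unfolding \<rho>_def by (rule Min_le) simp_all
    have l2: "\<rho> \<le> \<epsilon>2/2" unfolding \<rho>_def by (rule Min_le) simp_all
    have l3: "\<rho> \<le> (r - \<bar>s\<bar>)/2" unfolding \<rho>_def by (rule Min_le) simp_all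
    show "\<rho> < \<epsilon>1" using l1 \<epsilon>1(1) by linarith
    show "\<rho> < \<epsilon>2" using l2 \<epsilon>2(1) by linarith
    show "\<bar>s\<bar> + \<rho> < r" using l3 rs by (simp add: field_simps)
  qed
  define \<xi> where "\<xi> = \<pi> x"
  have \<xi>: "\<xi> \<in> \<Gamma>" unfolding \<xi>_def by (rule tubular_coordinates(2)[OF xU])
  define f where "f \<zeta> \<tau> = \<zeta> + \<tau> *\<^sub>R \<nu> \<zeta>" for \<zeta> :: "real^2" and \<tau> :: real
  have fx: "f \<xi> (s + \<tau>) = x + \<tau> *\<^sub>R \<nu> x" for \<tau>
    using tubular_coordinates(3)[OF xU] nu_proj[OF xU] by (simp add: f_def \<xi>_def s_def algebra_simps)
  have contf: "continuous_on \<Gamma> (\<lambda>\<zeta>. f \<zeta> \<tau>)" for \<tau>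
    unfolding f_def by (intro continuous_intros continuous_on_subset[OF continuous_nu Gamma_subset_U])
  have bot: "f \<xi> (s - \<rho>) \<in> interior negative_region" using \<epsilon>2(2)[OF \<rho>(1,3)] fx[of "-\<rho>"] by simp
  have top: "f \<xi> (s + \<rho>) \<in> - negative_region" using \<epsilon>1(3)[OF \<rho>(1,2)] fx[of \<rho>] by simp
  have near: "\<exists>\<delta>>0. \<forall>\<zeta>\<in>\<Gamma>. dist \<zeta> \<xi> < \<delta> \<longrightarrow> g \<zeta> \<in> W"
    if gW: "continuous_on \<Gamma> g" "open W" "g \<xi> \<in> W" for g :: "real^2 \<Rightarrow> real^2" and W
  proof -
    obtain e where e: "e > 0" "ball (g \<xi>) e \<subseteq> W" using gW(2,3) by (meson open_contains_ball)
    obtain \<delta> where "\<delta> > 0" "\<forall>\<zeta>\<in>\<Gamma>. dist \<zeta> \<xi> < \<delta> \<longrightarrow> dist (g \<zeta>) (g \<xi>) < e"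
      using gW(1) \<xi> e(1) unfolding continuous_on_iff by blast
    then show ?thesis using e(2) by (intro exI[of _ \<delta>]) (auto simp: dist_commute)
  qed
  obtain \<delta>1 where \<delta>1: "\<delta>1 > 0" "\<forall>\<zeta>\<in>\<Gamma>. dist \<zeta> \<xi> < \<delta>1 \<longrightarrow> f \<zeta> (s - \<rho>) \<in> interior negative_region"
    using near[OF contf open_interior bot] by blast
  have "open (- negative_region)" using closed_negative_region by (simp add: open_Compl)
  from near[OF contf this top] obtain \<delta>2 where \<delta>2: "\<delta>2 > 0" "\<forall>\<zeta>\<in>\<Gamma>. dist \<zeta> \<xi> < \<delta>2 \<longrightarrow> f \<zeta> (s + \<rho>) \<in> - negative_region"
    by blast
  obtain \<delta>3 where \<delta>3: "\<delta>3 > 0" "\<forall>\<zeta>\<in>\<Gamma>. dist \<zeta> \<xi> < \<delta>3 \<longrightarrow> dist (\<nu> \<zeta>) (\<nu> \<xi>) < \<epsilon>1 / (4 * r)"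
    using continuous_on_subset[OF continuous_nu Gamma_subset_U] \<xi> \<epsilon>1(1) r_pos
    unfolding continuous_on_iff by (metis divide_pos_pos zero_less_mult_iff zero_less_numeral)
  define \<delta> where "\<delta> = Min {\<delta>1, \<delta>2, \<delta>3, \<epsilon>1/4}"
  have \<delta>: "\<delta> > 0" "\<delta> \<le> \<delta>1" "\<delta> \<le> \<delta>2" "\<delta> \<le> \<delta>3" "\<delta> \<le> \<epsilon>1/4"
    using \<delta>1 \<delta>2 \<delta>3 \<epsilon>1 by (auto simp: \<delta>_def)
  have "\<zeta> \<in> \<pi> ` \<Gamma>\<^sub>h" if \<zeta>: "\<zeta> \<in> \<Gamma>" "dist \<zeta> \<xi> < \<delta>" for \<zeta>
  proof -
    have r\<tau>: "\<bar>\<tau>\<bar> < r" if "\<tau> \<in> {s - \<rho>..s + \<rho>}" for \<tau> using that \<rho> by auto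
    have inG: "f \<zeta> \<tau> \<in> covered" if \<tau>: "\<tau> \<in> {s - \<rho>..s + \<rho>}" for \<tau>
    proof -
      have "f \<zeta> \<tau> - f \<xi> \<tau> = (\<zeta> - \<xi>) + \<tau> *\<^sub>R (\<nu> \<zeta> - \<nu> \<xi>)"
        by (simp add: f_def algebra_simps)
      then have "norm (f \<zeta> \<tau> - f \<xi> \<tau>) \<le> norm (\<zeta> - \<xi>) + \<bar>\<tau>\<bar> * norm (\<nu> \<zeta> - \<nu> \<xi>)"
        by (metis norm_triangle_ineq norm_scaleR)
      also have "\<bar>\<tau>\<bar> * norm (\<nu> \<zeta> - \<nu> \<xi>) \<le> r * (\<epsilon>1 / (4 * r))"
        using r\<tau>[OF \<tau>] \<delta>3(2) \<zeta> \<delta> r_pos by (intro mult_mono) (auto simp: dist_norm less_imp_le)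
      also have "r * (\<epsilon>1 / (4 * r)) = \<epsilon>1/4" using r_pos by simp
      finally have 1: "dist (f \<zeta> \<tau>) (f \<xi> \<tau>) < \<epsilon>1/4 + \<epsilon>1/4" using \<zeta> \<delta> by (simp add: dist_norm)
      have "f \<xi> \<tau> = x + (\<tau> - s) *\<^sub>R \<nu> x" using fx[of "\<tau> - s"] by simp
      then have "dist (f \<xi> \<tau>) x \<le> \<rho>" using norm_nu[OF xU] \<tau> by (auto simp: dist_norm)
      then have "dist (f \<zeta> \<tau>) x < \<epsilon>1" using 1 \<rho>(4) dist_triangle[of "f \<zeta> \<tau>" x "f \<xi> \<tau>"] by linarith
      then show ?thesis using \<epsilon>1(2) by (auto simp: dist_commute)
    qed
    have "connected (f \<zeta> ` {s - \<rho>..s + \<rho>})"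
      by (intro connected_continuous_image) (auto simp: f_def intro!: continuous_intros)
    then have "f \<zeta> ` {s - \<rho>..s + \<rho>} \<inter> frontier negative_region \<noteq> {}"
    proof (rule connected_Int_frontier)
      have ends: "s - \<rho> \<in> {s - \<rho>..s + \<rho>}" "s + \<rho> \<in> {s - \<rho>..s + \<rho>}" using \<rho> by auto
      have "f \<zeta> (s - \<rho>) \<in> negative_region" "f \<zeta> (s + \<rho>) \<notin> negative_region"
        using \<delta>1 \<delta>2 \<zeta> \<delta> interior_subset by force+
      then show "f \<zeta> ` {s - \<rho>..s + \<rho>} \<inter> negative_region \<noteq> {}" "f \<zeta> ` {s - \<rho>..s + \<rho>} - negative_region \<noteq> {}"
        using imageI[OF ends(1), of "f \<zeta>"] imageI[OF ends(2), of "f \<zeta>"] by blast+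
    qed
    then obtain \<tau> where \<tau>: "\<tau> \<in> {s - \<rho>..s + \<rho>}" "f \<zeta> \<tau> \<in> frontier negative_region" by blast
    then have "f \<zeta> \<tau> \<in> \<Gamma>\<^sub>h" using frontier_negative_region_subset inG by blast
    moreover have "\<pi> (f \<zeta> \<tau>) = \<zeta>" unfolding f_def by (rule normal_line(3)[OF \<zeta>(1) r\<tau>[OF \<tau>(1)]])
    ultimately show ?thesis by (metis imageI)
  qed
  then show ?thesis using \<delta>(1) unfolding \<xi>_def by (intro exI[of _ \<delta>]) (auto simp: dist_commute)
qed

lemma finite_positive_edges: "finite (positive_edges \<Omega> \<T>)"
proof -
  have "positive_edges \<Omega> \<T> \<subseteq> (\<Union>K\<in>\<T>. {F. F face_of K})"
    by (auto simp: positive_edges_def positive_edge_of_def edge_of_def)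
  moreover have "finite (\<Union>K\<in>\<T>. {F. F face_of K})"
    using finite_mesh triangulation finite_polytope_faces simplex_imp_polytope
    by (auto simp: planar_triangulation_def)
  ultimately show ?thesis by (rule finite_subset)
qed

lemma compact_Gamma_h: "compact \<Gamma>\<^sub>h"
proof (rule compact_Union[OF finite_positive_edges])
  fix e assume "e \<in> positive_edges \<Omega> \<T>"
  then obtain K where "K \<in> \<T>" "positive_edge_of \<Omega> K e" by (auto simp: positive_edges_def)
  then show "compact e" using positive_edge_cases compact_segment by metis
qed

text \<open>On each component the image is open, closed and nonempty.\<close>

lemma proj_surjective:
  assumes comp: "\<And>\<gamma>. \<gamma> \<in> components \<Gamma> \<Longrightarrow> {x\<in>\<Gamma>\<^sub>h. \<pi> x \<in> \<gamma>} \<noteq> {}"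
  shows "\<pi> ` \<Gamma>\<^sub>h = \<Gamma>"
proof
  show "\<pi> ` \<Gamma>\<^sub>h \<subseteq> \<Gamma>" using tubular_coordinates(2) Gamma_h_subset_U by blast
  have cpt: "compact (\<pi> ` \<Gamma>\<^sub>h)"
    by (intro compact_continuous_image compact_Gamma_h continuous_on_subset[OF continuous_proj Gamma_h_subset_U])
  show "\<Gamma> \<subseteq> \<pi> ` \<Gamma>\<^sub>h"
  proof
    fix \<xi> assume "\<xi> \<in> \<Gamma>"
    then obtain \<gamma> where \<gamma>: "\<gamma> \<in> components \<Gamma>" "\<xi> \<in> \<gamma>" using Union_components by blast
    have con: "connected \<gamma>" and sub: "\<gamma> \<subseteq> \<Gamma>"
      using \<gamma>(1) in_components_connected in_components_subset by blast+
    define S where "S = \<gamma> \<inter> \<pi> ` \<Gamma>\<^sub>h"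
    have "closedin (top_of_set \<gamma>) S"
      unfolding S_def using cpt compact_imp_closed closedin_closed_Int by blast
    moreover have "openin (top_of_set \<gamma>) S"
      unfolding openin_contains_ball
    proof (intro conjI ballI)
      show "S \<subseteq> \<gamma>" by (auto simp: S_def)
      fix \<zeta> assume "\<zeta> \<in> S"
      then obtain x where "x \<in> \<Gamma>\<^sub>h" "\<zeta> = \<pi> x" by (auto simp: S_def)
      then obtain \<delta> where "\<delta> > 0" "ball \<zeta> \<delta> \<inter> \<Gamma> \<subseteq> \<pi> ` \<Gamma>\<^sub>h" using proj_image_open by blast
      then show "\<exists>e>0. ball \<zeta> e \<inter> \<gamma> \<subseteq> S" using sub by (intro exI[of _ \<delta>]) (auto simp: S_def)
    qed
    moreover have "S \<noteq> {}" using comp[OF \<gamma>(1)] by (auto simp: S_def)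
    ultimately have "S = \<gamma>" using con unfolding connected_clopen by blast
    then show "\<xi> \<in> \<pi> ` \<Gamma>\<^sub>h" using \<gamma>(2) by (auto simp: S_def)
  qed
qed

lemma proj_homeomorphism:
  assumes "\<And>\<gamma>. \<gamma> \<in> components \<Gamma> \<Longrightarrow> {x\<in>\<Gamma>\<^sub>h. \<pi> x \<in> \<gamma>} \<noteq> {}"
  shows "\<exists>g. homeomorphism \<Gamma>\<^sub>h \<Gamma> \<pi> g"
  by (rule homeomorphism_compact[OF compact_Gamma_h
        continuous_on_subset[OF continuous_proj Gamma_h_subset_U] proj_surjective[OF assms] proj_injective])
     auto

end

section \<open>Polygons whose vertices have degree two\<close>

text \<open>A finite straight-line graph in which every vertex has exactly two neighbours is a disjoint
  union of simple closed polygons.\<close>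

locale two_regular_graph =
  fixes E :: "'a::euclidean_space \<Rightarrow> 'a \<Rightarrow> bool"
  assumes sym: "E x y \<Longrightarrow> E y x" and irrefl: "\<not> E x x"
    and finite_vertices: "finite {x. \<exists>y. E x y}"
    and two: "E x y \<Longrightarrow> \<exists>z. z \<noteq> y \<and> E x z \<and> (\<forall>v. E x v \<longrightarrow> v = y \<or> v = z)"
    and cross_at_ends: "E a b \<Longrightarrow> E c d \<Longrightarrow> {a, b} \<noteq> {c, d} \<Longrightarrow>
       closed_segment a b \<inter> closed_segment c d \<subseteq> {a, b} \<inter> {c, d}"
begin

fun trail :: "'a list \<Rightarrow> bool" where
  "trail [] = True"
| "trail [x] = True"
| "trail (x # y # xs) = (E x y \<and> trail (y # xs))"

fun polygon :: "'a list \<Rightarrow> 'a set" where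
  "polygon [] = {}"
| "polygon [x] = {}"
| "polygon (x # y # xs) = closed_segment x y \<union> polygon (y # xs)"

lemma trail_edge: "trail xs \<Longrightarrow> Suc i < length xs \<Longrightarrow> E (xs ! i) (xs ! Suc i)"
proof (induction xs arbitrary: i rule: trail.induct)
  case (3 x y xs)
  then show ?case by (cases i) auto
qed auto

lemma mem_polygon: "z \<in> polygon xs \<longleftrightarrow> (\<exists>i. Suc i < length xs \<and> z \<in> closed_segment (xs ! i) (xs ! Suc i))"
proof (induction xs rule: polygon.induct)
  case (3 x y xs)
  show ?case
  proof
    assume "z \<in> polygon (x # y # xs)"
    then consider "z \<in> closed_segment x y" | "z \<in> polygon (y # xs)" by auto
    then show "\<exists>i. Suc i < length (x # y # xs) \<and> z \<in> closed_segment ((x # y # xs) ! i) ((x # y # xs) ! Suc i)"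
    proof cases
      case 1 then show ?thesis by (intro exI[of _ 0]) auto
    next
      case 2 
      then obtain i where "Suc i < length (y # xs)" "z \<in> closed_segment ((y # xs) ! i) ((y # xs) ! Suc i)"
        using 3 by blast
      then show ?thesis by (intro exI[of _ "Suc i"]) auto
    qed
  next
    assume "\<exists>i. Suc i < length (x # y # xs) \<and> z \<in> closed_segment ((x # y # xs) ! i) ((x # y # xs) ! Suc i)"
    then obtain i where i: "Suc i < length (x # y # xs)" "z \<in> closed_segment ((x # y # xs) ! i) ((x # y # xs) ! Suc i)"
      by blast
    show "z \<in> polygon (x # y # xs)"
    proof (cases i)
      case 0 then show ?thesis using i by simp
    next
      case (Suc j)
      then have "z \<in> polygon (y # xs)" unfolding 3 using i by (intro exI[of _ j]) auto
      then show ?thesis by simp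
    qed
  qed
qed auto

lemma trail_append: "trail (xs @ [y]) \<longleftrightarrow> trail xs \<and> (xs \<noteq> [] \<longrightarrow> E (last xs) y)"
  by (induction xs rule: trail.induct) auto

lemma polygon_snoc: "xs \<noteq> [] \<Longrightarrow> polygon (xs @ [y]) = polygon xs \<union> closed_segment (last xs) y"
  by (induction xs rule: polygon.induct) auto

lemma trail_segment_meets:
  assumes tr: "trail xs" and dist: "distinct xs" and e: "E a b"
    and new: "\<And>i. Suc i < length xs \<Longrightarrow> {xs ! i, xs ! Suc i} \<noteq> {a, b}"
  shows "polygon xs \<inter> closed_segment a b \<subseteq> {a, b} \<inter> set xs"
proof
  fix z assume z: "z \<in> polygon xs \<inter> closed_segment a b"
  then obtain i where i: "Suc i < length xs" "z \<in> closed_segment (xs ! i) (xs ! Suc i)"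
    using mem_polygon by blast
  have "z \<in> {xs ! i, xs ! Suc i} \<inter> {a, b}"
    using cross_at_ends[OF trail_edge[OF tr i(1)] e new[OF i(1)]] i z by blast
  then show "z \<in> {a, b} \<inter> set xs" using i(1) by auto
qed

lemma simple_trail_arc:
  assumes "trail xs" "distinct xs" "2 \<le> length xs"
  shows "\<exists>g. arc g \<and> pathstart g = hd xs \<and> pathfinish g = last xs \<and> path_image g = polygon xs"
  using assms
proof (induction xs rule: rev_induct)
  case (snoc y xs)
  have tr: "trail xs" and e: "xs \<noteq> [] \<Longrightarrow> E (last xs) y" using snoc.prems(1) trail_append by auto
  have dist: "distinct xs" "y \<notin> set xs" using snoc.prems(2) by auto
  have ne: "xs \<noteq> []" using snoc.prems(3) by auto
  have exy: "E (last xs) y" by (rule e[OF ne])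
  have ly: "last xs \<noteq> y" using dist ne by force
  have poly: "polygon (xs @ [y]) = polygon xs \<union> closed_segment (last xs) y" by (rule polygon_snoc[OF ne])
  show ?case
  proof (cases "length xs = 1")
    case True
    then obtain x where x: "xs = [x]" by (cases xs) auto
    then show ?thesis using ly
      by (intro exI[of _ "linepath x y"]) (auto simp: arc_linepath)
  next
    case False
    then have "2 \<le> length xs" using ne by (cases xs) (auto simp: Suc_le_eq)
    then obtain g where g: "arc g" "pathstart g = hd xs" "pathfinish g = last xs" "path_image g = polygon xs"
      using snoc.IH tr dist by blast
    have "polygon xs \<inter> closed_segment (last xs) y \<subseteq> {last xs, y} \<inter> set xs"
      by (rule trail_segment_meets[OF tr dist(1) exy]) (use dist(2) in \<open>auto simp: doubleton_eq_iff in_set_conv_nth\<close>)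
    then have "path_image g \<inter> path_image (linepath (last xs) y) \<subseteq> {pathstart (linepath (last xs) y)}"
      using dist(2) g(4) by auto
    then have "arc (g +++ linepath (last xs) y)"
      using g ly by (intro arc_join) (auto simp: arc_linepath)
    moreover have "path_image (g +++ linepath (last xs) y) = polygon (xs @ [y])"
      using g poly by (simp add: path_image_join)
    ultimately show ?thesis using g ne by (intro exI[of _ "g +++ linepath (last xs) y"]) auto
  qed
qed simp

lemma at_most_two: 
  assumes "E x a" "E x b" "E x c" "a \<noteq> b" "a \<noteq> c" "b \<noteq> c"
  shows False
  using two[OF assms(1)] assms by metis

text \<open>A longest simple trail from \<open>x\<^sub>0\<close> can only be continued at its own starting point.\<close>

lemma closed_trail_exists:
  assumes "E x\<^sub>0 y\<^sub>0"
  shows "\<exists>xs. trail xs \<and> distinct xs \<and> 3 \<le> length xs \<and> hd xs = x\<^sub>0 \<and> E (last xs) x\<^sub>0"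
proof -
  define V where "V = {x. \<exists>y. E x y}"
  define P where "P xs \<longleftrightarrow> trail xs \<and> distinct xs \<and> 2 \<le> length xs \<and> hd xs = x\<^sub>0" for xs
  have sub: "set xs \<subseteq> V" if "P xs" for xs
  proof
    fix z assume "z \<in> set xs"
    then obtain i where i: "i < length xs" "z = xs ! i" by (auto simp: in_set_conv_nth)
    have tr: "trail xs" and len: "2 \<le> length xs" using that by (auto simp: P_def)
    show "z \<in> V"
    proof (cases "Suc i < length xs")
      case True then show ?thesis using trail_edge[OF tr True] i by (auto simp: V_def)
    next
      case False
      then obtain j where "i = Suc j" using len i by (cases i) auto
      then show ?thesis using trail_edge[OF tr, of j] i sym by (auto simp: V_def)
    qed
  qed
  have start: "P [x\<^sub>0, y\<^sub>0]" using assms irrefl by (auto simp: P_def)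
  have bound: "\<forall>xs. P xs \<longrightarrow> length xs < Suc (card V)"
    using sub finite_vertices card_mono distinct_card unfolding P_def V_def by (metis le_imp_less_Suc)
  obtain xs where xs: "P xs" and max: "\<And>ys. P ys \<Longrightarrow> length ys \<le> length xs"
    using ex_has_greatest_nat[of P "[x\<^sub>0, y\<^sub>0]" length "Suc (card V)"] start bound by blast
  have tr: "trail xs" and dist: "distinct xs" and len: "2 \<le> length xs" and hd: "hd xs = x\<^sub>0"
    using xs by (auto simp: P_def)
  define k where "k = length xs - 1"
  have k: "k < length xs" "1 \<le> k" "length xs = Suc k" using len by (auto simp: k_def)
  have ne: "xs \<noteq> []" using len by auto
  have last: "last xs = xs ! k" using ne by (simp add: last_conv_nth k_def)
  have prev: "E (xs ! k) (xs ! (k - 1))" using trail_edge[OF tr, of "k - 1"] k sym by simp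
  obtain z where z: "z \<noteq> xs ! (k - 1)" "E (xs ! k) z" using two[OF prev] by blast
  have "z \<in> set xs"
  proof (rule ccontr)
    assume "z \<notin> set xs"
    then have "P (xs @ [z])" using xs ne z(2) last by (auto simp: P_def trail_append)
    then show False using max by fastforce
  qed
  then obtain i where i: "i < length xs" "z = xs ! i" by (auto simp: in_set_conv_nth)
  have "i \<noteq> k" using z(2) i irrefl by auto
  moreover have "i \<noteq> k - 1" using z(1) i by auto
  ultimately have ik: "Suc i < k" using i k by linarith
  have "i = 0"
  proof (rule ccontr)
    assume "i \<noteq> 0"
    then obtain j where j: "i = Suc j" by (cases i) auto
    have "E (xs ! i) (xs ! j)" using trail_edge[OF tr, of j] j i sym by simp
    moreover have "E (xs ! i) (xs ! Suc i)" using trail_edge[OF tr, of i] ik k by simp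
    moreover have "E (xs ! i) (xs ! k)" using z(2) i sym by simp
    moreover have "xs ! j \<noteq> xs ! Suc i" "xs ! j \<noteq> xs ! k" "xs ! Suc i \<noteq> xs ! k"
      using dist j ik k by (auto simp: nth_eq_iff_index_eq)
    ultimately show False using at_most_two by blast
  qed
  then have "z = x\<^sub>0" using i hd ne by (simp add: hd_conv_nth)
  then show ?thesis using tr dist hd z(2) last ik k by (intro exI[of _ xs]) auto
qed

definition carrier :: "'a set" where "carrier = {z. \<exists>a b. E a b \<and> z \<in> closed_segment a b}"

text \<open>The polygon of a closed simple trail is separated from the remaining edges, as each of its
  vertices already has both of its neighbours on it.\<close>

lemma simple_closed_component:
  assumes e: "E x\<^sub>0 y\<^sub>0"
  shows "\<exists>g S. simple_path g \<and> pathfinish g = pathstart g \<and> x\<^sub>0 \<in> path_image g \<and>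
     carrier = path_image g \<union> S \<and> closed S \<and> path_image g \<inter> S = {}"
proof -
  obtain xs where tr: "trail xs" and dist: "distinct xs" and len: "3 \<le> length xs"
    and hd: "hd xs = x\<^sub>0" and closing: "E (last xs) x\<^sub>0"
    using closed_trail_exists[OF e] by blast
  define k where "k = length xs - 1"
  have k: "k < length xs" "2 \<le> k" "length xs = Suc k" using len by (auto simp: k_def)
  have ne: "xs \<noteq> []" using len by auto
  have last: "last xs = xs ! k" using ne by (simp add: last_conv_nth k_def)
  have first: "x\<^sub>0 = xs ! 0" using hd ne by (simp add: hd_conv_nth)
  obtain g where g: "arc g" "pathstart g = x\<^sub>0" "pathfinish g = last xs" "path_image g = polygon xs"
    using simple_trail_arc[OF tr dist] len hd by auto
  define c where "c = g +++ linepath (last xs) x\<^sub>0"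
  have inj: "xs ! i = xs ! j \<longleftrightarrow> i = j" if "i < length xs" "j < length xs" for i j
    using dist that by (simp add: nth_eq_iff_index_eq)
  have lx: "last xs \<noteq> x\<^sub>0" using last first inj k by simp
  have new: "{xs ! i, xs ! Suc i} \<noteq> {last xs, x\<^sub>0}" if "Suc i < length xs" for i
    unfolding last first doubleton_eq_iff using inj[of i k] inj[of i 0] inj[of "Suc i" k] inj[of "Suc i" 0] that k
    by auto
  have "polygon xs \<inter> closed_segment (last xs) x\<^sub>0 \<subseteq> {last xs, x\<^sub>0} \<inter> set xs"
    by (rule trail_segment_meets[OF tr dist closing new])
  then have simple: "simple_path c" unfolding c_def
    using g lx by (intro simple_path_join_loop) (auto simp: arc_linepath)
  have img: "path_image c = polygon xs \<union> closed_segment (last xs) x\<^sub>0"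
    unfolding c_def using g by (simp add: path_image_join)
  define cyc where "cyc a b \<longleftrightarrow> (\<exists>i. Suc i < length xs \<and> {a, b} = {xs ! i, xs ! Suc i}) \<or> {a, b} = {last xs, x\<^sub>0}" for a b
  have cyc_img: "closed_segment a b \<subseteq> path_image c" if "cyc a b" for a b
  proof -
    have seg: "closed_segment a b = closed_segment u v" if "{a, b} = {u, v}" for u v
      using that by (simp add: segment_convex_hull)
    show ?thesis using that unfolding cyc_def img using seg mem_polygon by blast
  qed
  have img_cyc: "\<exists>a b. E a b \<and> cyc a b \<and> z \<in> closed_segment a b" if "z \<in> path_image c" for z
    using that unfolding img cyc_def
  proof (elim UnE)
    assume "z \<in> polygon xs"
    then obtain i where "Suc i < length xs" "z \<in> closed_segment (xs ! i) (xs ! Suc i)" using mem_polygon by blast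
    then show "\<exists>a b. E a b \<and> ((\<exists>i. Suc i < length xs \<and> {a, b} = {xs ! i, xs ! Suc i}) \<or> {a, b} = {last xs, x\<^sub>0}) \<and> z \<in> closed_segment a b"
      using trail_edge[OF tr] by blast
  qed (use closing in blast)
  have cyc_nbr: "cyc (xs ! i) b" if i: "i < length xs" and b: "E (xs ! i) b" for i b
  proof (rule ccontr)
    assume nc: "\<not> cyc (xs ! i) b"
    define s where "s = (if i = k then 0 else Suc i)"
    define p where "p = (if i = 0 then k else i - 1)"
    have cs: "cyc (xs ! i) (xs ! s)" "E (xs ! i) (xs ! s)"
    proof -
      show "E (xs ! i) (xs ! s)" using i k trail_edge[OF tr, of i] closing
        by (auto simp: s_def last first)
      show "cyc (xs ! i) (xs ! s)"
      proof (cases "i = k")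
        case True then show ?thesis by (simp add: s_def cyc_def last first)
      next
        case False
        then show ?thesis using i k unfolding cyc_def by (intro disjI1 exI[of _ i]) (auto simp: s_def)
      qed
    qed
    have cp: "cyc (xs ! i) (xs ! p)" "E (xs ! i) (xs ! p)"
    proof -
      show "E (xs ! i) (xs ! p)"
      proof (cases i)
        case 0 then show ?thesis using closing sym by (auto simp: p_def last first)
      next
        case (Suc j) then show ?thesis using trail_edge[OF tr, of j] i sym by (auto simp: p_def)
      qed
      show "cyc (xs ! i) (xs ! p)"
      proof (cases i)
        case 0 then show ?thesis by (auto simp: p_def cyc_def last first)
      next
        case (Suc j) then show ?thesis using i unfolding cyc_def by (intro disjI1 exI[of _ j]) (auto simp: p_def)
      qed
    qed
    have "s < length xs" "p < length xs" "s \<noteq> p"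
      using i k unfolding s_def p_def by (simp_all split: if_split) linarith+
    then have "xs ! s \<noteq> xs ! p" using inj by simp
    moreover have "b \<noteq> xs ! s" "b \<noteq> xs ! p" using nc cs cp by auto
    ultimately show False using at_most_two[OF cs(2) cp(2) b] by blast
  qed
  have cyc_verts: "a \<in> set xs \<and> b \<in> set xs" if "cyc a b" for a b
  proof -
    obtain u v where "{a, b} = {u, v}" "u \<in> set xs" "v \<in> set xs"
      using \<open>cyc a b\<close> first last k unfolding cyc_def by (metis Suc_lessD nth_mem zero_less_Suc)
    then show ?thesis by (auto simp: doubleton_eq_iff)
  qed
  have cyc_sym: "cyc a b \<longleftrightarrow> cyc b a" for a b by (simp add: cyc_def insert_commute)
  define R where "R = {(a, b). E a b \<and> \<not> cyc a b}"
  define S where "S = (\<Union>(a, b)\<in>R. closed_segment a b)"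
  have "finite R"
  proof (rule finite_subset)
    show "R \<subseteq> {x. \<exists>y. E x y} \<times> {x. \<exists>y. E x y}" using sym by (auto simp: R_def)
  qed (use finite_vertices in blast)
  then have "closed S" unfolding S_def by (intro closed_UN) auto
  moreover have "carrier = path_image c \<union> S"
    using cyc_img img_cyc unfolding carrier_def S_def R_def by fastforce
  moreover have "path_image c \<inter> S = {}"
  proof (rule ccontr)
    assume "path_image c \<inter> S \<noteq> {}"
    then obtain z a b c' d where ab: "E a b" "cyc a b" "z \<in> closed_segment a b"
      and cd: "E c' d" "\<not> cyc c' d" "z \<in> closed_segment c' d"
      using img_cyc unfolding S_def R_def by blast
    have "{a, b} \<noteq> {c', d}" using ab(2) cd(2) by (auto simp: doubleton_eq_iff cyc_sym)
    then have "z \<in> {a, b} \<inter> {c', d}" using cross_at_ends[OF ab(1) cd(1)] ab(3) cd(3) by blast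
    then have "c' \<in> set xs \<or> d \<in> set xs" using cyc_verts[OF ab(2)] by auto
    then show False
    proof
      assume "c' \<in> set xs"
      then show False using cyc_nbr cd by (metis in_set_conv_nth)
    next
      assume "d \<in> set xs"
      then have "cyc d c'" using cyc_nbr cd(1) sym by (metis in_set_conv_nth)
      then show False using cyc_sym cd(2) by blast
    qed
  qed
  moreover have "pathfinish c = pathstart c" using g by (simp add: c_def)
  moreover have "x\<^sub>0 \<in> path_image c" unfolding img by simp
  ultimately show ?thesis using simple by (intro exI[of _ c] exI[of _ S]) simp
qed

end

context immersed_curve
begin

definition pos_edge :: "real^2 \<Rightarrow> real^2 \<Rightarrow> bool" where
  "pos_edge p q \<longleftrightarrow> (\<exists>K w. pos_tri K p q w)"

text \<open>The intersection of two edges is a face of both.\<close>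

lemma positive_edges_meet_at_ends:
  assumes "pos_edge a b" "pos_edge c d" "{a, b} \<noteq> {c, d}"
  shows "closed_segment a b \<inter> closed_segment c d \<subseteq> {a, b} \<inter> {c, d}"
proof -
  obtain K w K' w' where P: "pos_tri K a b w" and P': "pos_tri K' c d w'"
    using assms unfolding pos_edge_def by blast
  note Q = pos_triD[OF P] and Q' = pos_triD[OF P']
  define I where "I = closed_segment a b \<inter> closed_segment c d"
  have F: "I face_of closed_segment a b" "I face_of closed_segment c d"
    using face_of_Int_subface[OF mesh_inter_face[OF Q(2) Q'(2)], of "closed_segment a b" "closed_segment c d"]
      triangle_edge[OF Q(3)] triangle_edge[OF Q'(3)] by (auto simp: edge_of_def I_def)
  have ends: "closed_segment p q = I" if "z \<in> I" "I face_of closed_segment p q" "z \<notin> {p, q}" "I \<subseteq> closed_segment p q" for p q z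
  proof -
    have "z \<in> open_segment p q" using that by (auto simp: open_segment_def)
    then have "p \<in> I" "q \<in> I" using face_ofD[OF that(2) _ _ _ that(1)] by auto
    then have "closed_segment p q \<subseteq> I"
      using face_of_imp_convex[OF that(2)] by (simp add: closed_segment_subset)
    then show ?thesis using that(4) by blast
  qed
  have "z \<in> {a, b} \<inter> {c, d}" if z: "z \<in> I" for z
  proof (rule ccontr)
    assume "z \<notin> {a, b} \<inter> {c, d}"
    then have "closed_segment a b = I \<or> closed_segment c d = I"
      using ends[OF z F(1)] ends[OF z F(2)] by (auto simp: I_def)
    then have f: "closed_segment a b face_of closed_segment c d \<or> closed_segment c d face_of closed_segment a b"
      using F by auto
    have "{p, q} = {u, v}" if "closed_segment p q face_of closed_segment u v" "p \<noteq> q" for p q u v :: "real^2"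
    proof -
      have "x extreme_point_of closed_segment u v" if x: "x \<in> {p, q}" for x
      proof -
        have "x extreme_point_of closed_segment p q" using x by (auto simp: extreme_point_of_segment)
        then show ?thesis using extreme_point_of_face[OF \<open>closed_segment p q face_of _\<close>] by blast
      qed
      then have "p \<in> {u, v}" "q \<in> {u, v}" by (auto simp: extreme_point_of_segment)
      then show ?thesis using that(2) by auto
    qed
    then show False using f assms(3) is_triangleD(2)[OF Q(3)] is_triangleD(2)[OF Q'(3)] by metis
  qed
  then show ?thesis unfolding I_def by blast
qed

lemma pos_edge_graph: "two_regular_graph pos_edge"
proof
  show "pos_edge x y \<Longrightarrow> pos_edge y x" for x y
    using pos_tri_sym unfolding pos_edge_def by blast
  show "\<not> pos_edge x x" for x
    using is_triangleD(2)[OF pos_triD(3)] unfolding pos_edge_def by blast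
  show "finite {x. \<exists>y. pos_edge x y}"
  proof (rule finite_subset)
    show "{x. \<exists>y. pos_edge x y} \<subseteq> (\<Union>K\<in>\<T>. {v. v extreme_point_of K})"
    proof
      fix x assume "x \<in> {x. \<exists>y. pos_edge x y}"
      then obtain y K w where P: "pos_tri K x y w" by (auto simp: pos_edge_def)
      have "x extreme_point_of K" using triangle_extreme_iff[OF pos_triD(3)[OF P]] by simp
      then show "x \<in> (\<Union>K\<in>\<T>. {v. v extreme_point_of K})" using pos_triD(2)[OF P] by blast
    qed
    have "finite {v. v extreme_point_of K}" if K: "K \<in> \<T>" for K
    proof -
      obtain p q w where "is_triangle K p q w" using mesh_triangle[OF K] by blast
      then have "{v. v extreme_point_of K} = {p, q, w}" using triangle_extreme_iff[of K p q w] by auto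
      then show ?thesis by simp
    qed
    then show "finite (\<Union>K\<in>\<T>. {v. v extreme_point_of K})" using finite_mesh by blast
  qed
  show "\<exists>z. z \<noteq> y \<and> pos_edge x z \<and> (\<forall>v. pos_edge x v \<longrightarrow> v = y \<or> v = z)" if "pos_edge x y" for x y
  proof -
    obtain K w where P: "pos_tri K x y w" using \<open>pos_edge x y\<close> by (auto simp: pos_edge_def)
    show ?thesis using two_edges_at_vertex[OF P] unfolding pos_edge_def by blast
  qed
qed (rule positive_edges_meet_at_ends)

text \<open>The part over \<open>\<gamma>\<close> is connected, as the image of \<open>\<gamma>\<close> under the inverse of \<open>\<pi>\<close>. It meets a simple closed polygon
  that is open and closed in \<open>\<Gamma>\<^sub>h\<close>, and connected too, and therefore coincides with it.\<close>

lemma component_simple_closed_curve: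
  assumes comp: "\<And>\<gamma>. \<gamma> \<in> components \<Gamma> \<Longrightarrow> {x\<in>\<Gamma>\<^sub>h. \<pi> x \<in> \<gamma>} \<noteq> {}"
    and \<gamma>: "\<gamma> \<in> components \<Gamma>"
  shows "\<exists>c. simple_path c \<and> pathfinish c = pathstart c \<and> path_image c = {x\<in>\<Gamma>\<^sub>h. \<pi> x \<in> \<gamma>}"
proof -
  interpret graph: two_regular_graph pos_edge by (rule pos_edge_graph)
  obtain g where g: "homeomorphism \<Gamma>\<^sub>h \<Gamma> \<pi> g" using proj_homeomorphism[OF comp] by blast
  define A where "A = {x\<in>\<Gamma>\<^sub>h. \<pi> x \<in> \<gamma>}"
  have con: "connected \<gamma>" and sub: "\<gamma> \<subseteq> \<Gamma>" and ne: "\<gamma> \<noteq> {}"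
    using \<gamma> in_components_connected in_components_subset in_components_nonempty by blast+
  have carrier: "graph.carrier = \<Gamma>\<^sub>h"
    unfolding graph.carrier_def pos_edge_def using mem_Gamma_h by blast
  have into: "\<pi> ` S \<subseteq> \<gamma>" if S: "connected S" "S \<subseteq> \<Gamma>\<^sub>h" "x \<in> S" "\<pi> x \<in> \<gamma>" for S x
  proof (rule components_maximal[OF \<gamma>])
    show "connected (\<pi> ` S)"
      by (rule connected_continuous_image[OF continuous_on_subset[OF continuous_proj] S(1)])
         (use S(2) Gamma_h_subset_U in blast)
    show "\<pi> ` S \<subseteq> \<Gamma>" using homeomorphism_image1[OF g] S(2) by blast
    show "\<gamma> \<inter> \<pi> ` S \<noteq> {}" using S by blast
  qed
  have "A = g ` \<gamma>"
  proof
    show "A \<subseteq> g ` \<gamma>"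
    proof
      fix y assume "y \<in> A"
      then have "y = g (\<pi> y)" "\<pi> y \<in> \<gamma>" using homeomorphism_apply1[OF g] by (simp_all add: A_def)
      then show "y \<in> g ` \<gamma>" by (rule image_eqI)
    qed
    show "g ` \<gamma> \<subseteq> A"
    proof (rule image_subsetI)
      fix \<zeta> assume z: "\<zeta> \<in> \<gamma>"
      then have "g \<zeta> \<in> g ` \<Gamma>" using sub by blast
      then have "g \<zeta> \<in> \<Gamma>\<^sub>h" unfolding homeomorphism_image2[OF g] .
      moreover have "\<pi> (g \<zeta>) = \<zeta>" using homeomorphism_apply2[OF g] z sub by blast
      ultimately show "g \<zeta> \<in> A" using z unfolding A_def by simp
    qed
  qed
  moreover have "continuous_on \<Gamma> g" using g by (simp add: homeomorphism_def)
  ultimately have conA: "connected A"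
    using connected_continuous_image[OF continuous_on_subset[OF _ sub] con] by simp
  obtain x where x: "x \<in> \<Gamma>\<^sub>h" "\<pi> x \<in> \<gamma>" using comp[OF \<gamma>] by blast
  then obtain a b where ab: "pos_edge a b" "x \<in> closed_segment a b"
    using mem_Gamma_h unfolding pos_edge_def by blast
  have seg: "closed_segment a b \<subseteq> \<Gamma>\<^sub>h" using ab(1) mem_Gamma_h unfolding pos_edge_def by blast
  have "\<pi> ` closed_segment a b \<subseteq> \<gamma>" by (rule into[OF _ seg ab(2) x(2)]) simp
  then have aA: "a \<in> A" using seg unfolding A_def by auto
  obtain c S where c: "simple_path c" "pathfinish c = pathstart c" "a \<in> path_image c"
    "\<Gamma>\<^sub>h = path_image c \<union> S" "closed S" "path_image c \<inter> S = {}"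
    using graph.simple_closed_component[OF ab(1)] unfolding carrier by blast
  have "path_image c \<subseteq> A"
  proof -
    have "\<pi> ` path_image c \<subseteq> \<gamma>"
      by (rule into[of _ a]) (use c aA in \<open>auto simp: A_def connected_simple_path_image\<close>)
    then show ?thesis using c(4) unfolding A_def by auto
  qed
  moreover have "A \<subseteq> path_image c"
  proof -
    have "A \<subseteq> path_image c \<union> S" using c(4) by (auto simp: A_def)
    moreover have "closed (path_image c)" using c(1) by (simp add: closed_simple_path_image)
    ultimately have "path_image c \<inter> A = {} \<or> S \<inter> A = {}"
      using conA c(5,6) unfolding connected_closed by blast
    then have "S \<inter> A = {}" using aA c(3) by blast
    then show ?thesis using \<open>A \<subseteq> path_image c \<union> S\<close> by blast
  qed
  ultimately have "path_image c = A" by (rule subset_antisym)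
  then show ?thesis using c(1,2) unfolding A_def by blast
qed

lemma phi_and_jacobian_bounds:
  "\<forall>K\<in>\<P>. \<forall>p q w. is_triangle K p q w \<and> positive_edge_of \<Omega> K (closed_segment p q) \<longrightarrow>
     (\<forall>x\<in>closed_segment p q. - curvature_const \<Omega> K * (diameter K)\<^sup>2 < \<phi> x \<and> \<phi> x \<le> diameter K) \<and>
     (\<exists>\<beta>\<in>{0..pi}.
        cos \<beta> = curvature_const \<Omega> K * shape_parameter K * diameter K
          - (min (\<phi> p) (\<phi> q) - \<phi> w) / diameter K \<and>
        0 < sin (\<beta> - conditioning_angle \<Omega> K) / (1 + max_curvature \<Omega> K * diameter K) \<and>
        (\<forall>x\<in>open_segment p q.
           sin (\<beta> - conditioning_angle \<Omega> K) / (1 + max_curvature \<Omega> K * diameter K) \<le> segment_jacobian \<pi> p q x \<and>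
           \<pi> differentiable (at x) \<and>
           segment_jacobian \<pi> p q x =
             norm (frechet_derivative \<pi> (at x) ((1 / dist p q) *\<^sub>R (p - q))) \<and>
           segment_jacobian \<pi> p q x \<le> 1 / (1 - max_curvature \<Omega> K * diameter K)))"
  (is "\<forall>K\<in>_. \<forall>p q w. _ \<longrightarrow> ?bounds K p q w")
proof (intro ballI allI impI, elim conjE)
  fix K p q w
  assume K: "K \<in> \<P>" "is_triangle K p q w" and e: "positive_edge_of \<Omega> K (closed_segment p q)"
  have KT: "K \<in> \<T>" using K(1) by (simp add: positively_cut_triangles_def)
  obtain v where v: "pos_tri K p q v" using positive_edge_of_pos_tri[OF KT e] by blast
  have "v = w"
    using is_triangle_third[OF pos_triD(3)[OF v] K(2)] is_triangleD(2-4)[OF K(2)]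
      is_triangleD(2-4)[OF pos_triD(3)[OF v]] by (auto simp: doubleton_eq_iff)
  then have P: "pos_tri K p q w" using v by simp
  show "?bounds K p q w" by (rule conjI[OF pos_tri_phi_and_jacobian[OF P]])
qed

end

section \<open>The theorem\<close>

theorem theorem3p1:
  fixes \<Omega> :: "(real^2) set"
    and \<T> :: "(real^2) set set"
    and r\<^sub>n :: real
    and \<Gamma> \<Gamma>\<^sub>h :: "(real^2) set"
    and \<P> :: "(real^2) set set"
    and \<phi> :: "real^2 \<Rightarrow> real"
    and \<pi> :: "real^2 \<Rightarrow> real^2"
    and h \<sigma> M C \<theta> :: "(real^2) set \<Rightarrow> real"
    and part :: "(real^2) set \<Rightarrow> (real^2) set"
  defines "\<Gamma> \<equiv> frontier \<Omega>"
    and "\<phi> \<equiv> signed_distance \<Omega>"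
    and "\<pi> \<equiv> closest_point \<Gamma>"
    and "\<P> \<equiv> positively_cut_triangles \<Omega> \<T>"
    and "\<Gamma>\<^sub>h \<equiv> \<Union>(positive_edges \<Omega> \<T>)"
    and "part \<equiv> (\<lambda>\<gamma>. {x\<in>\<Gamma>\<^sub>h. \<pi> x \<in> \<gamma>})"
    and "h \<equiv> diameter"
    and "\<sigma> \<equiv> shape_parameter"
    and "M \<equiv> max_curvature \<Omega>"
    and "C \<equiv> curvature_const \<Omega>"
    and "\<theta> \<equiv> conditioning_angle \<Omega>"
  assumes "C2_regular_boundary \<Omega>"
    and "tubular_radius \<Omega> r\<^sub>n"
    and "planar_triangulation \<T>"
    and "immersed \<Gamma> \<T>"
    and "\<And>\<gamma>. \<gamma> \<in> components \<Gamma> \<Longrightarrow> part \<gamma> \<noteq> {}"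
    and "\<And>K. K \<in> \<P> \<Longrightarrow> h K < r\<^sub>n"
    and "\<And>K. K \<in> \<P> \<Longrightarrow> \<theta> K < pi / 2"
    and "\<And>K. K \<in> \<P> \<Longrightarrow> 0 < \<sigma> K * C K * h K"
    and "\<And>K. K \<in> \<P> \<Longrightarrow> \<sigma> K * C K * h K < min (cos (\<theta> K)) (sin (\<theta> K / 2))"
    and "\<And>K \<alpha>. K \<in> \<P> \<Longrightarrow> is_adjacent_angle \<Omega> \<T> K \<alpha> \<Longrightarrow> C K * h K < 1 / 2 * sin \<alpha>"
  shows "(\<forall>e\<in>positive_edges \<Omega> \<T>. \<exists>!K. K \<in> \<P> \<and> e edge_of K) \<and>
    (\<forall>p q. closed_segment p q \<in> positive_edges \<Omega> \<T> \<longrightarrow>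
       (\<exists>g. C1_diffeomorphism (open_segment p q) (\<pi> ` open_segment p q) \<pi> g)) \<and>
    (\<forall>K\<in>\<P>. \<forall>p q r. is_triangle K p q r \<and> positive_edge_of \<Omega> K (closed_segment p q) \<longrightarrow>
       (\<forall>x\<in>closed_segment p q. - C K * (h K)\<^sup>2 < \<phi> x \<and> \<phi> x \<le> h K) \<and>
       (\<exists>\<beta>\<in>{0..pi}.
          cos \<beta> = C K * \<sigma> K * h K - (min (\<phi> p) (\<phi> q) - \<phi> r) / h K \<and>
          0 < sin (\<beta> - \<theta> K) / (1 + M K * h K) \<and>
          (\<forall>x\<in>open_segment p q.
             sin (\<beta> - \<theta> K) / (1 + M K * h K) \<le> segment_jacobian \<pi> p q x \<and>
             \<pi> differentiable (at x) \<and>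
             segment_jacobian \<pi> p q x =
               norm (frechet_derivative \<pi> (at x) ((1 / dist p q) *\<^sub>R (p - q))) \<and>
             segment_jacobian \<pi> p q x \<le> 1 / (1 - M K * h K)))) \<and>
    (\<exists>g. homeomorphism \<Gamma>\<^sub>h \<Gamma> \<pi> g) \<and>
    (\<forall>\<gamma>\<in>components \<Gamma>. \<exists>c. simple_path c \<and> pathfinish c = pathstart c \<and>
       path_image c = part \<gamma>)"
proof -
  interpret immersed_curve \<Omega> r\<^sub>n \<T>
    using assms(12-21) unfolding assms(1-11) C2_regular_boundary_def
    by unfold_locales auto
  have comp: "\<And>\<gamma>. \<gamma> \<in> components (frontier \<Omega>) \<Longrightarrow>
      {x \<in> \<Union> (positive_edges \<Omega> \<T>). closest_point (frontier \<Omega>) x \<in> \<gamma>} \<noteq> {}"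
    using assms(16) unfolding assms(1-11) .
  show ?thesis
    unfolding assms(1-11)
  proof (intro conjI phi_and_jacobian_bounds proj_homeomorphism[OF comp])
    show "\<forall>e\<in>positive_edges \<Omega> \<T>. \<exists>!K. K \<in> positively_cut_triangles \<Omega> \<T> \<and> e edge_of K"
      using positive_edge_unique_triangle by blast
    show "\<forall>p q. closed_segment p q \<in> positive_edges \<Omega> \<T> \<longrightarrow>
       (\<exists>g. C1_diffeomorphism (open_segment p q) (closest_point (frontier \<Omega>) ` open_segment p q)
          (closest_point (frontier \<Omega>)) g)"
      using positive_edge_diffeomorphism positive_edges_iff by blast
    show "\<forall>\<gamma>\<in>components (frontier \<Omega>). \<exists>c. simple_path c \<and> pathfinish c = pathstart c \<and>
       path_image c = {x \<in> \<Union> (positive_edges \<Omega> \<T>). closest_point (frontier \<Omega>) x \<in> \<gamma>}"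
      using component_simple_closed_curve[OF comp] by blast
  qed
qed

end
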